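(* Let $A>0$, let $K_n=\mathbb{Q}(\zeta_n)$ with $\zeta_n=e^{2\pi i/n}$, and let $f$ be a random completely multiplicative function on the nonzero integral ideals of $K_n$. Put \[ S_{x,K_n}=\sum_{N(\mathfrak{a})\le x}\frac{f(\mathfrak{a})}{N(\mathfrak{a})}, \] the sum over nonzero integral ideals $\mathfrak{a}$ of $K_n$ with norm at most $x$. If $n<(\log x)^{A}$, then \[ \mathbb{P}(S_{x,K_n}<0)=O\left(\exp\left(-\exp\left(\frac{\ln x}{C(A)\ln_{2}x}\right)\right)\right), \] where $C(A)$ is a positive constant depending only on $A$.
   Context: A random completely multiplicative function on ideals of $K_n$: for each nonzero prime ideal $\mathfrak{p}$, $f(\mathfrak{p})\in\{1,-1\}$ independently with probability $1/2$ each, and for $\mathfrak{a}=\mathfrak{p}_1^{e_1}\cdots\mathfrak{p}_s^{e_s}$, $f(\mathfrak{a})=f(\mathfrak{p}_1)^{e_1}\cdots f(\mathfrak{p}_s)^{e_s}$. $N(\mathfrak{a})$ is the absolute norm. $\ln_2 x=\ln\ln x$. *)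

theory Defs
  imports
    "HOL-Probability.Probability"
    "HOL-Algebra.Algebra"
    "HOL-Algebra.Algebraic_Closure_Type"
begin

text \<open>
  Since \<^term>\<open>cis (2 * pi / real n)\<close> is \<open>exp (2\<pi>i/n)\<close>, this is the subfield of the complex
  numbers generated by the rationals and a primitive \<open>n\<close>-th root of unity (for \<open>n \<ge> 1\<close>).
\<close>
definition cyclotomic_field :: "nat \<Rightarrow> complex set" where
  "cyclotomic_field n =
     generate_field ring_of_type_algebra (insert (cis (2 * pi / real n)) \<rat>)"

definition cyclotomic_integers :: "nat \<Rightarrow> complex ring" where
  "cyclotomic_integers n =
     ring_of_type_algebra\<lparr>carrier := {z \<in> cyclotomic_field n. algebraic_int z}\<rparr>"

definition nonzero_ideals :: "('a, 'b) ring_scheme \<Rightarrow> 'a set set" where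
  "nonzero_ideals R = {I. ideal I R \<and> I \<noteq> {\<zero>\<^bsub>R\<^esub>}}"

definition nonzero_prime_ideals :: "('a, 'b) ring_scheme \<Rightarrow> 'a set set" where
  "nonzero_prime_ideals R = {P. primeideal P R \<and> P \<noteq> {\<zero>\<^bsub>R\<^esub>}}"

text \<open>
  The absolute norm; \<^const>\<open>card\<close> is \<open>0\<close> on infinite sets, but in the ring of integers of a
  number field every nonzero ideal has a finite quotient.
\<close>
definition ideal_norm :: "('a, 'b) ring_scheme \<Rightarrow> 'a set \<Rightarrow> nat" where
  "ideal_norm R I = card (carrier (R Quot I))"

text \<open>
  \<open>F \<omega>\<close> is the realisation at the sample point \<open>\<omega>\<close>. Powers and products of ideals are taken in
  the multiplicative monoid of \<^const>\<open>ideals_set\<close>; the set \<open>S\<close> may be empty, which gives the value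
  \<open>1\<close> at the unit ideal. Values of \<open>F \<omega>\<close> at sets that are not nonzero ideals are unconstrained.
\<close>
definition random_completely_multiplicative ::
  "('a, 'b) ring_scheme \<Rightarrow> 'w measure \<Rightarrow> ('w \<Rightarrow> 'a set \<Rightarrow> real) \<Rightarrow> bool" where
  "random_completely_multiplicative R M F \<longleftrightarrow>
     prob_space M \<and>
     prob_space.indep_vars M (\<lambda>_. borel) (\<lambda>P \<omega>. F \<omega> P) (nonzero_prime_ideals R) \<and>
     (\<forall>P \<in> nonzero_prime_ideals R.
        (\<forall>\<omega> \<in> space M. F \<omega> P \<in> {1, -1}) \<and>
        measure M {\<omega> \<in> space M. F \<omega> P = 1} = 1 / 2 \<and>
        measure M {\<omega> \<in> space M. F \<omega> P = -1} = 1 / 2) \<and>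
     (\<forall>\<omega> \<in> space M. \<forall>S e. finite S \<and> S \<subseteq> nonzero_prime_ideals R \<longrightarrow>
        F \<omega> (finprod (ideals_set R) (\<lambda>P. P [^]\<^bsub>ideals_set R\<^esub> (e P :: nat)) S) =
          (\<Prod>P\<in>S. F \<omega> P ^ e P))"

definition ideal_partial_sum :: "('a, 'b) ring_scheme \<Rightarrow> ('a set \<Rightarrow> real) \<Rightarrow> real \<Rightarrow> real" where
  "ideal_partial_sum R g x =
     (\<Sum>I | I \<in> nonzero_ideals R \<and> real (ideal_norm R I) \<le> x. g I / real (ideal_norm R I))"

end

theory Submission
  imports
    Defs
    "Jordan_Normal_Form.Char_Poly"
    "HOL-Number_Theory.Number_Theory"
    "HOL-Real_Asymp.Real_Asymp"
begin

text \<open>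
  Let \<open>E\<close> be the sum of \<open>1 / N(\<pp>)\<close> over the prime ideals with \<open>N(\<pp>) \<le> x\<close>, and let \<open>y\<close> be
  \<open>exp (ln x / (D ln ln x))\<close> for a large constant \<open>D\<close>. The part of the sum supported on ideals
  composed of primes of norm at most \<open>y\<close> is a truncated Euler product: the full product is at least
  \<open>exp (-2 E)\<close> whatever the signs are, and Rankin's trick shows that the truncation costs
  much less. Bringing in the primes of norm greater than \<open>y\<close> one at a time changes the sum by a small
  martingale difference, up to the even powers, which are negligible; the exponential moment is then
  bounded as in the Azuma--Hoeffding inequality, with total variance at most
  \<open>(ln x) ^ O(1) / y\<close>. This gives a probability of at most \<open>exp (- y powr (1 / 3))\<close>.

  All this requires \<open>E = O(ln ln x)\<close>, uniformly for \<open>n < (ln x) powr A\<close>. For a rational prime \<open>p\<close> not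
  dividing \<open>n\<close> the primes above \<open>p\<close> have norm \<open>q = p ^ f \<equiv> 1 (mod n)\<close> and there are at most
  \<open>\<phi>(n)\<close> of them, so that they contribute at most \<open>\<phi>(n) / q\<close>. The \<open>q \<le> n ^ 4\<close> are distinct
  elements of the progression \<open>1 + k n\<close> and cost \<open>O(ln n)\<close>, higher prime powers beyond \<open>n ^ 4\<close> are
  sparse, and the primes beyond \<open>n ^ 4\<close> are counted by a Brun--Titchmarsh bound.
  The primes dividing \<open>n\<close> are handled through their ramification.
\<close>

text \<open>The obstacle is uniformity in n: allowing phi(n) prime ideals above each rational prime
  gives only E = O(phi(n) ln ln x), useless when n is a power of ln x. The congruence q = 1 (mod n)
  restores the balance, because such p have density 1 / phi(n); the sieve makes this effective as
  soon as p exceeds a fixed power of n. Once E <= c ln ln x, both exp (-2 E) and all the Euler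
  products are powers of ln x. Rankin's loss is exp (10 E - ln x / (2 ln y)) with ln x / ln y = D ln
  ln x, so a D linear in c makes it negligible, while y still exceeds every power of ln x and beats
  the martingale variance. Ideal theory enters through three facts: norms multiply along unique
  factorizations, m divides N(P) - 1, and at most phi(m) primes lie above p, where m is the part of
  n prime to p. For p dividing n the last two bound the contribution of p by 1, and there are O(ln
  n) such p.\<close>

hide_const (open) up_ring.coeff up_ring.monom Polynomials.lead_coeff Polynomials.degree
  Divisibility.prime Coset.order

section \<open>Algebraic integers\<close>

interpretation int_module: Modules.module "\<lambda>(c::int) (z::complex). of_int c * z"
  by unfold_locales (simp_all add: algebra_simps)

text \<open>This rule undoes \<open>of_int_mult\<close>, so that the simplifier would loop.\<close>

declare int_module.scale_scale [simp del]

text \<open>The determinant trick: multiplication by \<open>z\<close> acts on the generators through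
  an integer matrix, so the vector of generators is an eigenvector for \<open>z\<close>, nonzero
  because of \<open>s0\<close>, and \<open>z\<close> is a root of the monic integral characteristic
  polynomial.\<close>

lemma algebraic_int_if_span_stable:
  fixes z :: complex
  assumes fin: "finite S" and stable: "\<And>s. s \<in> S \<Longrightarrow> z * s \<in> int_module.span S"
    and nz: "s0 \<in> S" "s0 \<noteq> 0"
  shows "algebraic_int z"
proof -
  have "\<forall>s\<in>S. \<exists>u. z * s = (\<Sum>t\<in>S. of_int (u t) * t)"
    using stable int_module.span_finite[OF fin] by fastforce
  then obtain u where u: "\<And>s. s \<in> S \<Longrightarrow> z * s = (\<Sum>t\<in>S. of_int (u s t) * t)" by metis
  define n where "n = card S"
  obtain g where g: "bij_betw g {0..<n} S" using ex_bij_betw_nat_finite[OF fin] n_def by auto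
  have gS: "g i \<in> S" if "i < n" for i using g that by (auto simp: bij_betw_def)
  define A :: "int mat" where "A = mat n n (\<lambda>(i,j). u (g i) (g j))"
  have A: "A \<in> carrier_mat n n" by (simp add: A_def)
  let ?A = "map_mat of_int A :: complex mat"
  have A': "?A \<in> carrier_mat n n" using A by simp
  obtain i0 where i0: "i0 < n" "g i0 = s0" using g nz(1) by (auto simp: bij_betw_def)
  let ?v = "vec n g"
  have "?A *\<^sub>v ?v = z \<cdot>\<^sub>v ?v"
  proof (rule eq_vecI)
    fix i assume "i < dim_vec (z \<cdot>\<^sub>v ?v)"
    hence i: "i < n" by simp
    have "vec_index (?A *\<^sub>v ?v) i = (\<Sum>j = 0..<n. of_int (u (g i) (g j)) * g j)"
      using i A by (auto simp: scalar_prod_def A_def intro!: sum.cong)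
    also have "\<dots> = (\<Sum>t\<in>S. of_int (u (g i) t) * t)"
      by (rule sum.reindex_bij_betw[OF g])
    also have "\<dots> = z * g i" using u[OF gS[OF i]] by simp
    finally show "vec_index (?A *\<^sub>v ?v) i = vec_index (z \<cdot>\<^sub>v ?v) i" using i by simp
  qed (use A in simp)
  moreover have "?v \<noteq> 0\<^sub>v n"
  proof
    assume "?v = 0\<^sub>v n"
    hence "vec_index ?v i0 = vec_index (0\<^sub>v n) i0" by simp
    thus False using i0 nz by simp
  qed
  ultimately have "eigenvalue ?A z"
    unfolding eigenvalue_def eigenvector_def using A by (intro exI[of _ ?v]) simp
  hence "poly (char_poly ?A) z = 0" using eigenvalue_root_char_poly[OF A'] by simp
  moreover have cp: "char_poly ?A = map_poly of_int (char_poly A)"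
    by (rule of_int_hom.char_poly_hom[OF A])
  moreover have "lead_coeff (char_poly ?A) = 1"
    using degree_monic_char_poly[OF A'] by simp
  ultimately show ?thesis
    by (intro algebraic_int.intros[of "char_poly ?A"]) (auto simp: coeff_map_poly)
qed

lemma algebraic_int_top_power:
  assumes "algebraic_int (x::complex)"
  obtains a c where "a > 0" "x ^ a = (\<Sum>i<a. of_int (c i) * x ^ i)"
proof -
  from assms obtain p where p: "lead_coeff p = 1" "\<forall>i. coeff p i \<in> \<int>" "poly p x = 0"
    by (auto simp: algebraic_int.simps)
  have "degree p > 0"
  proof (rule ccontr)
    assume "\<not> degree p > 0"
    then obtain c where "p = [:c:]" by (metis degree_eq_zeroE neq0_conv)
    thus False using p by auto
  qed
  moreover have "0 = (\<Sum>i\<le>degree p. coeff p i * x ^ i)" using p(3) by (simp add: poly_altdef)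
  hence "(\<Sum>i<degree p. coeff p i * x ^ i) + x ^ degree p = 0"
    using p(1) by (simp add: lessThan_Suc_atMost[symmetric])
  hence "x ^ degree p = - (\<Sum>i<degree p. coeff p i * x ^ i)"
    by (rule minus_unique[symmetric])
  hence "x ^ degree p = (\<Sum>i<degree p. - coeff p i * x ^ i)"
    by (simp add: sum_negf)
  moreover have "\<forall>i. \<exists>c. - coeff p i = of_int c"
    using p(2) by (metis Ints_cases of_int_minus)
  then obtain c where "\<And>i. - coeff p i = of_int (c i)" by metis
  ultimately show ?thesis using that[of "degree p" c] by simp
qed

text \<open>One finitely generated module stable under both numbers serves for their sum and their
  product alike. It is spanned by the monomials \<open>x ^ i * y ^ j\<close> below the degrees of
  monic equations for \<open>x\<close> and \<open>y\<close>.\<close>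

lemma algebraic_int_span_common:
  assumes x: "algebraic_int (x::complex)" and y: "algebraic_int y"
  obtains S where "finite S" "1 \<in> S"
    "\<And>s. s \<in> int_module.span S \<Longrightarrow> x * s \<in> int_module.span S"
    "\<And>s. s \<in> int_module.span S \<Longrightarrow> y * s \<in> int_module.span S"
proof -
  obtain a c where a: "a > 0" "x ^ a = (\<Sum>i<a. of_int (c i) * x ^ i)"
    using algebraic_int_top_power[OF x] .
  obtain b d where b: "b > 0" "y ^ b = (\<Sum>i<b. of_int (d i) * y ^ i)"
    using algebraic_int_top_power[OF y] .
  define S where "S = (\<lambda>(i,j). x ^ i * y ^ j) ` ({..<a} \<times> {..<b})"
  have inS: "x ^ i * y ^ j \<in> int_module.span S" if "i < a" "j < b" for i j
    by (rule int_module.span_base) (use that in \<open>auto simp: S_def\<close>)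
  have ext: "z * s \<in> int_module.span S"
    if "\<And>s. s \<in> S \<Longrightarrow> z * s \<in> int_module.span S" "s \<in> int_module.span S" for z s
    using that(2)
  proof (induction rule: int_module.span_induct_alt)
    case base thus ?case using int_module.span_zero by simp
  next
    case (step k w s)
    have "of_int k * (z * w) + z * s \<in> int_module.span S"
      using step that(1) by (intro int_module.span_add int_module.span_scale) auto
    thus ?case by (simp add: algebra_simps)
  qed
  have 1: "x * s \<in> int_module.span S" if s: "s \<in> S" for s
  proof -
    obtain i j where ij: "i < a" "j < b" "s = x ^ i * y ^ j" using s by (auto simp: S_def)
    show ?thesis
    proof (cases "Suc i < a")
      case True
      thus ?thesis using inS[OF True ij(2)] by (simp add: ij mult.assoc)
    next
      case False
      hence "Suc i = a" using ij by simp
      hence "x * s = x ^ a * y ^ j" by (auto simp: ij)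
      also have "\<dots> = (\<Sum>k<a. of_int (c k) * (x ^ k * y ^ j))"
        by (simp add: a sum_distrib_right sum_distrib_left mult_ac)
      also have "\<dots> \<in> int_module.span S"
        using ij inS by (intro int_module.span_sum int_module.span_scale) auto
      finally show ?thesis .
    qed
  qed
  have 2: "y * s \<in> int_module.span S" if s: "s \<in> S" for s
  proof -
    obtain i j where ij: "i < a" "j < b" "s = x ^ i * y ^ j" using s by (auto simp: S_def)
    show ?thesis
    proof (cases "Suc j < b")
      case True
      thus ?thesis using inS[OF ij(1) True] by (simp add: ij mult_ac)
    next
      case False
      hence "Suc j = b" using ij by simp
      hence "y * s = x ^ i * y ^ b" by (auto simp: ij)
      also have "\<dots> = (\<Sum>k<b. of_int (d k) * (x ^ i * y ^ k))"
        by (simp add: b sum_distrib_right sum_distrib_left mult_ac)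
      also have "\<dots> \<in> int_module.span S"
        using ij inS by (intro int_module.span_sum int_module.span_scale) auto
      finally show ?thesis .
    qed
  qed
  show ?thesis
  proof (rule that)
    show "finite S" by (simp add: S_def)
    show "1 \<in> S" using a b by (force simp: S_def intro!: image_eqI[of _ _ "(0,0)"])
  qed (auto intro: ext 1 2)
qed

lemma algebraic_int_add [intro]:
  assumes "algebraic_int (x::complex)" "algebraic_int y"
  shows "algebraic_int (x + y)"
proof -
  obtain S where S: "finite S" "1 \<in> S"
    "\<And>s. s \<in> int_module.span S \<Longrightarrow> x * s \<in> int_module.span S"
    "\<And>s. s \<in> int_module.span S \<Longrightarrow> y * s \<in> int_module.span S"
    using algebraic_int_span_common[OF assms] by blast
  show ?thesis
    by (rule algebraic_int_if_span_stable[OF S(1) _ S(2)])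
      (simp_all add: distrib_right int_module.span_add S(3,4) int_module.span_base)
qed

lemma algebraic_int_mult [intro]:
  assumes "algebraic_int (x::complex)" "algebraic_int y"
  shows "algebraic_int (x * y)"
proof -
  obtain S where S: "finite S" "1 \<in> S"
    "\<And>s. s \<in> int_module.span S \<Longrightarrow> x * s \<in> int_module.span S"
    "\<And>s. s \<in> int_module.span S \<Longrightarrow> y * s \<in> int_module.span S"
    using algebraic_int_span_common[OF assms] by blast
  show ?thesis
    by (rule algebraic_int_if_span_stable[OF S(1) _ S(2)])
      (simp_all add: mult.assoc S(3,4) int_module.span_base)
qed

section \<open>Cyclotomic fields\<close>

interpretation rat_vs: Vector_Spaces.vector_space "\<lambda>(q::rat) (z::complex). of_rat q * z"
  by unfold_locales (simp_all add: algebra_simps of_rat_add of_rat_mult)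

declare rat_vs.scale_scale [simp del]

abbreviation rpoly :: "rat poly \<Rightarrow> complex poly" where "rpoly \<equiv> map_poly of_rat"

lemma rpoly_simps:
  "rpoly (p + q) = rpoly p + rpoly q" "rpoly (p * q) = rpoly p * rpoly q"
  "rpoly (p - q) = rpoly p - rpoly q"
  "rpoly (monom c k) = monom (of_rat c) k" "rpoly [:c:] = [:of_rat c:]" "rpoly 1 = 1" "rpoly (- p) = - rpoly p"
proof -
  show "rpoly (p + q) = rpoly p + rpoly q" "rpoly (p - q) = rpoly p - rpoly q"
       "rpoly (monom c k) = monom (of_rat c) k" "rpoly [:c:] = [:of_rat c:]" "rpoly 1 = 1" "rpoly (- p) = - rpoly p"
    by (auto intro!: poly_eqI simp: coeff_map_poly of_rat_add of_rat_diff of_rat_minus coeff_pCons split: nat.splits)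
  show "rpoly (p * q) = rpoly p * rpoly q"
    by (intro poly_eqI) (simp add: coeff_map_poly coeff_mult of_rat_sum of_rat_mult)
qed

text \<open>A nonzero polynomial of least degree vanishing at \<open>z\<close> is coprime to every
  polynomial that does not vanish there. The resulting Bezout identity inverts elements of Q[zeta]
  and shows that no conjugate of zeta has smaller order.\<close>

lemma primitive_common_root:
  fixes m q :: "rat poly"
  assumes m0: "m \<noteq> 0" "poly (rpoly m) z = 0"
    and mn: "\<And>p. p \<noteq> 0 \<Longrightarrow> poly (rpoly p) z = 0 \<Longrightarrow> degree m \<le> degree p"
    and q: "poly (rpoly q) z \<noteq> 0"
  shows "\<exists>a b c. c \<noteq> 0 \<and> a * q + b * m = [:c:]"
proof -
  define g where "g = gcd q m"
  obtain h where h: "m = g * h" using gcd_dvd2[of q m] unfolding g_def by (rule dvdE)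
  obtain k where k: "q = g * k" using gcd_dvd1[of q m] unfolding g_def by (rule dvdE)
  have "poly (rpoly g) z \<noteq> 0" using q k by (auto simp: rpoly_simps)
  hence "poly (rpoly h) z = 0" using m0(2) h by (auto simp: rpoly_simps)
  moreover have "h \<noteq> 0" "g \<noteq> 0" using h m0(1) by auto
  ultimately have "degree m \<le> degree h" using mn by blast
  hence "degree g = 0" using h \<open>h \<noteq> 0\<close> \<open>g \<noteq> 0\<close> by (simp add: degree_mult_eq)
  then obtain c where c: "g = [:c:]" by (metis degree_eq_zeroE)
  obtain a b where "a * q + b * m = g"
    using bezout_coefficients[of q m "fst (bezout_coefficients q m)" "snd (bezout_coefficients q m)"]
    unfolding g_def by simp
  moreover have "c \<noteq> 0" using c \<open>g \<noteq> 0\<close> by auto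
  ultimately show ?thesis using c by blast
qed

definition zeta :: "nat \<Rightarrow> complex" where "zeta n = cis (2 * pi / real n)"

lemma zeta_pow: "zeta n ^ k = cis (2 * pi * real k / real n)"
  by (simp add: zeta_def Complex.DeMoivre mult_ac)

lemma zeta_pow_self [simp]: "n \<ge> 1 \<Longrightarrow> zeta n ^ n = 1"
  by (simp add: zeta_pow)

lemma roots_unity_zeta:
  assumes "n \<ge> 1"
  shows "bij_betw (\<lambda>k. zeta n ^ k) {..<n} {z. z ^ n = 1}"
  using Complex.bij_betw_roots_unity[of n] assms by (simp add: zeta_pow)

lemma zeta_pow_eq_1: assumes "n \<ge> 1" "k < n" "zeta n ^ k = 1" shows "k = 0"
proof -
  have "inj_on (\<lambda>k. zeta n ^ k) {..<n}" using roots_unity_zeta[OF assms(1)] by (simp add: bij_betw_def)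
  thus ?thesis using assms by (auto dest: inj_onD[of _ _ k 0])
qed

lemma card_primitive_roots:
  assumes n: "n \<ge> 1"
  shows "finite {w::complex. w ^ n = 1 \<and> (\<forall>d\<in>{0<..<n}. w ^ d \<noteq> 1)}"
    "card {w::complex. w ^ n = 1 \<and> (\<forall>d\<in>{0<..<n}. w ^ d \<noteq> 1)} \<le> totient n"
proof -
  have "{w::complex. w ^ n = 1 \<and> (\<forall>d\<in>{0<..<n}. w ^ d \<noteq> 1)} \<subseteq> (\<lambda>k. zeta n ^ k) ` totatives n"
  proof safe
    fix w :: complex assume w: "w ^ n = 1" "\<forall>d\<in>{0<..<n}. w ^ d \<noteq> 1"
    obtain k0 where k0: "k0 < n" "w = zeta n ^ k0"
      using w(1) roots_unity_zeta[OF n] by (auto simp: bij_betw_def)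
    \<comment> \<open>\<open>totatives n\<close> is a subset of {1..n}, so the exponent 0, which
      arises for n = 1, is represented by \<open>n\<close>.\<close>
    define k where "k = (if k0 = 0 then n else k0)"
    have k: "0 < k" "k \<le> n" "w = zeta n ^ k" using k0 n by (auto simp: k_def)
    have "coprime k n"
    proof (rule ccontr)
      assume "\<not> coprime k n"
      hence "gcd k n \<noteq> 1" using coprime_iff_gcd_eq_1 by blast
      moreover have "gcd k n \<noteq> 0" using n by simp
      ultimately have g: "gcd k n > 1" by linarith
      have "w ^ (n div gcd k n) = zeta n ^ (n * (k div gcd k n))"
        using div_mult_swap[of "gcd k n" n k] div_mult_swap[of "gcd k n" k n]
        by (simp add: k(3) mult.commute flip: power_mult)
      also have "\<dots> = 1" using n by (simp add: power_mult)
      finally have "w ^ (n div gcd k n) = 1" .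
      moreover have "n div gcd k n \<in> {0<..<n}"
        using g n by (auto simp: div_greater_zero_iff dest: dvd_imp_le)
      ultimately show False using w(2) by blast
    qed
    thus "w \<in> (\<lambda>k. zeta n ^ k) ` totatives n" using k by (auto simp: totatives_def)
  qed
  thus "finite {w::complex. w ^ n = 1 \<and> (\<forall>d\<in>{0<..<n}. w ^ d \<noteq> 1)}"
    "card {w::complex. w ^ n = 1 \<and> (\<forall>d\<in>{0<..<n}. w ^ d \<noteq> 1)} \<le> totient n"
    unfolding totient_def using surj_card_le[of "totatives n" _ "\<lambda>k. zeta n ^ k"]
    by (auto intro: finite_subset)
qed

text \<open>The minimal polynomial divides X^n - 1, hence is squarefree, and by Bezout none of its
  roots has order below n. Its degree is therefore the number of its roots, all of them primitive
  n-th roots of unity.\<close>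

lemma zeta_minpoly:
  assumes n: "n \<ge> 1"
  shows "\<exists>m :: rat poly. m \<noteq> 0 \<and> poly (rpoly m) (zeta n) = 0 \<and>
    (\<forall>p. p \<noteq> 0 \<longrightarrow> poly (rpoly p) (zeta n) = 0 \<longrightarrow> degree m \<le> degree p) \<and> degree m \<le> totient n"
proof -
  define P where "P p \<longleftrightarrow> p \<noteq> 0 \<and> poly (rpoly p) (zeta n) = 0" for p
  define Un1 :: "nat \<Rightarrow> rat poly" where "Un1 d = monom 1 d - 1" for d
  have Xz: "poly (rpoly (Un1 d)) w = w ^ d - 1" for d w
    by (simp add: Un1_def rpoly_simps poly_monom)
  have "poly (rpoly (Un1 n)) 0 \<noteq> 0" unfolding Xz using n by (simp add: power_0_left)
  hence "Un1 n \<noteq> 0" by (intro notI) simp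
  hence "P (Un1 n)" using Xz[of n "zeta n"] n by (simp add: P_def)
  then obtain m where m: "P m" and mn: "\<And>p. P p \<Longrightarrow> degree m \<le> degree p"
    using ex_has_least_nat[of P "Un1 n" degree] by blast
  have mz: "m \<noteq> 0" "poly (rpoly m) (zeta n) = 0" using m by (auto simp: P_def)
  have mn': "degree m \<le> degree p" if "p \<noteq> 0" "poly (rpoly p) (zeta n) = 0" for p
    using mn that by (simp add: P_def)
  have dv: "m dvd p" if "poly (rpoly p) (zeta n) = 0" for p
  proof (rule ccontr)
    assume "\<not> m dvd p"
    hence "p mod m \<noteq> 0" by (simp add: mod_eq_0_iff_dvd)
    moreover have "poly (rpoly (p div m * m + p mod m)) (zeta n) = 0" using that by simp
    hence "poly (rpoly (p mod m)) (zeta n) = 0" using mz by (simp only: rpoly_simps poly_add poly_mult mult_zero_right add_0)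
    ultimately have "degree m \<le> degree (p mod m)" using mn by (auto simp: P_def)
    thus False using degree_mod_less[OF mz(1), of p] \<open>p mod m \<noteq> 0\<close> by auto
  qed
  have "m dvd Un1 n" using \<open>P (Un1 n)\<close> by (intro dv) (simp add: P_def)
  then obtain h where h: "Un1 n = m * h" by auto
  define M where "M = rpoly m"
  have M0: "M \<noteq> 0" using mz(1) by (auto simp: M_def poly_eq_iff coeff_map_poly)
  have Mh: "monom 1 n - 1 = M * rpoly h" using arg_cong[OF h, of rpoly] by (simp add: Un1_def M_def rpoly_simps)
  have root1: "w ^ n = 1" if "poly M w = 0" for w
    using that Xz[of n w] h by (auto simp: M_def rpoly_simps)
  have root2: "w ^ d \<noteq> 1" if w: "poly M w = 0" and d: "d \<in> {0<..<n}" for w d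
  proof
    assume wd: "w ^ d = 1"
    have "poly (rpoly (Un1 d)) (zeta n) \<noteq> 0" using zeta_pow_eq_1[OF n, of d] d by (auto simp: Xz)
    then obtain a b c where c: "c \<noteq> 0" "a * Un1 d + b * m = [:c:]"
      using primitive_common_root[OF mz mn', of "Un1 d"] by auto
    have "poly (rpoly (a * Un1 d + b * m)) w = 0"
      using w wd by (simp add: rpoly_simps Xz M_def)
    thus False using c by (simp add: rpoly_simps)
  qed
  have rs: "rsquarefree M"
    unfolding rsquarefree_roots
  proof (intro allI notI)
    fix a assume a: "poly M a = 0 \<and> poly (pderiv M) a = 0"
    have "poly (pderiv (monom 1 n - 1)) a = 0"
      unfolding Mh using a by (simp add: pderiv_mult)
    hence "of_nat n * a ^ (n - 1) = 0" by (simp add: pderiv_diff pderiv_monom poly_monom pderiv_1)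
    hence "a = 0" using n by auto
    thus False using root1[of a] a n by (simp add: power_0_left)
  qed
  have "degree M = card {z. poly M z = 0}"
  proof -
    have "M = Polynomial.smult (lead_coeff M) (\<Prod>z | poly M z = 0. [:-z, 1:])"
      using complex_poly_decompose_rsquarefree[OF rs] by simp
    hence "degree M = degree (Polynomial.smult (lead_coeff M) (\<Prod>z | poly M z = 0. [:-z, 1:]))" by simp
    also have "\<dots> = degree (\<Prod>z | poly M z = 0. [:-z, 1:])" using M0 by simp
    also have "\<dots> = (\<Sum>z | poly M z = 0. degree [:-z, 1:])" by (rule degree_prod_sum_eq) auto
    finally show ?thesis by simp
  qed
  also have "\<dots> \<le> card {w::complex. w ^ n = 1 \<and> (\<forall>d\<in>{0<..<n}. w ^ d \<noteq> 1)}"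
    by (rule card_mono) (use card_primitive_roots[OF n] root1 root2 in auto)
  also have "\<dots> \<le> totient n" by (rule card_primitive_roots[OF n])
  finally have "degree m \<le> totient n" by (simp add: M_def)
  thus ?thesis using mz mn' by blast
qed

lemma ring_of_type_algebra_simps [simp]:
  "carrier ring_of_type_algebra = UNIV" "x \<otimes>\<^bsub>ring_of_type_algebra\<^esub> y = x * y"
  "x \<oplus>\<^bsub>ring_of_type_algebra\<^esub> y = x + y" "\<zero>\<^bsub>ring_of_type_algebra\<^esub> = 0" "\<one>\<^bsub>ring_of_type_algebra\<^esub> = 1"
  by (simp_all add: ring_of_type_algebra_def)

lemma ring_of_type_algebra_uminus [simp]:
  "\<ominus>\<^bsub>ring_of_type_algebra\<^esub> (x::complex) = - x"
proof -
  interpret field "ring_of_type_algebra :: complex ring" by (rule field_from_type_algebra)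
  show ?thesis using minus_equality[of "- x" x] by simp
qed

lemma ring_of_type_algebra_inv [simp]:
  "x \<noteq> 0 \<Longrightarrow> inv\<^bsub>ring_of_type_algebra\<^esub> (x::complex) = inverse x"
proof -
  assume "x \<noteq> 0"
  interpret field "ring_of_type_algebra :: complex ring" by (rule field_from_type_algebra)
  show ?thesis using comm_inv_char[of x "inverse x"] \<open>x \<noteq> 0\<close> by simp
qed

lemma cyclotomic_field_closed:
  assumes "x \<in> cyclotomic_field n"
  shows "y \<in> cyclotomic_field n \<Longrightarrow> x + y \<in> cyclotomic_field n"
    "y \<in> cyclotomic_field n \<Longrightarrow> x * y \<in> cyclotomic_field n"
    "- x \<in> cyclotomic_field n" "inverse x \<in> cyclotomic_field n"
proof -
  show "y \<in> cyclotomic_field n \<Longrightarrow> x + y \<in> cyclotomic_field n"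
    "y \<in> cyclotomic_field n \<Longrightarrow> x * y \<in> cyclotomic_field n"
    "- x \<in> cyclotomic_field n"
    using generate_field.eng_add[of x ring_of_type_algebra _ y]
      generate_field.eng_mult[of x ring_of_type_algebra _ y]
      generate_field.a_inv[of x ring_of_type_algebra] assms
    by (simp_all add: cyclotomic_field_def)
  show "inverse x \<in> cyclotomic_field n"
    using generate_field.m_inv[of x ring_of_type_algebra] assms
    by (cases "x = 0") (simp_all add: cyclotomic_field_def)
qed

lemma Rats_in_cyclotomic_field: "x \<in> \<rat> \<Longrightarrow> x \<in> cyclotomic_field n"
  by (simp add: cyclotomic_field_def generate_field.incl)

lemma zeta_in_cyclotomic_field: "zeta n \<in> cyclotomic_field n"
  by (simp add: cyclotomic_field_def generate_field.incl zeta_def)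

text \<open>Q[zeta] is already closed under inverses, by the Bezout identity with the minimal
  polynomial.\<close>

lemma cyclotomic_field_poly:
  assumes n: "n \<ge> 1" and z: "z \<in> cyclotomic_field n"
  shows "\<exists>p. z = poly (rpoly p) (zeta n)"
proof -
  obtain m :: "rat poly" where m: "m \<noteq> 0" "poly (rpoly m) (zeta n) = 0"
    and mn: "\<forall>p. p \<noteq> 0 \<longrightarrow> poly (rpoly p) (zeta n) = 0 \<longrightarrow> degree m \<le> degree p"
    and "degree m \<le> totient n"
    using zeta_minpoly[OF n] by auto
  from z show ?thesis
    unfolding cyclotomic_field_def
  proof (induction z rule: generate_field.induct)
    case one
    thus ?case by (intro exI[of _ 1]) (simp add: rpoly_simps)
  next
    case (incl h)
    show ?case
    proof (cases "h \<in> \<rat>")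
      case True
      then obtain r where "h = of_rat r" by (auto simp: Rats_def)
      thus ?thesis by (intro exI[of _ "[:r:]"]) (simp add: rpoly_simps)
    next
      case False
      hence "h = zeta n" using incl by (simp add: zeta_def)
      thus ?thesis by (intro exI[of _ "monom 1 1"]) (simp add: rpoly_simps poly_monom)
    qed
  next
    case (a_inv h)
    then obtain p where "h = poly (rpoly p) (zeta n)" by blast
    thus ?case by (intro exI[of _ "- p"]) (simp add: rpoly_simps)
  next
    case (m_inv h)
    then obtain p where p: "h = poly (rpoly p) (zeta n)" by blast
    hence "poly (rpoly p) (zeta n) \<noteq> 0" using m_inv by simp
    then obtain a b c where c: "c \<noteq> 0" "a * p + b * m = [:c:]"
      using primitive_common_root[OF m mn[rule_format], of p] by auto
    have "poly (rpoly (a * p + b * m)) (zeta n) = of_rat c" by (simp add: c rpoly_simps)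
    hence "poly (rpoly a) (zeta n) * h = of_rat c" using m p by (simp add: rpoly_simps)
    hence A: "poly (rpoly a) (zeta n) = of_rat c / h" using m_inv(2) by (simp add: eq_divide_eq)
    have "of_rat c \<noteq> (0 :: complex)" using c by simp
    hence "inverse h = of_rat (inverse c) * poly (rpoly a) (zeta n)"
      unfolding A of_rat_inverse by (simp add: divide_inverse)
    thus ?case using m_inv by (intro exI[of _ "[:inverse c:] * a"]) (simp add: rpoly_simps del: mult_pCons_left)
  next
    case (eng_add h1 h2)
    then obtain p q where "h1 = poly (rpoly p) (zeta n)" "h2 = poly (rpoly q) (zeta n)" by blast
    thus ?case by (intro exI[of _ "p + q"]) (simp add: rpoly_simps)
  next
    case (eng_mult h1 h2)
    then obtain p q where "h1 = poly (rpoly p) (zeta n)" "h2 = poly (rpoly q) (zeta n)" by blast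
    thus ?case by (intro exI[of _ "p * q"]) (simp add: rpoly_simps)
  qed
qed

text \<open>Reduction modulo the minimal polynomial shows that the powers of zeta below its degree
  span the field.\<close>

lemma cyclotomic_field_independent_card:
  assumes n: "n \<ge> 1" and B: "B \<subseteq> cyclotomic_field n" "rat_vs.independent B"
  shows "finite B \<and> card B \<le> totient n"
proof -
  obtain m :: "rat poly" where m: "m \<noteq> 0" "poly (rpoly m) (zeta n) = 0"
    and mn: "\<forall>p. p \<noteq> 0 \<longrightarrow> poly (rpoly p) (zeta n) = 0 \<longrightarrow> degree m \<le> degree p"
    and d: "degree m \<le> totient n"
    using zeta_minpoly[OF n] by auto
  have dm: "degree m > 0"
  proof (rule ccontr)
    assume "\<not> degree m > 0"
    then obtain c where "m = [:c:]" by (metis degree_eq_zeroE neq0_conv)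
    thus False using m by (auto simp: rpoly_simps)
  qed
  define T where "T = (\<lambda>i. zeta n ^ i) ` {..<degree m}"
  have "B \<subseteq> rat_vs.span T"
  proof
    fix z assume "z \<in> B"
    then obtain p where p: "z = poly (rpoly p) (zeta n)" using cyclotomic_field_poly[OF n] B(1) by blast
    define r where "r = p mod m"
    have r: "degree r < degree m" using degree_mod_less'[OF m(1), of p] dm by (cases "r = 0") (auto simp: r_def)
    have "z = poly (rpoly (p div m * m + r)) (zeta n)" by (simp add: p r_def)
    also have "\<dots> = poly (rpoly r) (zeta n)" using m by (simp only: rpoly_simps poly_add poly_mult mult_zero_right add_0)
    also have "\<dots> = (\<Sum>i\<le>degree r. of_rat (coeff r i) * zeta n ^ i)"
      by (simp add: poly_altdef coeff_map_poly)
    also have "\<dots> \<in> rat_vs.span T"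
      by (intro rat_vs.span_sum rat_vs.span_scale rat_vs.span_base) (use r in \<open>auto simp: T_def\<close>)
    finally show "z \<in> rat_vs.span T" .
  qed
  hence "finite B \<and> card B \<le> card T" using rat_vs.independent_span_bound[OF _ B(2), of T] by (simp add: T_def)
  moreover have "card T \<le> degree m" unfolding T_def using card_image_le[of "{..<degree m}"] by simp
  ultimately show ?thesis using d by simp
qed

section \<open>Quotients of rings of integers\<close>

definition addsub :: "complex set \<Rightarrow> bool" where
  "addsub I \<longleftrightarrow> 0 \<in> I \<and> (\<forall>a\<in>I. \<forall>b\<in>I. a - b \<in> I)"

lemma addsub_0: "addsub I \<Longrightarrow> 0 \<in> I"
  and addsub_diff: "addsub I \<Longrightarrow> a \<in> I \<Longrightarrow> b \<in> I \<Longrightarrow> a - b \<in> I"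
  by (auto simp: addsub_def)

lemma addsub_uminus: "addsub I \<Longrightarrow> a \<in> I \<Longrightarrow> - a \<in> I"
  using addsub_diff[of I 0 a] addsub_0[of I] by simp

lemma addsub_add: "addsub I \<Longrightarrow> a \<in> I \<Longrightarrow> b \<in> I \<Longrightarrow> a + b \<in> I"
  using addsub_diff[of I a "- b"] addsub_uminus[of I b] by simp

lemma addsub_sum: "addsub I \<Longrightarrow> (\<And>x. x \<in> A \<Longrightarrow> f x \<in> I) \<Longrightarrow> sum f A \<in> I"
  by (induction A rule: infinite_finite_induct) (auto intro: addsub_0 addsub_add)

lemma addsub_of_nat_mult: "addsub I \<Longrightarrow> a \<in> I \<Longrightarrow> of_nat k * a \<in> I"
  by (induction k) (auto intro: addsub_0 addsub_add simp: distrib_right)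

lemma addsub_of_int_mult: "addsub I \<Longrightarrow> a \<in> I \<Longrightarrow> of_int k * a \<in> I"
  by (cases k rule: int_cases2) (auto intro: addsub_of_nat_mult addsub_uminus)

text \<open>For an ideal these sets are exactly the elements of the quotient ring; see
  \<open>ideal_norm_eq\<close>.\<close>

definition coset_of :: "complex set \<Rightarrow> complex \<Rightarrow> complex set" where
  "coset_of I x = (\<lambda>i. x + i) ` I"

lemma coset_of_eq_iff:
  assumes "addsub I"
  shows "coset_of I x = coset_of I y \<longleftrightarrow> x - y \<in> I"
proof
  assume "coset_of I x = coset_of I y"
  moreover have "x \<in> coset_of I x" using addsub_0[OF assms] by (auto simp: coset_of_def intro!: image_eqI[of _ _ 0])
  ultimately show "x - y \<in> I" by (auto simp: coset_of_def)
next
  assume xy: "x - y \<in> I"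
  have "x + i \<in> coset_of I y" if "i \<in> I" for i
    using addsub_add[OF assms xy that] by (auto simp: coset_of_def intro!: image_eqI[of _ _ "x - y + i"])
  moreover have "y + i \<in> coset_of I x" if "i \<in> I" for i
    using addsub_diff[OF assms that xy] by (auto simp: coset_of_def intro!: image_eqI[of _ _ "i - (x - y)"])
  ultimately show "coset_of I x = coset_of I y" unfolding coset_of_def[of I x] coset_of_def[of I y] by (auto simp: coset_of_def)
qed

text \<open>The index formula [A:C] = [A:B][B:C]: choose a representative of each coset of B and
  translate by it the cosets of C inside B. The bijection is stated explicitly because finiteness is
  inferred from it as well as cardinality, \<open>card\<close> being 0 on infinite sets.\<close>

lemma bij_betw_cosets_tower:
  assumes A: "addsub A" and B: "addsub B" and C: "addsub C" and CB: "C \<subseteq> B" and BA: "B \<subseteq> A"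
  shows "bij_betw (\<lambda>(U,Y). (\<lambda>y. (SOME x. x \<in> A \<and> coset_of B x = U) + y) ` Y)
    (coset_of B ` A \<times> coset_of C ` B) (coset_of C ` A)"
proof -
  define r where "r U = (SOME x. x \<in> A \<and> coset_of B x = U)" for U
  have r: "r U \<in> A" "coset_of B (r U) = U" if "U \<in> coset_of B ` A" for U
    using someI_ex[of "\<lambda>x. x \<in> A \<and> coset_of B x = U"] that by (auto simp: r_def)
  have tr: "(\<lambda>y. a + y) ` coset_of C b = coset_of C (a + b)" for a b
    by (simp add: coset_of_def image_image add.assoc)
  have "bij_betw (\<lambda>(U,Y). (\<lambda>y. r U + y) ` Y) (coset_of B ` A \<times> coset_of C ` B) (coset_of C ` A)"
    unfolding bij_betw_def
  proof (intro conjI inj_onI)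
    fix u v assume u: "u \<in> coset_of B ` A \<times> coset_of C ` B" and v: "v \<in> coset_of B ` A \<times> coset_of C ` B"
      and eq: "(\<lambda>(U,Y). (\<lambda>y. r U + y) ` Y) u = (\<lambda>(U,Y). (\<lambda>y. r U + y) ` Y) v"
    obtain U b U' b' where U: "u = (U, coset_of C b)" "v = (U', coset_of C b')" "U \<in> coset_of B ` A"
      "U' \<in> coset_of B ` A" "b \<in> B" "b' \<in> B" using u v by (cases u; cases v) auto
    have e: "(r U + b) - (r U' + b') \<in> C" using eq by (simp add: U tr coset_of_eq_iff[OF C])
    have "(r U + b) - (r U' + b') - b + b' \<in> B"
      by (rule addsub_add[OF B addsub_diff[OF B subsetD[OF CB e] U(5)] U(6)])
    hence "r U - r U' \<in> B" by (simp add: algebra_simps)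
    hence "U = U'" using r[OF U(3)] r[OF U(4)] coset_of_eq_iff[OF B] by metis
    thus "u = v" using e U by (simp add: coset_of_eq_iff[OF C])
  next
    show "(\<lambda>(U,Y). (\<lambda>y. r U + y) ` Y) ` (coset_of B ` A \<times> coset_of C ` B) = coset_of C ` A"
    proof safe
      fix U Y a b assume "a \<in> A" "b \<in> B"
      thus "(\<lambda>y. r (coset_of B a) + y) ` coset_of C b \<in> coset_of C ` A"
        using r[of "coset_of B a"] BA addsub_add[OF A] by (auto simp: tr)
    next
      fix a assume a: "a \<in> A"
      define U where "U = coset_of B a"
      have "U \<in> coset_of B ` A" using a by (simp add: U_def)
      note rU = r[OF this]
      have "a - r U \<in> B" using rU(2) coset_of_eq_iff[OF B, of a "r U"] U_def by simp
      hence "(U, coset_of C (a - r U)) \<in> coset_of B ` A \<times> coset_of C ` B" using a U_def by auto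
      moreover have "coset_of C a = (\<lambda>(U,Y). (\<lambda>y. r U + y) ` Y) (U, coset_of C (a - r U))"
        by (simp add: tr)
      ultimately show "coset_of C a \<in> (\<lambda>(U,Y). (\<lambda>y. r U + y) ` Y) ` (coset_of B ` A \<times> coset_of C ` B)"
        by (metis image_eqI)
    qed
  qed
  thus ?thesis by (simp add: r_def)
qed

lemma card_cosets_mult:
  assumes "addsub A" "addsub B" "addsub C" "C \<subseteq> B" "B \<subseteq> A"
  shows "card (coset_of C ` A) = card (coset_of B ` A) * card (coset_of C ` B)"
  using bij_betw_same_card[OF bij_betw_cosets_tower[OF assms]] by (simp add: card_cartesian_product)

lemma finite_cosets_tower:
  assumes "addsub A" "addsub B" "addsub C" "C \<subseteq> B" "B \<subseteq> A"
    "finite (coset_of B ` A)" "finite (coset_of C ` B)"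
  shows "finite (coset_of C ` A)"
  using bij_betw_finite[OF bij_betw_cosets_tower[OF assms(1-5)]] assms(6,7) by simp

lemma rat_common_denominator:
  fixes u :: "'a \<Rightarrow> rat"
  assumes "finite B"
  shows "\<exists>D::int. D > 0 \<and> (\<forall>b\<in>B. \<exists>k::int. u b * of_int D = of_int k)"
  using assms
proof induction
  case empty
  thus ?case by (intro exI[of _ 1]) auto
next
  case (insert x B)
  then obtain D :: int where D: "D > 0" "\<And>b. b \<in> B \<Longrightarrow> \<exists>k::int. u b * of_int D = of_int k" by blast
  obtain a d where ad: "quotient_of (u x) = (a, d)" by fastforce
  have d: "d > 0" "u x = of_int a / of_int d"
    using quotient_of_denom_pos[OF ad] quotient_of_div[OF ad] by auto
  have "\<exists>k::int. u b * of_int (D * d) = of_int k" if b: "b \<in> insert x B" for b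
  proof (cases "b = x")
    case True
    thus ?thesis using d by (intro exI[of _ "a * D"]) simp
  next
    case False
    then obtain k where "u b * of_int D = of_int k" using D b by blast
    thus ?thesis by (intro exI[of _ "k * d"]) (simp add: mult.assoc[symmetric])
  qed
  thus ?case using D d by (intro exI[of _ "D * d"]) auto
qed

text \<open>The last assumption is the bound [K : Q] <= deg, phrased without the choice of a
  basis.\<close>

locale number_ring =
  fixes K :: "complex set" and deg :: nat
  assumes K_add: "x \<in> K \<Longrightarrow> y \<in> K \<Longrightarrow> x + y \<in> K"
    and K_mult: "x \<in> K \<Longrightarrow> y \<in> K \<Longrightarrow> x * y \<in> K"
    and K_uminus: "x \<in> K \<Longrightarrow> - x \<in> K"
    and K_inverse: "x \<in> K \<Longrightarrow> inverse x \<in> K"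
    and K_Rats: "x \<in> \<rat> \<Longrightarrow> x \<in> K"
    and K_indep: "B \<subseteq> K \<Longrightarrow> rat_vs.independent B \<Longrightarrow> finite B \<and> card B \<le> deg"
begin

definition OK :: "complex set" where "OK = {z \<in> K. algebraic_int z}"

lemma OK_add: "x \<in> OK \<Longrightarrow> y \<in> OK \<Longrightarrow> x + y \<in> OK"
  and OK_mult: "x \<in> OK \<Longrightarrow> y \<in> OK \<Longrightarrow> x * y \<in> OK"
  and OK_uminus: "x \<in> OK \<Longrightarrow> - x \<in> OK"
  and OK_of_int: "of_int k \<in> OK"
  by (auto simp: OK_def intro: K_add K_mult K_uminus K_Rats)

lemma OK_of_nat: "of_nat k \<in> OK" using OK_of_int[of "int k"] by simp
lemma OK_0: "0 \<in> OK" and OK_1: "1 \<in> OK" using OK_of_int[of 0] OK_of_int[of 1] by auto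

lemma OK_diff: "x \<in> OK \<Longrightarrow> y \<in> OK \<Longrightarrow> x - y \<in> OK"
  using OK_add[of x "- y"] OK_uminus[of y] by simp

lemma OK_power: "x \<in> OK \<Longrightarrow> x ^ k \<in> OK"
  by (induction k) (auto intro: OK_1 OK_mult)

lemma OK_sum: "(\<And>x. x \<in> A \<Longrightarrow> f x \<in> OK) \<Longrightarrow> sum f A \<in> OK"
  by (induction A rule: infinite_finite_induct) (auto intro: OK_0 OK_add)

lemma OK_prod: "(\<And>x. x \<in> A \<Longrightarrow> f x \<in> OK) \<Longrightarrow> prod f A \<in> OK"
  by (induction A rule: infinite_finite_induct) (auto intro: OK_1 OK_mult)

lemma addsub_OK: "addsub OK" by (simp add: addsub_def OK_0 OK_diff)

text \<open>A maximal set that is independent modulo \<open>I\<close> gives a basis of the quotient over the field with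
  \<open>p\<close> elements. It is independent over the rationals: in a primitive integral relation
  all coefficients would be divisible by \<open>p\<close>.\<close>

lemma card_quotient_char_p:
  fixes p :: nat
  assumes p: "prime p" and I: "addsub I" "I \<subseteq> OK" and pI: "\<And>x. x \<in> OK \<Longrightarrow> of_nat p * x \<in> I"
  shows "finite (coset_of I ` OK) \<and> (\<exists>k\<le>deg. card (coset_of I ` OK) = p ^ k)"
proof -
  define free where "free B \<longleftrightarrow> B \<subseteq> OK \<and> finite B \<and>
    (\<forall>c::complex \<Rightarrow> int. (\<Sum>b\<in>B. of_int (c b) * b) \<in> I \<longrightarrow> (\<forall>b\<in>B. int p dvd c b))" for B
  have free_card: "card B \<le> deg" if B: "free B" for B
  proof -
    have fin: "finite B" and BK: "B \<subseteq> K" using B by (auto simp: free_def OK_def)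
    have "rat_vs.independent B"
    proof
      assume "rat_vs.dependent B"
      then obtain u v where u: "v \<in> B" "u v \<noteq> 0" "(\<Sum>b\<in>B. of_rat (u b) * b) = 0"
        using rat_vs.dependent_finite[OF fin] by auto
      obtain D :: int where D: "D > 0" "\<forall>b\<in>B. \<exists>k::int. u b * of_int D = of_int k"
        using rat_common_denominator[OF fin, of u] by blast
      then obtain c :: "complex \<Rightarrow> int" where c: "\<And>b. b \<in> B \<Longrightarrow> u b * of_int D = of_int (c b)" by metis
      have "of_int D * (\<Sum>b\<in>B. of_rat (u b) * b) = (\<Sum>b\<in>B. of_int (c b) * b)"
      proof -
        have "of_int D * (of_rat (u b) * b) = of_int (c b) * b" if "b \<in> B" for b
        proof -
          have "of_rat (u b * of_int D) = (of_int (c b) :: complex)" using c[OF that] by simp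
          hence "of_rat (u b) * of_int D = (of_int (c b) :: complex)" by (simp add: of_rat_mult)
          thus ?thesis by (simp add: algebra_simps)
        qed
        thus ?thesis unfolding sum_distrib_left by (rule sum.cong[OF refl])
      qed
      hence c0: "(\<Sum>b\<in>B. of_int (c b) * b) = 0" using u by simp
      have "of_int (c v) \<noteq> (0::rat)" using c[OF u(1)] u(2) D(1) by (metis less_irrefl mult_eq_0_iff of_int_eq_0_iff)
      hence cv: "c v \<noteq> 0" by simp
      define g where "g = Gcd (c ` B)"
      have g: "g \<noteq> 0" "g > 0" and gd: "\<And>b. b \<in> B \<Longrightarrow> g dvd c b"
        using cv u(1) Gcd_int_greater_eq_0[of "c ` B"] by (auto simp: g_def Gcd_0_iff order.strict_iff_order)
      have "of_int g * (\<Sum>b\<in>B. of_int (c b div g) * b) = (\<Sum>b\<in>B. of_int (c b) * b)"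
        unfolding sum_distrib_left
      proof (rule sum.cong)
        fix b assume "b \<in> B"
        hence "of_int (g * (c b div g)) = (of_int (c b) :: complex)" using gd by simp
        thus "of_int g * (of_int (c b div g) * b) = of_int (c b) * b"
          unfolding of_int_mult by (simp add: mult.assoc[symmetric])
      qed simp
      hence "(\<Sum>b\<in>B. of_int (c b div g) * b) = 0" using c0 g by simp
      hence pd: "\<And>b. b \<in> B \<Longrightarrow> int p dvd c b div g"
        using B addsub_0[OF I(1)] unfolding free_def by (auto elim!: allE[of _ "\<lambda>b. c b div g"])
      have "int p * g dvd c b" if b: "b \<in> B" for b
      proof -
        obtain k where k: "c b = g * k" using gd[OF b] by (elim dvdE)
        hence "int p dvd k" using pd[OF b] g by simp
        thus ?thesis by (simp add: k mult.commute)
      qed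
      hence "int p * g dvd g" unfolding g_def by (intro Gcd_greatest) auto
      hence "int p * g dvd 1 * g" by simp
      hence "int p dvd 1" using g by (subst (asm) dvd_mult_cancel_right) simp
      thus False using p prime_gt_1_nat[OF p] by auto
    qed
    thus ?thesis using K_indep[OF BK] by simp
  qed
  have "free {}" by (simp add: free_def)
  then obtain B where B: "free B" and Bmax: "\<And>B'. free B' \<Longrightarrow> card B' \<le> card B"
    using ex_has_greatest_nat[of free "{}" card "Suc deg"] free_card by (auto simp: less_Suc_eq_le)
  have fin: "finite B" and BO: "B \<subseteq> OK" using B by (auto simp: free_def)
  define comb where "comb c = (\<Sum>b\<in>B. of_int (c b) * b)" for c :: "complex \<Rightarrow> int"
  have free_dvd: "int p dvd c b" if "comb c \<in> I" "b \<in> B" for c b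
    using B that by (auto simp: free_def comb_def)
  have combO: "comb c \<in> OK" for c
    unfolding comb_def using BO by (auto intro!: OK_sum OK_mult OK_of_int)
  have pint: "of_int (int p * k) * x \<in> I" if "x \<in> OK" for k x
    using addsub_of_int_mult[OF I(1) pI[OF that], of k] by (simp add: mult_ac)
  have comb_diff: "comb c - comb c' = comb (\<lambda>b. c b - c' b)" for c c'
    by (simp add: comb_def left_diff_distrib sum_subtractf)
  have rep: "\<exists>c. x - comb c \<in> I" if x: "x \<in> OK" for x
  proof (cases "x \<in> B")
    case True
    have "comb (\<lambda>b. if b = x then 1 else 0) = (\<Sum>b\<in>B. if b = x then b else 0)"
      unfolding comb_def by (rule sum.cong) auto
    also have "\<dots> = x" using True fin by (simp add: sum.delta)
    finally show ?thesis using addsub_0[OF I(1)] by (intro exI[of _ "\<lambda>b. if b = x then 1 else 0"]) simp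
  next
    case False
    hence "\<not> free (insert x B)" using Bmax[of "insert x B"] fin by auto
    then obtain c :: "complex \<Rightarrow> int" where c: "(\<Sum>b\<in>insert x B. of_int (c b) * b) \<in> I"
      "\<not> (\<forall>b\<in>insert x B. int p dvd c b)" using x BO fin by (auto simp: free_def)
    have c1: "of_int (c x) * x + comb c \<in> I" using c(1) False fin by (simp add: comb_def)
    have "\<not> int p dvd c x"
    proof
      assume d: "int p dvd c x"
      hence "of_int (c x) * x \<in> I" using pint[OF x] by (auto elim!: dvdE)
      hence "comb c \<in> I" using addsub_diff[OF I(1) c1, of "of_int (c x) * x"] by simp
      hence "\<forall>b\<in>B. int p dvd c b" using B by (auto simp: free_def comb_def)
      thus False using c(2) d by auto
    qed
    hence "coprime (int p) (c x)" using p by (simp add: prime_imp_coprime)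
    hence "gcd (c x) (int p) = 1" by (simp add: gcd.commute)
    \<comment> \<open>\<open>s\<close> inverts \<open>c x\<close> modulo \<open>p\<close>, so the
      relation can be solved for \<open>x\<close> modulo \<open>I\<close>.\<close>
    then obtain s t where st: "s * c x + t * int p = 1"
      using bezout_int[of "c x" "int p"] by auto
    have neg: "comb (\<lambda>b. - s * c b) = - (of_int s * comb c)"
      unfolding comb_def sum_distrib_left sum_negf[symmetric] by (rule sum.cong) (simp_all add: mult.assoc)
    have "x - comb (\<lambda>b. - s * c b) = of_int (s * c x + t * int p) * x + of_int s * comb c"
      unfolding st neg by simp
    also have "\<dots> = of_int s * (of_int (c x) * x + comb c) + of_int (int p * t) * x"
      by (simp add: algebra_simps)
    also have "\<dots> \<in> I"
      by (intro addsub_add[OF I(1)] addsub_of_int_mult[OF I(1)] c1 pint x)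
    finally show ?thesis by blast
  qed
  have "bij_betw (\<lambda>c. coset_of I (comb c)) (B \<rightarrow>\<^sub>E {0..<int p}) (coset_of I ` OK)"
    unfolding bij_betw_def
  proof (intro conjI inj_onI)
    fix c c' assume c: "c \<in> B \<rightarrow>\<^sub>E {0..<int p}" "c' \<in> B \<rightarrow>\<^sub>E {0..<int p}"
      and "coset_of I (comb c) = coset_of I (comb c')"
    hence "comb (\<lambda>b. c b - c' b) \<in> I" by (simp add: coset_of_eq_iff[OF I(1)] comb_diff)
    hence d: "\<forall>b\<in>B. int p dvd c b - c' b" using free_dvd[of "\<lambda>b. c b - c' b"] by simp
    have "c b = c' b" if "b \<in> B" for b
    proof -
      have "c b \<in> {0..<int p}" "c' b \<in> {0..<int p}" using c that by auto
      moreover have "c b mod int p = c' b mod int p" using d that by (simp add: mod_eq_dvd_iff)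
      ultimately show ?thesis by simp
    qed
    thus "c = c'" using c by (intro PiE_ext) auto
  next
    show "(\<lambda>c. coset_of I (comb c)) ` (B \<rightarrow>\<^sub>E {0..<int p}) = coset_of I ` OK"
    proof safe
      fix x assume x: "x \<in> OK"
      obtain c where c: "x - comb c \<in> I" using rep[OF x] by blast
      define c' where "c' = restrict (\<lambda>b. c b mod int p) B"
      have "comb c - comb c' = (\<Sum>b\<in>B. of_int (int p * (c b div int p)) * b)"
        unfolding comb_diff by (simp add: comb_def c'_def minus_mod_eq_mult_div)
      also have "\<dots> \<in> I" using pint BO by (intro addsub_sum[OF I(1)]) auto
      finally have "(x - comb c) + (comb c - comb c') \<in> I" by (intro addsub_add[OF I(1)] c)
      hence "coset_of I x = coset_of I (comb c')" by (simp add: coset_of_eq_iff[OF I(1)])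
      moreover have "c' \<in> B \<rightarrow>\<^sub>E {0..<int p}" using prime_gt_0_nat[OF p] by (auto simp: c'_def)
      ultimately show "coset_of I x \<in> (\<lambda>c. coset_of I (comb c)) ` (B \<rightarrow>\<^sub>E {0..<int p})" by blast
    qed (use combO in auto)
  qed
  hence 1: "card (coset_of I ` OK) = card (B \<rightarrow>\<^sub>E {0..<int p})"
    and 2: "finite (coset_of I ` OK) \<longleftrightarrow> finite (B \<rightarrow>\<^sub>E {0..<int p})"
    by (auto dest: bij_betw_same_card bij_betw_finite)
  have "card (B \<rightarrow>\<^sub>E {0..<int p}) = p ^ card B" using fin by (simp add: card_PiE)
  moreover have "finite (B \<rightarrow>\<^sub>E {0..<int p})" using fin by (intro finite_PiE) auto
  ultimately show ?thesis using 1 2 free_card[OF B] by metis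
qed

end

section \<open>Unique factorization of ideals\<close>

lemma UN_constant_eq: "a \<in> A \<Longrightarrow> (\<And>z. z \<in> A \<Longrightarrow> f z = c) \<Longrightarrow> (\<Union>z\<in>A. f z) = c"
  by fastforce

text \<open>The coset of \<open>x\<close> modulo \<open>B\<close> is the union of the cosets
  \<open>coset_of B z\<close> over \<open>z\<close> in \<open>coset_of C x\<close>, hence a function
  of the latter.\<close>

lemma finite_cosets_mono:
  assumes B: "addsub B" and C: "C \<subseteq> B" "0 \<in> C" and fin: "finite (coset_of C ` A)"
  shows "finite (coset_of B ` A)" "card (coset_of B ` A) \<le> card (coset_of C ` A)"
proof -
  have eq: "coset_of B x = (\<Union>z\<in>coset_of C x. coset_of B z)" for x
  proof -
    have "coset_of B z = coset_of B x" if "z \<in> coset_of C x" for z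
    proof -
      obtain i where "i \<in> C" "z = x + i" using \<open>z \<in> coset_of C x\<close> by (auto simp: coset_of_def)
      thus ?thesis using C by (auto simp: coset_of_eq_iff[OF B])
    qed
    moreover have "x \<in> coset_of C x" using C by (auto simp: coset_of_def intro!: image_eqI[of _ _ 0])
    ultimately show ?thesis by (intro UN_constant_eq[symmetric])
  qed
  have "coset_of B ` A = (\<lambda>Z. \<Union>z\<in>Z. coset_of B z) ` (coset_of C ` A)"
    unfolding image_image by (rule image_cong[OF refl eq])
  thus "finite (coset_of B ` A)" "card (coset_of B ` A) \<le> card (coset_of C ` A)"
    using fin by (auto intro: card_image_le)
qed

lemma coset_pigeonhole:
  assumes I: "addsub I" and fin: "finite (coset_of I ` A)" and a: "\<And>k::nat. a k \<in> A"
  shows "\<exists>i j. i < j \<and> a j - a i \<in> I"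
proof -
  have "finite (range (\<lambda>k. coset_of I (a k)))" using a by (intro finite_subset[OF _ fin]) auto
  hence "\<not> inj (\<lambda>k. coset_of I (a k))" using finite_imageD by blast
  then obtain i j where "i \<noteq> j" "coset_of I (a i) = coset_of I (a j)" by (auto simp: inj_def)
  hence "i < j \<and> a j - a i \<in> I \<or> j < i \<and> a i - a j \<in> I"
    by (metis coset_of_eq_iff[OF I] linorder_neqE_nat)
  thus ?thesis by blast
qed

context number_ring
begin

definition RK :: "complex ring" where "RK = ring_of_type_algebra\<lparr>carrier := OK\<rparr>"

lemma RK_simps [simp]:
  "carrier RK = OK" "x \<otimes>\<^bsub>RK\<^esub> y = x * y" "x \<oplus>\<^bsub>RK\<^esub> y = x + y" "\<zero>\<^bsub>RK\<^esub> = 0" "\<one>\<^bsub>RK\<^esub> = 1"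
  by (simp_all add: RK_def ring_of_type_algebra_def)

lemma cring_RK: "cring RK"
proof (rule cringI)
  show "abelian_group RK"
    by (rule abelian_groupI) (auto intro: OK_add OK_0 OK_uminus simp: add_ac intro!: bexI[of _ "- _"])
  show "Group.comm_monoid RK"
    by (rule comm_monoidI) (auto intro: OK_mult OK_1 simp: mult_ac)
qed (simp add: distrib_right)

interpretation RK: cring RK by (rule cring_RK)

lemma RK_uminus: "x \<in> OK \<Longrightarrow> \<ominus>\<^bsub>RK\<^esub> x = - x"
  using RK.minus_equality[of "- x" x] OK_uminus[of x] by simp

definition is_ideal :: "complex set \<Rightarrow> bool" where
  "is_ideal I \<longleftrightarrow> I \<subseteq> OK \<and> addsub I \<and> (\<forall>r\<in>OK. \<forall>a\<in>I. r * a \<in> I)"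

lemma is_idealD: "is_ideal I \<Longrightarrow> I \<subseteq> OK" "is_ideal I \<Longrightarrow> addsub I"
  "is_ideal I \<Longrightarrow> r \<in> OK \<Longrightarrow> a \<in> I \<Longrightarrow> r * a \<in> I" "is_ideal I \<Longrightarrow> r \<in> OK \<Longrightarrow> a \<in> I \<Longrightarrow> a * r \<in> I"
  by (auto simp: is_ideal_def mult.commute)

lemma is_ideal_OK: "is_ideal OK" by (auto simp: is_ideal_def addsub_OK OK_mult)

lemma is_ideal_1: "is_ideal I \<Longrightarrow> 1 \<in> I \<longleftrightarrow> I = OK"
  using is_idealD(3)[of I _ 1] is_idealD(1)[of I] OK_1 by auto

lemma ideal_iff: "ideal I RK \<longleftrightarrow> is_ideal I"
proof
  assume I: "ideal I RK"
  interpret ideal I RK by fact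
  show "is_ideal I" unfolding is_ideal_def addsub_def
  proof (intro conjI ballI)
    show IO: "I \<subseteq> OK" using a_subset by simp
    show "0 \<in> I" using zero_closed by simp
    show "r * a \<in> I" if "r \<in> OK" "a \<in> I" for r a using I_l_closed[of a r] that by simp
    show "a - b \<in> I" if ab: "a \<in> I" "b \<in> I" for a b
    proof -
      have "- b \<in> I" using I_l_closed[OF ab(2), of "- 1"] OK_of_int[of "- 1"] by simp
      thus ?thesis using a_closed[OF ab(1), of "- b"] by simp
    qed
  qed
next
  assume I: "is_ideal I"
  note D = is_idealD(1,2)[OF I]
  show "ideal I RK"
  proof (rule idealI)
    show "ring RK" by (rule RK.ring_axioms)
    show "subgroup I (add_monoid RK)"
    proof (unfold_locales)
      show "I \<subseteq> carrier (add_monoid RK)" using D by simp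
      show "\<one>\<^bsub>add_monoid RK\<^esub> \<in> I" using addsub_0[OF D(2)] by simp
      show "x \<otimes>\<^bsub>add_monoid RK\<^esub> y \<in> I" if "x \<in> I" "y \<in> I" for x y
        using addsub_add[OF D(2) that] by simp
      show "inv\<^bsub>add_monoid RK\<^esub> x \<in> I" if "x \<in> I" for x
        using addsub_uminus[OF D(2) that] RK_uminus[of x] D(1) that by (auto simp: a_inv_def)
    qed
  qed (use is_idealD(3,4)[OF I] in auto)
qed

definition is_prime :: "complex set \<Rightarrow> bool" where
  "is_prime P \<longleftrightarrow> is_ideal P \<and> P \<noteq> OK \<and> P \<noteq> {0} \<and> (\<forall>a\<in>OK. \<forall>b\<in>OK. a * b \<in> P \<longrightarrow> a \<in> P \<or> b \<in> P)"

lemma is_primeD: assumes "is_prime P"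
  shows "is_ideal P" "P \<noteq> OK" "P \<noteq> {0}" "a \<in> OK \<Longrightarrow> b \<in> OK \<Longrightarrow> a * b \<in> P \<Longrightarrow> a \<in> P \<or> b \<in> P" "1 \<notin> P"
  using assms is_ideal_1[of P] by (auto simp: is_prime_def)

lemma nonzero_primeideal_iff: "primeideal P RK \<and> P \<noteq> {0} \<longleftrightarrow> is_prime P"
proof
  assume P: "primeideal P RK \<and> P \<noteq> {0}"
  then interpret primeideal P RK by simp
  show "is_prime P"
    unfolding is_prime_def using P I_prime I_notcarr ideal_iff is_ideal by auto
next
  assume "is_prime P"
  note D = is_primeD[OF this]
  have "primeideal P RK"
  proof (rule primeidealI)
    show "ideal P RK" using D(1) by (simp add: ideal_iff)
    show "cring RK" by (rule cring_RK)
    show "carrier RK \<noteq> P" using D(2) by simp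
    show "a \<in> P \<or> b \<in> P" if "a \<in> carrier RK" "b \<in> carrier RK" "a \<otimes>\<^bsub>RK\<^esub> b \<in> P" for a b
      using D(4)[of a b] that by simp
  qed
  thus "primeideal P RK \<and> P \<noteq> {0}" using D(3) by simp
qed

definition nrm :: "complex set \<Rightarrow> nat" where "nrm I = card (coset_of I ` OK)"

lemma ideal_norm_eq: "is_ideal I \<Longrightarrow> ideal_norm RK I = nrm I"
proof -
  assume "is_ideal I"
  have "I +>\<^bsub>RK\<^esub> x = coset_of I x" for x
    by (auto simp: a_r_coset_def r_coset_def coset_of_def add.commute)
  hence "carrier (RK Quot I) = coset_of I ` OK"
    by (auto simp: FactRing_def A_RCOSETS_def RCOSETS_def a_r_coset_def)
  thus ?thesis by (simp add: ideal_norm_def nrm_def)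
qed

lemma ideal_prod_subset:
  assumes "addsub C" "\<And>a b. a \<in> A \<Longrightarrow> b \<in> B \<Longrightarrow> a * b \<in> C"
  shows "ideal_prod RK A B \<subseteq> C"
proof
  fix x assume "x \<in> ideal_prod RK A B"
  thus "x \<in> C" by induction (auto intro: assms addsub_add)
qed

lemma ideal_prod_I: "a \<in> A \<Longrightarrow> b \<in> B \<Longrightarrow> a * b \<in> ideal_prod RK A B"
  using ideal_prod.prod[of a A b B RK] by simp

lemma ideal_prod_plus: "x \<in> ideal_prod RK A B \<Longrightarrow> y \<in> ideal_prod RK A B \<Longrightarrow> x + y \<in> ideal_prod RK A B"
  using ideal_prod.sum[of x RK A B y] by simp

lemma ideal_prod_mono: "A \<subseteq> A' \<Longrightarrow> B \<subseteq> B' \<Longrightarrow> ideal_prod RK A B \<subseteq> ideal_prod RK A' B'"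
proof
  fix x assume AB: "A \<subseteq> A'" "B \<subseteq> B'" and "x \<in> ideal_prod RK A B"
  from this(3) show "x \<in> ideal_prod RK A' B'"
    by induction (use AB in \<open>auto intro: ideal_prod_I ideal_prod_plus\<close>)
qed

lemma ideal_prod_comm: "ideal_prod RK A B = ideal_prod RK B A"
proof -
  have "x \<in> ideal_prod RK B A" if "x \<in> ideal_prod RK A B" for x and A B :: "complex set"
    using that
  proof induction
    case (prod i j) thus ?case using ideal_prod_I[of j B i A] by (simp add: mult.commute)
  qed (auto intro: ideal_prod_plus)
  thus ?thesis by blast
qed

lemma ideal_prod_assoc1: "ideal_prod RK A (ideal_prod RK B C) \<subseteq> ideal_prod RK (ideal_prod RK A B) C"
proof
  fix x assume "x \<in> ideal_prod RK A (ideal_prod RK B C)"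
  thus "x \<in> ideal_prod RK (ideal_prod RK A B) C"
  proof induction
    case (prod a t)
    from prod(2) have "a * t \<in> ideal_prod RK (ideal_prod RK A B) C"
    proof induction
      case (prod b c)
      thus ?case using ideal_prod_I[OF ideal_prod_I[OF \<open>a \<in> A\<close> prod(1)] prod(2)] by (simp add: mult.assoc)
    next
      case (sum s t) thus ?case using ideal_prod_plus by (simp add: distrib_left)
    qed
    thus ?case by simp
  qed (auto intro: ideal_prod_plus)
qed

lemma ideal_prod_assoc: "ideal_prod RK A (ideal_prod RK B C) = ideal_prod RK (ideal_prod RK A B) C"
  using ideal_prod_assoc1[of A B C] ideal_prod_assoc1[of C B A] ideal_prod_comm by (metis subset_antisym)

text \<open>The submodules of K over the ring of integers. Inverses of ideals live here, and
  \<open>ideal_prod\<close> extends to them.\<close>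

definition is_mod :: "complex set \<Rightarrow> bool" where
  "is_mod A \<longleftrightarrow> A \<subseteq> K \<and> addsub A \<and> (\<forall>r\<in>OK. \<forall>a\<in>A. r * a \<in> A)"

lemma is_ideal_is_mod: "is_ideal A \<Longrightarrow> is_mod A"
  by (auto simp: is_ideal_def is_mod_def OK_def)

lemma is_ideal_iff_mod: "is_ideal A \<longleftrightarrow> is_mod A \<and> A \<subseteq> OK"
  by (auto simp: is_ideal_def is_mod_def OK_def)

lemma ideal_prod_one: "is_mod A \<Longrightarrow> ideal_prod RK OK A = A"
proof -
  assume A: "is_mod A"
  hence "ideal_prod RK OK A \<subseteq> A" by (intro ideal_prod_subset) (auto simp: is_mod_def)
  moreover have "A \<subseteq> ideal_prod RK OK A"
    using ideal_prod_I[OF OK_1] by fastforce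
  ultimately show ?thesis by blast
qed

lemma is_mod_ideal_prod: assumes A: "is_mod A" and B: "is_mod B" shows "is_mod (ideal_prod RK A B)"
proof -
  have AB: "A \<subseteq> K" "B \<subseteq> K" "addsub A" "addsub B" using A B by (auto simp: is_mod_def)
  have 1: "ideal_prod RK A B \<subseteq> K"
  proof
    fix x assume "x \<in> ideal_prod RK A B"
    thus "x \<in> K" by induction (use AB in \<open>auto intro: K_add K_mult\<close>)
  qed
  have 2: "r * x \<in> ideal_prod RK A B" if x: "x \<in> ideal_prod RK A B" and r: "r \<in> OK" for r x
    using x
  proof induction
    case (prod a b)
    hence "r * a \<in> A" using A r by (auto simp: is_mod_def)
    from ideal_prod_I[OF this prod(2)] show ?case by (simp add: mult.assoc)
  qed (auto intro: ideal_prod_plus simp: distrib_left)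
  have 3: "0 \<in> ideal_prod RK A B" using ideal_prod_I[OF addsub_0 addsub_0] AB by fastforce
  have "a - b \<in> ideal_prod RK A B" if "a \<in> ideal_prod RK A B" "b \<in> ideal_prod RK A B" for a b
    using ideal_prod_plus[OF that(1) 2[OF that(2), of "- 1"]] OK_of_int[of "- 1"] by simp
  thus ?thesis using 1 2 3 by (auto simp: is_mod_def addsub_def)
qed

lemma is_ideal_ideal_prod: "is_ideal A \<Longrightarrow> is_ideal B \<Longrightarrow> is_ideal (ideal_prod RK A B)"
  using RK.ideal_prod_is_ideal[of A B] by (simp add: ideal_iff)

lemma ideal_prod_subset_right: "is_ideal A \<Longrightarrow> is_ideal B \<Longrightarrow> ideal_prod RK A B \<subseteq> B"
  by (intro ideal_prod_subset) (auto dest: is_idealD)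

lemma ideal_prod_subset_left: "is_ideal A \<Longrightarrow> is_ideal B \<Longrightarrow> ideal_prod RK A B \<subseteq> A"
  by (intro ideal_prod_subset) (auto dest: is_idealD)

definition princ :: "complex \<Rightarrow> complex set" where "princ a = (\<lambda>x. a * x) ` OK"

lemma is_ideal_princ: "a \<in> OK \<Longrightarrow> is_ideal (princ a)"
  unfolding is_ideal_def addsub_def princ_def
proof (intro conjI ballI)
  fix r x assume "r \<in> OK" "x \<in> (\<lambda>x. a * x) ` OK"
  thus "r * x \<in> (\<lambda>x. a * x) ` OK" by (auto intro!: image_eqI[of _ _ "r * _"] OK_mult)
next
  fix x y assume "x \<in> (\<lambda>x. a * x) ` OK" "y \<in> (\<lambda>x. a * x) ` OK"
  thus "x - y \<in> (\<lambda>x. a * x) ` OK" by (auto simp: right_diff_distrib[symmetric] OK_diff)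
qed (auto intro: OK_mult OK_0 intro!: image_eqI[of _ _ 0])

definition id_plus :: "complex set \<Rightarrow> complex \<Rightarrow> complex set" where
  "id_plus I a = {i + a * r | i r. i \<in> I \<and> r \<in> OK}"

lemma id_plus_I: "i \<in> I \<Longrightarrow> r \<in> OK \<Longrightarrow> i + a * r \<in> id_plus I a"
  by (auto simp: id_plus_def)

lemma is_ideal_id_plus:
  assumes I: "is_ideal I" and a: "a \<in> OK"
  shows "is_ideal (id_plus I a)" "I \<subseteq> id_plus I a" "a \<in> id_plus I a"
proof -
  note D = is_idealD[OF I]
  show "is_ideal (id_plus I a)" unfolding is_ideal_def addsub_def
  proof (intro conjI ballI)
    show "id_plus I a \<subseteq> OK" using D(1) a by (auto simp: id_plus_def intro!: OK_add OK_mult)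
    show "0 \<in> id_plus I a" using id_plus_I[OF addsub_0[OF D(2)] OK_0] by simp
    show "x - y \<in> id_plus I a" if xy: "x \<in> id_plus I a" "y \<in> id_plus I a" for x y
    proof -
      obtain i r j s where "x = i + a * r" "y = j + a * s" "i \<in> I" "j \<in> I" "r \<in> OK" "s \<in> OK"
        using xy by (auto simp: id_plus_def)
      thus ?thesis using id_plus_I[of "i - j" I "r - s" a] addsub_diff[OF D(2)] OK_diff
        by (simp add: algebra_simps)
    qed
    show "r * x \<in> id_plus I a" if r: "r \<in> OK" and x: "x \<in> id_plus I a" for r x
    proof -
      obtain i s where "x = i + a * s" "i \<in> I" "s \<in> OK" using x by (auto simp: id_plus_def)
      thus ?thesis using id_plus_I[of "r * i" I "r * s" a] D(3)[OF r] OK_mult[OF r]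
        by (simp add: algebra_simps)
    qed
  qed
  show "I \<subseteq> id_plus I a" using id_plus_I[OF _ OK_0, of _ I a] by auto
  show "a \<in> id_plus I a" using id_plus_I[OF addsub_0[OF D(2)] OK_1] by simp
qed

text \<open>A monic integral equation for \<open>a\<close>, freed of powers of X, has a nonzero
  constant term, and the equation exhibits this integer as a multiple of \<open>a\<close>.\<close>

lemma nat_in_princ:
  assumes a: "a \<in> OK" "a \<noteq> 0"
  shows "\<exists>m::nat. m > 0 \<and> of_nat m \<in> princ a"
proof -
  have "algebraic_int a" using a by (simp add: OK_def)
  then obtain p where p: "lead_coeff p = 1" "\<forall>i. coeff p i \<in> \<int>" "poly p a = 0"
    by (auto simp: algebraic_int.simps)
  hence p0: "p \<noteq> 0" by auto
  \<comment> \<open>\<open>q\<close> keeps the integer coefficients of \<open>p\<close>, shifted by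
    the multiplicity of the root 0.\<close>
  obtain q where q: "p = [:-0, 1:] ^ order 0 p * q" "\<not> [:-0, 1:] dvd q" using order_decomp[OF p0, of 0] by blast
  have q': "p = monom 1 (order 0 p) * q" using q(1) by (simp add: monom_altdef)
  have cq: "coeff q i = coeff p (i + order 0 p)" for i
    by (subst q') (simp add: coeff_monom_mult)
  have "poly q a = 0" using p(3) a(2) by (subst (asm) q') (simp add: poly_monom)
  moreover have "poly q 0 \<noteq> 0" using q(2) by (simp add: poly_eq_0_iff_dvd)
  moreover have "poly q a = coeff q 0 + a * (\<Sum>i<degree q. coeff q (Suc i) * a ^ i)"
    by (simp add: poly_altdef lessThan_Suc_atMost[symmetric] sum.lessThan_Suc_shift sum_distrib_left mult_ac
        del: sum.lessThan_Suc)
  ultimately have *: "a * (\<Sum>i<degree q. coeff q (Suc i) * a ^ i) = - coeff q 0" "coeff q 0 \<noteq> 0"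
    by (auto simp: add_eq_0_iff poly_0_coeff_0)
  have "(\<Sum>i<degree q. coeff q (Suc i) * a ^ i) \<in> OK"
  proof (intro OK_sum OK_mult OK_power a)
    fix i show "coeff q (Suc i) \<in> OK" using p(2) OK_of_int by (metis Ints_cases cq)
  qed
  hence c: "- coeff q 0 \<in> princ a" using * by (auto simp: princ_def intro!: image_eqI[of _ _ "(\<Sum>i<degree q. coeff q (Suc i) * a ^ i)"])
  obtain k :: int where k: "coeff q 0 = of_int k" using p(2) cq by (metis Ints_cases)
  have "of_nat (nat \<bar>k\<bar>) = (if k < 0 then - coeff q 0 else - (- coeff q 0))" by (simp add: k)
  also have "\<dots> \<in> princ a" using c addsub_uminus[OF is_idealD(2)[OF is_ideal_princ[OF a(1)]] c] by simp
  finally show ?thesis using *(2) k by (intro exI[of _ "nat \<bar>k\<bar>"]) auto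
qed

lemma princ_subset: "is_ideal I \<Longrightarrow> a \<in> I \<Longrightarrow> princ a \<subseteq> I"
  by (auto simp: princ_def dest: is_idealD(4))

text \<open>Induction over the prime factors: multiplication by \<open>m\<close> carries the cosets
  of (p) in the ring to the cosets of (p m) in (m), and the tower of indices does the rest.\<close>

lemma finite_cosets_princ_nat: "m > 0 \<Longrightarrow> finite (coset_of (princ (of_nat m)) ` OK)"
proof (induction m rule: prime_divisors_induct)
  case (unit m)
  hence "princ (of_nat m) = OK" by (auto simp: princ_def)
  moreover have "coset_of OK ` OK \<subseteq> {OK}"
    using coset_of_eq_iff[OF addsub_OK, of _ 0] by (auto simp: coset_of_def)
  ultimately show ?case by (metis finite.emptyI finite_insert finite_subset)
next
  case (factor p m)
  hence p: "prime p" and m: "m > 0" by auto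
  have pid: "is_ideal (princ (of_nat k))" for k by (intro is_ideal_princ OK_of_nat)
  have fp: "finite (coset_of (princ (of_nat p)) ` OK)"
    using card_quotient_char_p[OF p is_idealD(2,1)[OF pid]] by (auto simp: princ_def)
  have eq: "princ (of_nat (p * m)) = (\<lambda>x. of_nat m * x) ` princ (of_nat p)"
    by (simp add: princ_def image_image mult_ac)
  have "coset_of (princ (of_nat (p * m))) ` princ (of_nat m) =
      (\<lambda>Z. (\<lambda>x. of_nat m * x) ` Z) ` (coset_of (princ (of_nat p)) ` OK)"
    unfolding eq by (simp add: princ_def[of "of_nat m"] image_image coset_of_def distrib_left)
  hence "finite (coset_of (princ (of_nat (p * m))) ` princ (of_nat m))" using fp by simp
  moreover have "of_nat (p * m) \<in> princ (of_nat m)"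
    unfolding princ_def by (rule image_eqI[of _ _ "of_nat p"]) (simp_all add: OK_of_nat mult.commute)
  hence "princ (of_nat (p * m)) \<subseteq> princ (of_nat m)" by (rule princ_subset[OF pid])
  ultimately show ?case
    using finite_cosets_tower[OF addsub_OK is_idealD(2)[OF pid[of m]] is_idealD(2)[OF pid[of "p * m"]] _
      is_idealD(1)[OF pid] factor.IH[OF m]] by blast
qed auto

lemma is_ideal_nonzero: "is_ideal I \<Longrightarrow> I \<noteq> {0} \<Longrightarrow> \<exists>a\<in>I. a \<noteq> 0"
  using addsub_0[OF is_idealD(2)] by blast

lemma nat_in_ideal:
  assumes I: "is_ideal I" "I \<noteq> {0}"
  shows "\<exists>m::nat. m > 0 \<and> of_nat m \<in> I"
proof -
  obtain a where a: "a \<in> I" "a \<noteq> 0" using is_ideal_nonzero[OF I] by blast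
  hence "a \<in> OK" using is_idealD(1)[OF I(1)] by blast
  thus ?thesis using nat_in_princ[of a] a princ_subset[OF I(1) a(1)] by blast
qed

lemma finite_cosets:
  assumes I: "is_ideal I" "I \<noteq> {0}"
  shows "finite (coset_of I ` OK)"
proof -
  obtain m :: nat where m: "m > 0" "of_nat m \<in> I" using nat_in_ideal[OF I] by blast
  show ?thesis
    by (rule finite_cosets_mono(1)[OF is_idealD(2)[OF I(1)] princ_subset[OF I(1) m(2)] _ finite_cosets_princ_nat[OF m(1)]])
      (auto intro!: addsub_0 is_idealD(2) is_ideal_princ OK_of_nat)
qed

lemma nrm_pos: assumes "is_ideal I" "I \<noteq> {0}" shows "nrm I > 0"
  using finite_cosets[OF assms] OK_0 by (auto simp: nrm_def card_gt_0_iff)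

lemma nrm_mult_index:
  assumes "is_ideal I" "is_ideal J" "I \<subseteq> J"
  shows "nrm I = nrm J * card (coset_of I ` J)"
  unfolding nrm_def using assms by (intro card_cosets_mult addsub_OK) (auto dest: is_idealD)

text \<open>Makes the norm a measure for Noetherian induction: enlarging an ideal lowers it, since
  the index is at least 2.\<close>

lemma nrm_strict_mono:
  assumes I: "is_ideal I" "I \<noteq> {0}" and J: "is_ideal J" "I \<subset> J"
  shows "nrm J < nrm I"
proof -
  have fin: "finite (coset_of I ` J)"
    using is_idealD(1)[OF J(1)] by (intro finite_subset[OF _ finite_cosets[OF I]]) auto
  obtain j where j: "j \<in> J" "j \<notin> I" using J by blast
  have z: "0 \<in> J" using addsub_0[OF is_idealD(2)[OF J(1)]] .
  have "coset_of I 0 \<noteq> coset_of I j"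
    using j addsub_uminus[OF is_idealD(2)[OF I(1)], of "- j"] by (auto simp: coset_of_eq_iff[OF is_idealD(2)[OF I(1)]])
  hence "card {coset_of I 0, coset_of I j} = 2" by simp
  hence c: "2 \<le> card (coset_of I ` J)" using card_mono[OF fin, of "{coset_of I 0, coset_of I j}"] j z by auto
  have "J \<noteq> {0}" using j addsub_0[OF is_idealD(2)[OF I(1)]] by auto
  hence "nrm J > 0" using nrm_pos J by blast
  have "nrm J * 2 \<le> nrm J * card (coset_of I ` J)" using c by (rule mult_le_mono2)
  thus ?thesis using nrm_mult_index[OF I(1) J(1)] J(2) \<open>nrm J > 0\<close> by auto
qed

text \<open>A finite integral domain is a field: for \<open>a\<close> outside \<open>P\<close> two
  powers of \<open>a\<close> agree modulo \<open>P\<close>, and cancelling the smaller one gives a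
  power congruent to 1.\<close>

lemma prime_maximal:
  assumes P: "is_prime P" and J: "is_ideal J" "P \<subseteq> J" "J \<noteq> P"
  shows "J = OK"
proof -
  note D = is_primeD[OF P]
  obtain a where a: "a \<in> J" "a \<notin> P" using J by blast
  have aO: "a \<in> OK" using a J is_idealD(1) by blast
  obtain i j where ij: "i < j" "a ^ j - a ^ i \<in> P"
    using coset_pigeonhole[OF is_idealD(2)[OF D(1)] finite_cosets[OF D(1,3)], of "\<lambda>k. a ^ k"] OK_power[OF aO] by blast
  have np: "a ^ k \<notin> P" for k
  proof (induction k)
    case 0 thus ?case using D(5) by simp
  next
    case (Suc k) thus ?case using D(4)[OF aO OK_power[OF aO], of k] a(2) by auto
  qed
  have "a ^ i * (a ^ (j - i) - 1) \<in> P" using ij by (simp add: algebra_simps flip: power_add)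
  hence "a ^ (j - i) - 1 \<in> P" using D(4)[of "a ^ i" "a ^ (j - i) - 1"] np aO OK_power OK_diff OK_1 by blast
  moreover have "a ^ (j - i) \<in> J" using is_idealD(4)[OF J(1) OK_power[OF aO] a(1), of "j - i - 1"] ij(1)
    by (simp add: Suc_diff_Suc flip: power_Suc)
  ultimately have "a ^ (j - i) - (a ^ (j - i) - 1) \<in> J"
    using J(2) addsub_diff[OF is_idealD(2)[OF J(1)], of "a ^ (j - i)" "a ^ (j - i) - 1"] by auto
  thus ?thesis using is_ideal_1[OF J(1)] by simp
qed

text \<open>Products of ideals are avoided by speaking about all products of elements.\<close>

lemma contains_prime_products:
  assumes "is_ideal I" "I \<noteq> {0}"
  shows "\<exists>Ps. (\<forall>P\<in>set Ps. is_prime P) \<and> (\<forall>xs. list_all2 (\<in>) xs Ps \<longrightarrow> prod_list xs \<in> I)"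
  using assms
proof (induction "nrm I" arbitrary: I rule: less_induct)
  case less
  note I = less.prems
  note D = is_idealD[OF I(1)]
  consider "I = OK" | "is_prime I" | "I \<noteq> OK" "\<not> is_prime I" by blast
  thus ?case
  proof cases
    case 1
    thus ?thesis using OK_1 by (intro exI[of _ "[]"]) auto
  next
    case 2
    thus ?thesis by (intro exI[of _ "[I]"]) (auto simp: list_all2_Cons2)
  next
    case 3
    then obtain a b where ab: "a \<in> OK" "b \<in> OK" "a * b \<in> I" "a \<notin> I" "b \<notin> I"
      using I by (auto simp: is_prime_def)
    \<comment> \<open>Both \<open>I + (a)\<close> and \<open>I + (b)\<close> have smaller norm than
      \<open>I\<close>, and their product lies in \<open>I\<close> because \<open>a * b\<close>
      does.\<close>
    have step: "\<exists>Ps. (\<forall>P\<in>set Ps. is_prime P) \<and> (\<forall>xs. list_all2 (\<in>) xs Ps \<longrightarrow> prod_list xs \<in> id_plus I c)"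
      if "c \<in> OK" "c \<notin> I" for c
    proof (rule less.hyps)
      note c = is_ideal_id_plus[OF I(1) that(1)]
      show "is_ideal (id_plus I c)" by (rule c)
      show "id_plus I c \<noteq> {0}" using c that addsub_0[OF D(2)] by auto
      show "nrm (id_plus I c) < nrm I" using c that by (intro nrm_strict_mono I) auto
    qed
    obtain Ps Qs where Ps: "\<forall>P\<in>set Ps. is_prime P" "\<And>xs. list_all2 (\<in>) xs Ps \<Longrightarrow> prod_list xs \<in> id_plus I a"
      and Qs: "\<forall>P\<in>set Qs. is_prime P" "\<And>xs. list_all2 (\<in>) xs Qs \<Longrightarrow> prod_list xs \<in> id_plus I b"
      using step[OF ab(1,4)] step[OF ab(2,5)] by metis
    have "prod_list xs \<in> I" if xs: "list_all2 (\<in>) xs (Ps @ Qs)" for xs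
    proof -
      obtain us vs where uv: "xs = us @ vs" "list_all2 (\<in>) us Ps" "list_all2 (\<in>) vs Qs"
        using xs by (auto simp: list_all2_append2)
      obtain i r j s where u: "prod_list us = i + a * r" "i \<in> I" "r \<in> OK"
        and v: "prod_list vs = j + b * s" "j \<in> I" "s \<in> OK"
        using Ps(2)[OF uv(2)] Qs(2)[OF uv(3)] by (auto simp: id_plus_def)
      have "prod_list xs = (j + b * s) * i + (a * r) * j + (r * s) * (a * b)"
        by (simp add: uv u v algebra_simps)
      also have "\<dots> \<in> I"
        using addsub_add[OF D(2) addsub_add[OF D(2) D(3)[OF _ u(2)] D(3)[OF _ v(2)]] D(3)[OF _ ab(3)],
            of "j + b * s" "a * r" "r * s"] u v ab D(1) by (auto intro!: OK_add OK_mult)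
      finally show ?thesis .
    qed
    thus ?thesis using Ps(1) Qs(1) by (intro exI[of _ "Ps @ Qs"]) auto
  qed
qed

section \<open>Inverses of ideals, cancellation and the norm of a product with a prime\<close>

definition inv_id :: "complex set \<Rightarrow> complex set" where
  "inv_id P = {z \<in> K. \<forall>x\<in>P. z * x \<in> OK}"

lemma is_mod_inv_id: "is_mod (inv_id P)"
  unfolding is_mod_def addsub_def inv_id_def
proof (intro conjI ballI)
  fix x y assume x: "x \<in> {z \<in> K. \<forall>x\<in>P. z * x \<in> OK}" and y: "y \<in> {z \<in> K. \<forall>x\<in>P. z * x \<in> OK}"
  have "x - y \<in> K" using K_add[of x "- y"] K_uminus[of y] x y by simp
  thus "x - y \<in> {z \<in> K. \<forall>x\<in>P. z * x \<in> OK}" using x y by (auto simp: left_diff_distrib OK_diff)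
next
  fix r a assume "r \<in> OK" "a \<in> {z \<in> K. \<forall>x\<in>P. z * x \<in> OK}"
  thus "r * a \<in> {z \<in> K. \<forall>x\<in>P. z * x \<in> OK}"
    using OK_mult by (auto simp: mult.assoc OK_def intro: K_mult)
qed (auto intro: OK_0 K_Rats)

text \<open>Take a nonzero \<open>a\<close> in \<open>P\<close> and a shortest list of primes whose
  products lie in (a). Some member is contained in \<open>P\<close>, hence equals \<open>P\<close>;
  leaving it out yields \<open>b\<close> outside (a) with b P inside (a), and \<open>b / a\<close>
  is the witness.\<close>

lemma prime_inv_id_not_integral:
  assumes P: "is_prime P"
  shows "\<exists>g\<in>inv_id P. g \<notin> OK"
proof -
  note D = is_primeD[OF P]
  obtain a where a: "a \<in> P" "a \<noteq> 0" using is_ideal_nonzero[OF D(1,3)] by blast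
  have aO: "a \<in> OK" using a is_idealD(1)[OF D(1)] by blast
  have "princ a \<noteq> {0}" using a OK_1 by (auto simp: princ_def)
  define good where "good Ps \<longleftrightarrow> (\<forall>P\<in>set Ps. is_prime P) \<and> (\<forall>xs. list_all2 (\<in>) xs Ps \<longrightarrow> prod_list xs \<in> princ a)" for Ps
  have "\<exists>Ps. good Ps"
    unfolding good_def by (rule contains_prime_products[OF is_ideal_princ[OF aO] \<open>princ a \<noteq> {0}\<close>])
  then obtain Ps where Ps: "good Ps" and least: "\<And>Qs. good Qs \<Longrightarrow> length Ps \<le> length Qs"
    using ex_has_least_nat[of good _ length] by blast
  have "\<exists>Q\<in>set Ps. Q \<subseteq> P"
  proof (rule ccontr)
    assume no: "\<not> (\<exists>Q\<in>set Ps. Q \<subseteq> P)"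
    have ex: "\<exists>xs. list_all2 (\<in>) xs Qs \<and> prod_list xs \<notin> P \<and> prod_list xs \<in> OK"
      if "\<forall>Q\<in>set Qs. is_prime Q \<and> \<not> Q \<subseteq> P" for Qs
      using that
    proof (induction Qs)
      case Nil
      thus ?case using D(5) OK_1 by (intro exI[of _ "[]"]) auto
    next
      case (Cons Q Qs)
      then obtain xs where xs: "list_all2 (\<in>) xs Qs" "prod_list xs \<notin> P" "prod_list xs \<in> OK" by auto
      obtain x where x: "x \<in> Q" "x \<notin> P" using Cons.prems by auto
      have "x \<in> OK" using x Cons.prems is_idealD(1)[OF is_primeD(1), of Q] by auto
      thus ?case using xs x D(4)[of x "prod_list xs"] by (intro exI[of _ "x # xs"]) (auto intro: OK_mult)
    qed
    obtain xs where "list_all2 (\<in>) xs Ps" "prod_list xs \<notin> P"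
      using ex[of Ps] no Ps by (auto simp: good_def)
    thus False using Ps princ_subset[OF D(1) a(1)] by (auto simp: good_def)
  qed
  then obtain Q where Q: "Q \<in> set Ps" "Q \<subseteq> P" by blast
  have "is_prime Q" using Ps Q by (auto simp: good_def)
  hence "Q = P" using prime_maximal[of Q P] D Q by blast
  then obtain us vs where uv: "Ps = us @ P # vs" using Q split_list by metis
  have "\<not> good (us @ vs)" using least[of "us @ vs"] uv by auto
  then obtain xs where xs: "list_all2 (\<in>) xs (us @ vs)" "prod_list xs \<notin> princ a"
    using Ps uv by (auto simp: good_def)
  define b where "b = prod_list xs"
  have bO: "b \<in> OK"
  proof -
    have "prod_list ys \<in> OK" if "list_all2 (\<in>) ys Qs" "\<forall>Q\<in>set Qs. is_prime Q" for ys Qs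
      using that
    proof (induction rule: list_all2_induct)
      case Nil thus ?case by (simp add: OK_1)
    next
      case (Cons x ys Q Qs)
      hence "x \<in> OK" using is_idealD(1)[OF is_primeD(1), of Q] by auto
      thus ?case using Cons by (auto intro: OK_mult)
    qed
    thus ?thesis using xs(1) Ps uv by (auto simp: b_def good_def)
  qed
  have bP: "b * x \<in> princ a" if x: "x \<in> P" for x
  proof -
    obtain ys zs where yz: "xs = ys @ zs" "list_all2 (\<in>) ys us" "list_all2 (\<in>) zs vs"
      using xs(1) by (auto simp: list_all2_append2)
    have "list_all2 (\<in>) (ys @ x # zs) Ps" using yz x uv by (auto intro: list_all2_appendI)
    hence "prod_list (ys @ x # zs) \<in> princ a" using Ps unfolding good_def by blast
    thus ?thesis by (simp add: b_def yz mult_ac)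
  qed
  have aK: "a \<in> K" "b \<in> K" using aO bO by (auto simp: OK_def)
  have "b / a \<in> inv_id P"
  proof -
    have "b / a * x \<in> OK" if "x \<in> P" for x using bP[OF that] a by (auto simp: princ_def)
    moreover have "b / a \<in> K" using K_mult[OF aK(2) K_inverse[OF aK(1)]] by (simp add: divide_inverse)
    ultimately show ?thesis by (simp add: inv_id_def)
  qed
  moreover have "b / a \<notin> OK"
  proof
    assume "b / a \<in> OK"
    hence "a * (b / a) \<in> princ a" unfolding princ_def by (rule imageI)
    thus False using xs(2) a by (simp add: b_def)
  qed
  ultimately show ?thesis by blast
qed

text \<open>By the pigeonhole principle two powers \<open>g ^ i\<close> and \<open>g ^ j\<close> differ by an algebraic integer, which
  exhibits \<open>g\<close> as a root of a monic polynomial over the algebraic integers.\<close>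

lemma integral_if_stable:
  assumes g: "g \<in> K" and I: "is_ideal I" "I \<noteq> {0}" and stable: "\<And>x. x \<in> I \<Longrightarrow> g * x \<in> I"
  shows "g \<in> OK"
proof -
  obtain c where c: "c \<in> I" "c \<noteq> 0" using is_ideal_nonzero[OF I] by blast
  have cO: "c \<in> OK" using c is_idealD(1)[OF I(1)] by blast
  have "c * g ^ k \<in> I" for k
  proof (induction k)
    case (Suc k) thus ?case using stable[OF Suc] by (simp add: mult_ac)
  qed (use c in simp)
  hence cg: "c * g ^ k \<in> OK" for k using is_idealD(1)[OF I(1)] by blast
  have pr: "is_ideal (princ c)" by (rule is_ideal_princ[OF cO])
  have "princ c \<noteq> {0}" using c OK_1 by (auto simp: princ_def)
  \<comment> \<open>Dividing a congruence modulo (c) by \<open>c\<close> shows that g^j - g^i is an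
    algebraic integer.\<close>
  then obtain i j where ij: "i < j" "c * g ^ j - c * g ^ i \<in> princ c"
    using coset_pigeonhole[OF is_idealD(2)[OF pr] finite_cosets[OF pr], of "\<lambda>k. c * g ^ k"] cg by blast
  then obtain y where y: "c * g ^ j - c * g ^ i = c * y" "y \<in> OK" by (auto simp: princ_def)
  hence "c * (g ^ j - g ^ i) = c * y" by (simp add: right_diff_distrib)
  hence "g ^ j - g ^ i = y" using c by simp
  hence 1: "poly (monom 1 j - monom 1 i) g = y" by (simp add: poly_monom)
  have dg: "degree (monom 1 j - monom (1::complex) i) = j"
    using ij(1) by (intro antisym degree_diff_le le_degree) (auto intro: order.trans[OF degree_monom_le])
  have 2: "algebraic_int y" using y by (simp add: OK_def)
  have 3: "\<forall>k. coeff (monom 1 j - monom (1::complex) i) k \<in> \<int>" by simp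
  have 4: "lead_coeff (monom 1 j - monom (1::complex) i) = 1"
    unfolding dg using ij(1) by simp
  have "degree (monom 1 j - monom (1::complex) i) > 0" unfolding dg using ij(1) by simp
  hence "algebraic_int g" by (rule algebraic_int_root[OF 2 1 3 4])
  thus ?thesis using g by (simp add: OK_def)
qed

text \<open>P P^(-1) lies between P and the whole ring, so maximality leaves two cases. If it were
  P, every element of P^(-1) would map P into itself and be integral by
  \<open>integral_if_stable\<close>.\<close>

lemma prime_times_inv:
  assumes P: "is_prime P"
  shows "ideal_prod RK P (inv_id P) = OK"
proof -
  note D = is_primeD[OF P]
  define J where "J = ideal_prod RK P (inv_id P)"
  have JO: "J \<subseteq> OK" unfolding J_def by (rule ideal_prod_subset[OF addsub_OK]) (auto simp: inv_id_def mult.commute)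
  hence J: "is_ideal J" using is_mod_ideal_prod[OF is_ideal_is_mod[OF D(1)] is_mod_inv_id[of P]] by (simp add: is_ideal_iff_mod J_def)
  have "1 \<in> inv_id P" using is_idealD(1)[OF D(1)] by (auto simp: inv_id_def K_Rats)
  hence PJ: "P \<subseteq> J" using ideal_prod_I[of _ P 1 "inv_id P"] by (auto simp: J_def)
  have "J \<noteq> P"
  proof
    assume JP: "J = P"
    obtain g where g: "g \<in> inv_id P" "g \<notin> OK" using prime_inv_id_not_integral[OF P] by blast
    have "g * x \<in> P" if "x \<in> P" for x
      using ideal_prod_I[OF that g(1)] JP by (simp add: J_def mult.commute)
    thus False using integral_if_stable[OF _ D(1,3), of g] g by (auto simp: inv_id_def)
  qed
  thus ?thesis using prime_maximal[OF P J PJ] by (simp add: J_def)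
qed

text \<open>To contain is to divide: the cofactor is P^(-1) I, which lies in the ring because I lies
  in P.\<close>

lemma prime_divides:
  assumes P: "is_prime P" and I: "is_ideal I" "I \<subseteq> P"
  obtains J where "is_ideal J" "I = ideal_prod RK P J"
proof
  define J where "J = ideal_prod RK (inv_id P) I"
  have "J \<subseteq> OK" unfolding J_def using I by (intro ideal_prod_subset[OF addsub_OK]) (auto simp: inv_id_def)
  thus "is_ideal J" using is_mod_ideal_prod[OF is_mod_inv_id[of P] is_ideal_is_mod[OF I(1)]] by (simp add: is_ideal_iff_mod J_def)
  show "I = ideal_prod RK P J"
    by (simp add: J_def ideal_prod_assoc prime_times_inv[OF P] ideal_prod_one is_ideal_is_mod[OF I(1)])
qed

lemma prime_cancel:
  assumes P: "is_prime P" and A: "is_mod A" and B: "is_mod B" and eq: "ideal_prod RK P A = ideal_prod RK P B"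
  shows "A = B"
proof -
  have "ideal_prod RK (inv_id P) (ideal_prod RK P C) = C" if "is_mod C" for C
    using that by (simp add: ideal_prod_assoc ideal_prod_comm[of "inv_id P" P] prime_times_inv[OF P] ideal_prod_one)
  thus ?thesis using A B eq by metis
qed

lemma ideal_prod_nonzero:
  assumes "is_ideal A" "A \<noteq> {0}" "is_ideal B" "B \<noteq> {0}"
  shows "ideal_prod RK A B \<noteq> {0}"
proof -
  obtain a where a: "a \<in> A" "a \<noteq> 0" using is_ideal_nonzero[OF assms(1,2)] by blast
  obtain b where b: "b \<in> B" "b \<noteq> 0" using is_ideal_nonzero[OF assms(3,4)] by blast
  have "a * b \<in> ideal_prod RK A B" by (rule ideal_prod_I[OF a(1) b(1)])
  thus ?thesis using a b by force
qed

text \<open>Otherwise multiplying by P^(-1) gives P^(-1) A = A, and every element of P^(-1) would be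
  integral.\<close>

lemma prime_prod_strict:
  assumes P: "is_prime P" and A: "is_ideal A" "A \<noteq> {0}"
  shows "ideal_prod RK P A \<subset> A"
proof -
  have "ideal_prod RK P A \<noteq> A"
  proof
    assume eq: "ideal_prod RK P A = A"
    obtain g where g: "g \<in> inv_id P" "g \<notin> OK" using prime_inv_id_not_integral[OF P] by blast
    have "ideal_prod RK (inv_id P) A = ideal_prod RK (inv_id P) (ideal_prod RK P A)" by (simp add: eq)
    also have "\<dots> = A" using is_ideal_is_mod[OF A(1)]
      by (simp add: ideal_prod_assoc ideal_prod_comm[of "inv_id P" P] prime_times_inv[OF P] ideal_prod_one)
    finally have "ideal_prod RK (inv_id P) A = A" .
    hence "g * x \<in> A" if "x \<in> A" for x using ideal_prod_I[OF g(1) that] by simp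
    thus False using integral_if_stable[OF _ A, of g] g by (auto simp: inv_id_def)
  qed
  thus ?thesis using ideal_prod_subset_right[OF is_primeD(1)[OF P] A(1)] by blast
qed

text \<open>Among the proper ideals containing \<open>I\<close> one of least norm is maximal, and
  maximal ideals are prime.\<close>

lemma proper_in_prime:
  assumes I: "is_ideal I" "I \<noteq> {0}" "I \<noteq> OK"
  shows "\<exists>P. is_prime P \<and> I \<subseteq> P"
proof -
  define good where "good J \<longleftrightarrow> is_ideal J \<and> J \<noteq> OK \<and> I \<subseteq> J" for J
  have "good I" using I by (simp add: good_def)
  then obtain P where P: "good P" and least: "\<And>J. good J \<Longrightarrow> nrm P \<le> nrm J"
    using ex_has_least_nat[of good I nrm] by blast
  have idP: "is_ideal P" and IP: "I \<subseteq> P" and PO: "P \<noteq> OK" using P by (auto simp: good_def)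
  have P0: "P \<noteq> {0}" using I IP addsub_0[OF is_idealD(2)[OF I(1)]] by auto
  have "a \<in> P \<or> b \<in> P" if ab: "a \<in> OK" "b \<in> OK" "a * b \<in> P" for a b
  proof (rule disjCI)
    assume bP: "b \<notin> P"
    note c = is_ideal_id_plus[OF idP ab(2)]
    have "nrm (id_plus P b) < nrm P" using c bP by (intro nrm_strict_mono idP P0) auto
    hence "\<not> good (id_plus P b)" using least leD by blast
    hence "id_plus P b = OK" using c IP by (auto simp: good_def)
    then obtain i r where ir: "1 = i + b * r" "i \<in> P" "r \<in> OK" using OK_1 unfolding id_plus_def by blast
    have "a * 1 = a * i + r * (a * b)" by (subst ir(1)) (simp add: algebra_simps)
    also have "\<dots> \<in> P"
      by (rule addsub_add[OF is_idealD(2)[OF idP] is_idealD(3)[OF idP ab(1) ir(2)] is_idealD(3)[OF idP ir(3) ab(3)]])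
    finally show "a \<in> P" by simp
  qed
  hence "is_prime P" using idP PO P0 by (auto simp: is_prime_def)
  thus ?thesis using IP by blast
qed

text \<open>Peel off prime divisors one by one, the norm decreasing, and collect their
  inverses.\<close>

lemma ideal_inverse:
  assumes "is_ideal A" "A \<noteq> {0}"
  shows "\<exists>B. is_mod B \<and> ideal_prod RK A B = OK"
  using assms
proof (induction "nrm A" arbitrary: A rule: less_induct)
  case less
  note A = less.prems
  show ?case
  proof (cases "A = OK")
    case True
    thus ?thesis using ideal_prod_one[of OK] is_ideal_is_mod[OF is_ideal_OK] by blast
  next
    case False
    obtain P where P: "is_prime P" "A \<subseteq> P" using proper_in_prime[OF A False] by blast
    obtain J where J: "is_ideal J" "A = ideal_prod RK P J" using prime_divides[OF P(1) A(1) P(2)] .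
    have J0: "J \<noteq> {0}" using A J ideal_prod_subset_right[OF is_primeD(1)[OF P(1)] J(1)] addsub_0[OF is_idealD(2)[OF A(1)]] by auto
    have "A \<subset> J" using prime_prod_strict[OF P(1) J(1) J0] J by simp
    hence "nrm J < nrm A" by (intro nrm_strict_mono A J)
    then obtain B where B: "is_mod B" "ideal_prod RK J B = OK" using less.hyps[OF _ J(1) J0] by blast
    have "ideal_prod RK A (ideal_prod RK B (inv_id P)) = ideal_prod RK P (ideal_prod RK (ideal_prod RK J B) (inv_id P))"
      by (simp add: J ideal_prod_assoc)
    also have "\<dots> = OK" by (simp add: B ideal_prod_one is_mod_inv_id prime_times_inv P)
    finally show ?thesis using is_mod_ideal_prod[OF B(1) is_mod_inv_id] by blast
  qed
qed

text \<open>Multiplication by an \<open>\<alpha>\<close> in A outside P A induces a bijection from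
  O/P to A/PA, after which the index tower applies. It is injective because the elements sent into P
  A form a proper ideal containing P. It is surjective because P A + (\<alpha>) = A: multiplying by
  A^(-1) gives an ideal strictly above P, hence the whole ring.\<close>

lemma nrm_prime_mult:
  assumes P: "is_prime P" and A: "is_ideal A" "A \<noteq> {0}"
  shows "nrm (ideal_prod RK P A) = nrm P * nrm A"
proof -
  note D = is_primeD[OF P]
  define PA where "PA = ideal_prod RK P A"
  have idPA: "is_ideal PA" unfolding PA_def by (rule is_ideal_ideal_prod[OF D(1) A(1)])
  have PAA: "PA \<subset> A" unfolding PA_def by (rule prime_prod_strict[OF P A])
  then obtain \<alpha> where \<alpha>: "\<alpha> \<in> A" "\<alpha> \<notin> PA" by blast
  have \<alpha>O: "\<alpha> \<in> OK" using \<alpha> is_idealD(1)[OF A(1)] by blast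
  have mult_in: "\<alpha> * x \<in> PA \<longleftrightarrow> x \<in> P" if x: "x \<in> OK" for x
  proof
    assume "x \<in> P" thus "\<alpha> * x \<in> PA" using ideal_prod_I[of x P \<alpha> A] \<alpha> by (simp add: PA_def mult.commute)
  next
    define L where "L = {x \<in> OK. \<alpha> * x \<in> PA}"
    assume "\<alpha> * x \<in> PA"
    hence xL: "x \<in> L" using x by (simp add: L_def)
    have "is_ideal L" unfolding is_ideal_def addsub_def L_def
      using is_idealD(3)[OF idPA] addsub_0[OF is_idealD(2)[OF idPA]] addsub_diff[OF is_idealD(2)[OF idPA]]
      by (auto simp: OK_0 OK_diff OK_mult right_diff_distrib mult.left_commute)
    moreover have "P \<subseteq> L"
      using ideal_prod_I[of _ P \<alpha> A] \<alpha> is_idealD(1)[OF D(1)] by (auto simp: L_def PA_def mult.commute)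
    moreover have "1 \<notin> L" using \<alpha> by (simp add: L_def)
    hence "L \<noteq> OK" using OK_1 by blast
    ultimately have "L = P" using prime_maximal[OF P] by blast
    thus "x \<in> P" using xL by simp
  qed
  define L where "L = id_plus PA \<alpha>"
  note Lp = is_ideal_id_plus[OF idPA \<alpha>O, folded L_def]
  have LA: "L \<subseteq> A" using PAA \<alpha> is_idealD[OF A(1)] by (auto simp: L_def id_plus_def intro!: addsub_add)
  obtain B where B: "is_mod B" "ideal_prod RK A B = OK" using ideal_inverse[OF A] by blast
  have "L = A"
  proof -
    define U where "U = ideal_prod RK L B"
    have UO: "U \<subseteq> OK" using ideal_prod_mono[OF LA, of B B] B by (simp add: U_def)
    hence idU: "is_ideal U" using is_mod_ideal_prod[OF is_ideal_is_mod[OF Lp(1)] B(1)] by (simp add: is_ideal_iff_mod U_def)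
    have "ideal_prod RK PA B = P"
    proof -
      have "ideal_prod RK PA B = ideal_prod RK P OK" by (simp add: PA_def B flip: ideal_prod_assoc)
      thus ?thesis using ideal_prod_one[OF is_ideal_is_mod[OF D(1)]] by (simp add: ideal_prod_comm)
    qed
    hence PU: "P \<subseteq> U" using ideal_prod_mono[OF Lp(2), of B B] by (simp add: U_def)
    have UA: "ideal_prod RK U A = L"
      by (simp add: U_def B ideal_prod_comm[of B A] ideal_prod_comm[of L OK] ideal_prod_one is_ideal_is_mod[OF Lp(1)]
          flip: ideal_prod_assoc)
    have "U \<noteq> P" using UA Lp(3) \<alpha> by (auto simp: PA_def)
    hence "U = OK" using prime_maximal[OF P idU PU] by blast
    thus ?thesis using UA ideal_prod_one[OF is_ideal_is_mod[OF A(1)]] by simp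
  qed
  define h where "h Z = (\<Union>z\<in>Z. coset_of PA (\<alpha> * z))" for Z
  have h: "h (coset_of P x) = coset_of PA (\<alpha> * x)" if "x \<in> OK" for x
  proof -
    have "coset_of PA (\<alpha> * z) = coset_of PA (\<alpha> * x)" if "z \<in> coset_of P x" for z
    proof -
      obtain i where i: "i \<in> P" "z = x + i" using \<open>z \<in> coset_of P x\<close> by (auto simp: coset_of_def)
      moreover have "i \<in> OK" using i is_idealD(1)[OF D(1)] by blast
      ultimately show ?thesis using mult_in[of i]
        by (simp add: coset_of_eq_iff[OF is_idealD(2)[OF idPA]] distrib_left)
    qed
    moreover have "x \<in> coset_of P x"
      using addsub_0[OF is_idealD(2)[OF D(1)]] by (auto simp: coset_of_def intro!: image_eqI[of _ _ 0])
    ultimately show ?thesis unfolding h_def by (intro UN_constant_eq)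
  qed
  have "bij_betw h (coset_of P ` OK) (coset_of PA ` A)"
    unfolding bij_betw_def
  proof (intro conjI inj_onI)
    fix Z Z' assume Z: "Z \<in> coset_of P ` OK" "Z' \<in> coset_of P ` OK" "h Z = h Z'"
    then obtain x y where xy: "Z = coset_of P x" "Z' = coset_of P y" "x \<in> OK" "y \<in> OK" by blast
    hence "\<alpha> * (x - y) \<in> PA" using Z(3) h by (simp add: coset_of_eq_iff[OF is_idealD(2)[OF idPA]] right_diff_distrib)
    thus "Z = Z'" using xy mult_in[of "x - y"] by (simp add: OK_diff coset_of_eq_iff[OF is_idealD(2)[OF D(1)]])
  next
    show "h ` coset_of P ` OK = coset_of PA ` A"
    proof safe
      fix x assume "x \<in> OK"
      thus "h (coset_of P x) \<in> coset_of PA ` A" using h is_idealD(4)[OF A(1) _ \<alpha>(1)] by auto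
    next
      fix a assume "a \<in> A"
      hence "a \<in> L" using \<open>L = A\<close> by simp
      then obtain i r where ir: "a = i + \<alpha> * r" "i \<in> PA" "r \<in> OK" by (auto simp: L_def id_plus_def)
      hence "coset_of PA a = h (coset_of P r)" using h by (simp add: coset_of_eq_iff[OF is_idealD(2)[OF idPA]])
      thus "coset_of PA a \<in> h ` coset_of P ` OK" using ir by blast
    qed
  qed
  hence "card (coset_of PA ` A) = nrm P" by (simp add: bij_betw_same_card nrm_def)
  thus ?thesis using nrm_mult_index[OF idPA A(1)] PAA by (simp add: PA_def mult.commute)
qed

end

section \<open>Factorization into prime powers, its uniqueness, and residue rings of primes\<close>

context number_ring
begin

interpretation RK: cring RK by (rule cring_RK)

abbreviation MK where "MK \<equiv> ideals_set RK"

interpretation MK: Group.comm_monoid MK by (rule RK.ideals_set_is_comm_monoid)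

lemma MK_simps [simp]:
  "carrier MK = {I. is_ideal I}" "I \<otimes>\<^bsub>MK\<^esub> J = ideal_prod RK I J" "\<one>\<^bsub>MK\<^esub> = OK"
  by (simp_all add: ideals_set_def ideal_iff)

text \<open>The same \<open>finprod\<close> expression as in
  \<open>random_completely_multiplicative\<close>, whose last clause thus evaluates the random
  function at \<open>fac e S\<close> directly.\<close>

definition fac :: "(complex set \<Rightarrow> nat) \<Rightarrow> complex set set \<Rightarrow> complex set" where
  "fac e S = finprod MK (\<lambda>P. P [^]\<^bsub>MK\<^esub> e P) S"

lemma MK_pow_closed: "is_ideal P \<Longrightarrow> is_ideal (P [^]\<^bsub>MK\<^esub> (k::nat))"
  using MK.nat_pow_closed[of P k] by simp

lemma fac_Pi: "S \<subseteq> Collect is_prime \<Longrightarrow> (\<lambda>P. P [^]\<^bsub>MK\<^esub> (e P :: nat)) \<in> S \<rightarrow> carrier MK"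
  by (auto dest: is_primeD(1) intro: MK_pow_closed)

lemma is_ideal_fac: "S \<subseteq> Collect is_prime \<Longrightarrow> is_ideal (fac e S)"
  unfolding fac_def using MK.finprod_closed[OF fac_Pi, of S e] by simp

lemma fac_empty [simp]: "fac e {} = OK"
  by (simp add: fac_def)

lemma fac_insert:
  assumes "finite S" "insert P S \<subseteq> Collect is_prime" "P \<notin> S"
  shows "fac e (insert P S) = ideal_prod RK (P [^]\<^bsub>MK\<^esub> e P) (fac e S)"
  unfolding fac_def
  using MK.finprod_insert[OF assms(1,3) fac_Pi, of e] fac_Pi[OF assms(2), of e] assms(2) by auto

lemma fac_cong: "S \<subseteq> Collect is_prime \<Longrightarrow> (\<And>P. P \<in> S \<Longrightarrow> e P = e' P) \<Longrightarrow> fac e S = fac e' S"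
  unfolding fac_def by (rule MK.finprod_cong'[OF refl fac_Pi]) simp_all

lemma MK_pow_Suc: "P [^]\<^bsub>MK\<^esub> Suc k = ideal_prod RK P (P [^]\<^bsub>MK\<^esub> k)"
  by (simp add: ideal_prod_comm)

lemma fac_Suc:
  assumes S: "finite S" "S \<subseteq> Collect is_prime" "P \<in> S"
  shows "fac (e(P := Suc (e P))) S = ideal_prod RK P (fac e S)"
proof -
  have S': "S = insert P (S - {P})" "finite (S - {P})" "insert P (S - {P}) \<subseteq> Collect is_prime" "P \<notin> S - {P}"
    using S by auto
  have "fac (e(P := Suc (e P))) (S - {P}) = fac e (S - {P})" using S by (intro fac_cong) auto
  thus ?thesis
    using fac_insert[OF S'(2-4), of e] fac_insert[OF S'(2-4), of "e(P := Suc (e P))"] S'(1)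
    by (simp only: MK_pow_Suc fun_upd_same ideal_prod_assoc flip: S'(1))
qed

lemma OK_nonzero: "OK \<noteq> {0}"
  using OK_1 by (metis singletonD zero_neq_one)

lemma nrm_OK: "nrm OK = 1"
proof -
  have "coset_of OK x = coset_of OK 0" if "x \<in> OK" for x
    using that by (subst coset_of_eq_iff[OF addsub_OK]) simp
  hence "coset_of OK ` OK = {coset_of OK 0}" using OK_0 by blast
  thus ?thesis by (simp add: nrm_def)
qed

lemma nrm_eq_1: assumes "is_ideal I" "I \<noteq> {0}" "nrm I = 1" shows "I = OK"
proof (rule ccontr)
  assume "I \<noteq> OK"
  hence "I \<subset> OK" using is_idealD(1)[OF assms(1)] by blast
  thus False using nrm_strict_mono[OF assms(1,2) is_ideal_OK] nrm_OK assms(3) by simp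
qed

lemma nrm_prime_ge_2: assumes "is_prime P" shows "nrm P \<ge> 2"
  using nrm_pos[of P] nrm_eq_1[of P] is_primeD[OF assms] by (cases "nrm P = 0 \<or> nrm P = 1") auto

lemma pow_prod:
  assumes P: "is_prime P" and J: "is_ideal J" "J \<noteq> {0}"
  shows "ideal_prod RK (P [^]\<^bsub>MK\<^esub> (k::nat)) J \<noteq> {0} \<and>
    nrm (ideal_prod RK (P [^]\<^bsub>MK\<^esub> k) J) = nrm P ^ k * nrm J"
proof (induction k)
  case 0
  thus ?case using J by (simp add: ideal_prod_one is_ideal_is_mod)
next
  case (Suc k)
  have id: "is_ideal (ideal_prod RK (P [^]\<^bsub>MK\<^esub> k) J)"
    by (intro is_ideal_ideal_prod MK_pow_closed J is_primeD(1)[OF P])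
  have eq: "ideal_prod RK (P [^]\<^bsub>MK\<^esub> Suc k) J = ideal_prod RK P (ideal_prod RK (P [^]\<^bsub>MK\<^esub> k) J)"
    by (simp only: MK_pow_Suc ideal_prod_assoc)
  show ?case unfolding eq
    using ideal_prod_nonzero[OF is_primeD(1,3)[OF P] id] nrm_prime_mult[OF P id] Suc by simp
qed

lemma fac_nonzero_nrm:
  assumes "finite S" "S \<subseteq> Collect is_prime"
  shows "fac e S \<noteq> {0} \<and> nrm (fac e S) = (\<Prod>P\<in>S. nrm P ^ e P)"
  using assms
proof (induction S rule: finite_induct)
  case empty
  thus ?case by (simp add: nrm_OK OK_nonzero)
next
  case (insert P S)
  hence "is_prime P" "is_ideal (fac e S)" "fac e S \<noteq> {0}" using is_ideal_fac[of S e] by auto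
  from pow_prod[OF this, of "e P"] show ?case
    using insert by (simp add: fac_insert)
qed

lemma fac_zero: "S \<subseteq> Collect is_prime \<Longrightarrow> fac (\<lambda>_. 0) S = OK"
  unfolding fac_def using MK.finprod_one_eqI[of S "\<lambda>P. P [^]\<^bsub>MK\<^esub> (0::nat)"] by simp

text \<open>The exponents vanish outside S, so that a new prime may first join S without changing
  the product and then have its exponent raised by \<open>fac_Suc\<close>.\<close>

lemma ideal_factorization:
  assumes "is_ideal I" "I \<noteq> {0}"
  shows "\<exists>S e. finite S \<and> S \<subseteq> Collect is_prime \<and> I = fac e S \<and> (\<forall>P. P \<notin> S \<longrightarrow> e P = 0)"
  using assms
proof (induction "nrm I" arbitrary: I rule: less_induct)
  case less
  note I = less.prems
  show ?case
  proof (cases "I = OK")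
    case True
    thus ?thesis by (intro exI[of _ "{}"] exI[of _ "\<lambda>_. 0"]) simp
  next
    case False
    obtain P where P: "is_prime P" "I \<subseteq> P" using proper_in_prime[OF I False] by blast
    obtain J where J: "is_ideal J" "I = ideal_prod RK P J" using prime_divides[OF P(1) I(1) P(2)] .
    have J0: "J \<noteq> {0}" using I J ideal_prod_subset_right[OF is_primeD(1)[OF P(1)] J(1)] addsub_0[OF is_idealD(2)[OF I(1)]] by auto
    have "I \<subset> J" using prime_prod_strict[OF P(1) J(1) J0] J by simp
    hence "nrm J < nrm I" by (intro nrm_strict_mono I J)
    then obtain S e where S: "finite S" "S \<subseteq> Collect is_prime" "J = fac e S" "\<forall>P. P \<notin> S \<longrightarrow> e P = 0"
      using less.hyps[OF _ J(1) J0] by blast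
    have S': "finite (insert P S)" "insert P S \<subseteq> Collect is_prime" "P \<in> insert P S" using S P by auto
    have "fac e (insert P S) = fac e S"
    proof (cases "P \<in> S")
      case False
      hence "e P = 0" using S by simp
      have "fac e (insert P S) = ideal_prod RK (P [^]\<^bsub>MK\<^esub> e P) (fac e S)"
        by (rule fac_insert[OF S(1) S'(2) False])
      also have "\<dots> = fac e S" unfolding \<open>e P = 0\<close>
        using ideal_prod_one[OF is_ideal_is_mod[OF is_ideal_fac[OF S(2), of e]]] by simp
      finally show ?thesis .
    qed (simp add: insert_absorb)
    hence "I = fac (e(P := Suc (e P))) (insert P S)"
      using J(2) S(3) fac_Suc[OF S', of e] by simp
    thus ?thesis using S S' by (intro exI[of _ "insert P S"] exI[of _ "e(P := Suc (e P))"]) auto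
  qed
qed

lemma prime_subset_eq: "is_prime P \<Longrightarrow> is_prime Q \<Longrightarrow> P \<subseteq> Q \<Longrightarrow> P = Q"
  using prime_maximal[of P Q] is_primeD[of Q] by blast

lemma prod_subset_prime:
  assumes Q: "is_prime Q" and A: "is_ideal A" and B: "is_ideal B" and AB: "ideal_prod RK A B \<subseteq> Q"
  shows "A \<subseteq> Q \<or> B \<subseteq> Q"
proof -
  have "primeideal Q RK" using Q nonzero_primeideal_iff by blast
  thus ?thesis using RK.primeideal_divides_ideal_prod[of Q A B] A B AB by (simp add: ideal_iff)
qed

lemma fac_subset_prime:
  assumes "finite S" "S \<subseteq> Collect is_prime" "is_prime Q" "fac e S \<subseteq> Q"
  shows "Q \<in> S \<and> e Q > 0"
  using assms
proof (induction S rule: finite_induct)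
  case empty
  thus ?case using is_primeD(1,2)[OF empty(2)] is_idealD(1) by auto
next
  case (insert P S)
  have P: "is_prime P" and S: "S \<subseteq> Collect is_prime" using insert.prems by auto
  have pow: "P [^]\<^bsub>MK\<^esub> k \<subseteq> Q \<Longrightarrow> k > 0 \<and> P \<subseteq> Q" for k :: nat
  proof (induction k)
    case 0
    thus ?case using is_primeD(1,2)[OF insert.prems(2)] is_idealD(1)[of Q] by auto
  next
    case (Suc k)
    thus ?case
      using prod_subset_prime[OF insert.prems(2) is_primeD(1)[OF P] MK_pow_closed[OF is_primeD(1)[OF P]], of k]
      unfolding MK_pow_Suc by auto
  qed
  have "P [^]\<^bsub>MK\<^esub> e P \<subseteq> Q \<or> fac e S \<subseteq> Q"
    using insert.prems(3) insert.hyps insert.prems(1)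
    by (intro prod_subset_prime[OF insert.prems(2) MK_pow_closed[OF is_primeD(1)[OF P]] is_ideal_fac[OF S]])
      (simp add: fac_insert)
  thus ?case
    using pow[of "e P"] prime_subset_eq[OF P insert.prems(2)] insert.IH[OF S insert.prems(2)] by auto
qed

text \<open>Induction on the total exponent: a prime with positive exponent on one side contains the
  product, so it has positive exponent on the other side too and can be cancelled.\<close>

lemma fac_unique:
  assumes S: "finite S" "S \<subseteq> Collect is_prime" and eq: "fac e S = fac e' S"
  shows "\<forall>P\<in>S. e P = e' P"
  using eq
proof (induction "\<Sum>P\<in>S. e P" arbitrary: e e' rule: less_induct)
  case less
  show ?case
  proof (cases "\<exists>P\<in>S. e P > 0")
    case False
    hence "fac e S = OK" using fac_zero[OF S(2)] fac_cong[OF S(2), of e "\<lambda>_. 0"] by simp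
    hence 1: "fac e' S = OK" using less.prems by simp
    have "e' P = 0" if "P \<in> S" for P
    proof (rule ccontr)
      assume "e' P \<noteq> 0"
      hence "fac e' S = fac ((e'(P := e' P - 1))(P := Suc ((e'(P := e' P - 1)) P))) S"
        by (intro fac_cong[OF S(2)]) auto
      also have "\<dots> = ideal_prod RK P (fac (e'(P := e' P - 1)) S)" by (rule fac_Suc[OF S that])
      also have "\<dots> \<subseteq> P" using S that by (intro ideal_prod_subset_left is_ideal_fac) (auto dest: is_primeD(1))
      finally show False using 1 is_primeD(1,2)[of P] is_idealD(1)[of P] S that by auto
    qed
    thus ?thesis using False by auto
  next
    case True
    then obtain P where P: "P \<in> S" "e P > 0" by blast
    have pP: "is_prime P" using P S by auto
    have dec: "fac e S = ideal_prod RK P (fac (e(P := e P - 1)) S)" if "e P > 0" for e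
    proof -
      have "fac e S = fac ((e(P := e P - 1))(P := Suc ((e(P := e P - 1)) P))) S"
        using that by (intro fac_cong[OF S(2)]) auto
      thus ?thesis using fac_Suc[OF S P(1), of "e(P := e P - 1)"] by simp
    qed
    have "fac e S \<subseteq> P" unfolding dec[of e, OF P(2)]
      using pP by (intro ideal_prod_subset_left is_ideal_fac S is_primeD(1))
    hence e': "e' P > 0" using less.prems fac_subset_prime[OF S pP, of e'] by simp
    have eq': "fac (e(P := e P - 1)) S = fac (e'(P := e' P - 1)) S"
    proof (rule prime_cancel[OF pP])
      show "is_mod (fac (e(P := e P - 1)) S)" "is_mod (fac (e'(P := e' P - 1)) S)"
        by (intro is_ideal_is_mod is_ideal_fac S(2))+
      show "ideal_prod RK P (fac (e(P := e P - 1)) S) = ideal_prod RK P (fac (e'(P := e' P - 1)) S)"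
        using less.prems unfolding dec[of e, OF P(2)] dec[of e', OF e'] .
    qed
    have "(\<Sum>Q\<in>S. (e(P := e P - 1)) Q) < (\<Sum>Q\<in>S. e Q)"
      using S(1) P by (intro sum_strict_mono_ex1) auto
    from less.hyps[OF this eq'] have *: "\<And>Q. Q \<in> S \<Longrightarrow> (e(P := e P - 1)) Q = (e'(P := e' P - 1)) Q" by blast
    have "e Q = e' Q" if "Q \<in> S" for Q
      using *[OF that] P(2) e' by (cases "Q = P") auto
    thus ?thesis by blast
  qed
qed

text \<open>The quotient is killed by \<open>p\<close>, hence has order a power of \<open>p\<close>;
  the order is not 1 because \<open>P\<close> is proper.\<close>

lemma nrm_char:
  assumes P: "is_prime P" and p: "prime (p::nat)" "of_nat p \<in> P"
  shows "\<exists>k>0. nrm P = p ^ k"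
proof -
  note D = is_primeD(1)[OF P]
  obtain k where k: "nrm P = p ^ k"
    using card_quotient_char_p[OF p(1) is_idealD(2,1)[OF D]] is_idealD(4)[OF D _ p(2)] by (auto simp: nrm_def)
  have "k \<noteq> 0" using k nrm_prime_ge_2[OF P] by (intro notI) simp
  thus ?thesis using k by blast
qed

lemma prime_in_prime:
  assumes P: "is_prime P"
  shows "\<exists>p::nat. prime p \<and> of_nat p \<in> P"
proof -
  note D = is_primeD[OF P]
  obtain m :: nat where m: "m > 0" "of_nat m \<in> P" using nat_in_ideal[OF D(1,3)] by blast
  have "of_nat m \<in> P \<Longrightarrow> ?thesis" using m(1)
  proof (induction m rule: prime_divisors_induct)
    case (unit x) thus ?case using D(5) by simp
  next
    case (factor p x)
    hence "of_nat p \<in> P \<or> of_nat x \<in> P" using D(4)[of "of_nat p" "of_nat x"] OK_of_nat by simp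
    thus ?case using factor by auto
  qed auto
  thus ?thesis using m(2) by blast
qed

text \<open>Dividing \<open>I\<close> by one prime keeps it inside the others, since a different
  prime cannot contain the one divided out.\<close>

lemma subset_fac_one:
  assumes "finite S" "S \<subseteq> Collect is_prime" "is_ideal I" "\<And>P. P \<in> S \<Longrightarrow> I \<subseteq> P"
  shows "I \<subseteq> fac (\<lambda>_. 1) S"
  using assms
proof (induction S arbitrary: I rule: finite_induct)
  case empty
  thus ?case using is_idealD(1) by auto
next
  case (insert P S)
  have P: "is_prime P" and S: "S \<subseteq> Collect is_prime" using insert.prems by auto
  obtain J where J: "is_ideal J" "I = ideal_prod RK P J"
    using prime_divides[OF P insert.prems(2)] insert.prems(3) by auto
  have "J \<subseteq> Q" if Q: "Q \<in> S" for Q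
  proof -
    have "is_prime Q" "Q \<noteq> P" "ideal_prod RK P J \<subseteq> Q" using S Q insert.hyps insert.prems(3)[of Q] J by auto
    thus ?thesis using prod_subset_prime[OF _ is_primeD(1)[OF P] J(1)] prime_subset_eq[OF P] by blast
  qed
  hence "J \<subseteq> fac (\<lambda>_. 1) S" using insert.IH[OF S J(1)] by blast
  hence "I \<subseteq> ideal_prod RK P (fac (\<lambda>_. 1) S)" unfolding J(2) by (rule ideal_prod_mono[OF order_refl])
  also have "\<dots> = fac (\<lambda>_. 1) (insert P S)"
    using insert.hyps insert.prems(1) is_primeD(1)[OF P] by (simp add: fac_insert ideal_prod_one is_ideal_is_mod)
  finally show ?case .
qed

lemma fac_add:
  assumes S: "S \<subseteq> Collect is_prime"
  shows "fac (\<lambda>P. e P + e' P) S = ideal_prod RK (fac e S) (fac e' S)"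
proof -
  have "fac (\<lambda>P. e P + e' P) S =
      finprod MK (\<lambda>P. P [^]\<^bsub>MK\<^esub> e P \<otimes>\<^bsub>MK\<^esub> P [^]\<^bsub>MK\<^esub> e' P) S"
    unfolding fac_def
  proof (rule MK.finprod_cong'[OF refl])
    show "(\<lambda>P. P [^]\<^bsub>MK\<^esub> e P \<otimes>\<^bsub>MK\<^esub> P [^]\<^bsub>MK\<^esub> e' P) \<in> S \<rightarrow> carrier MK"
      using fac_Pi[OF S, of e] fac_Pi[OF S, of e'] by (auto intro!: is_ideal_ideal_prod)
    fix P assume "P \<in> S"
    hence "P \<in> carrier MK" using S is_primeD(1) by auto
    thus "P [^]\<^bsub>MK\<^esub> (e P + e' P) = P [^]\<^bsub>MK\<^esub> e P \<otimes>\<^bsub>MK\<^esub> P [^]\<^bsub>MK\<^esub> e' P"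
      by (rule MK.nat_pow_mult[symmetric])
  qed
  also have "\<dots> = fac e S \<otimes>\<^bsub>MK\<^esub> fac e' S"
    unfolding fac_def by (rule MK.finprod_multf[OF fac_Pi[OF S] fac_Pi[OF S]])
  finally show ?thesis by simp
qed

text \<open>\<open>t\<close> acts as a common ramification index: \<open>u\<close> lies in the
  product of the primes of \<open>S\<close>, so \<open>p\<close> lies in its \<open>t\<close>-th
  power, and the norm of that power is at most the norm of (p). This is the inequality between the
  sum of e f and the degree.\<close>

lemma primes_above_bound:
  assumes p: "prime (p::nat)" and uv: "u \<in> OK" "v \<in> OK" "of_nat p = u ^ t * v"
    and S: "finite S" "S \<subseteq> {P. is_prime P \<and> u \<in> P}"
  shows "(\<Prod>P\<in>S. nrm P) ^ t \<le> p ^ deg"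
proof -
  have Sp: "S \<subseteq> Collect is_prime" using S by auto
  have "princ u \<subseteq> P" if "P \<in> S" for P
    using S that by (intro princ_subset is_primeD(1)) auto
  hence "princ u \<subseteq> fac (\<lambda>_. 1) S"
    by (rule subset_fac_one[OF S(1) Sp is_ideal_princ[OF uv(1)]])
  moreover have "u \<in> princ u" using OK_1 by (auto simp: princ_def intro!: image_eqI[of _ _ 1])
  ultimately have u: "u \<in> fac (\<lambda>_. 1) S" by blast
  have "u ^ t \<in> fac (\<lambda>_. t) S"
  proof (induction t)
    case 0
    thus ?case using fac_zero[OF Sp] OK_1 by simp
  next
    case (Suc t)
    have "fac (\<lambda>_. Suc t) S = ideal_prod RK (fac (\<lambda>_. t) S) (fac (\<lambda>_. 1) S)"
      using fac_add[OF Sp, of "\<lambda>_. t" "\<lambda>_. 1"] by simp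
    thus ?case using ideal_prod_I[OF Suc.IH u] by (simp add: mult.commute)
  qed
  hence pf: "of_nat p \<in> fac (\<lambda>_. t) S" using is_idealD(4)[OF is_ideal_fac[OF Sp] uv(2)] uv(3) by simp
  have idp: "is_ideal (princ (of_nat p))" by (intro is_ideal_princ OK_of_nat)
  have p0: "p > 0" using prime_gt_0_nat[OF p] .
  have "nrm (fac (\<lambda>_. t) S) \<le> nrm (princ (of_nat p))"
    unfolding nrm_def
    by (rule finite_cosets_mono(2)[OF is_idealD(2)[OF is_ideal_fac[OF Sp]] princ_subset[OF is_ideal_fac[OF Sp] pf]
          addsub_0[OF is_idealD(2)[OF idp]] finite_cosets_princ_nat[OF p0]])
  also have "\<dots> \<le> p ^ deg"
  proof -
    obtain k where "k \<le> deg" "nrm (princ (of_nat p)) = p ^ k"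
      using card_quotient_char_p[OF p is_idealD(2,1)[OF idp]] by (auto simp: nrm_def princ_def)
    thus ?thesis using p0 by (simp add: power_increasing)
  qed
  finally show ?thesis using fac_nonzero_nrm[OF S(1) Sp] by (simp add: prod_power_distrib)
qed

text \<open>Multiplication by \<open>a\<close> permutes the nonzero residue classes. Comparing the
  products of their representatives before and after puts a^(N(P) - 1) - 1 times an element outside
  P into P.\<close>

lemma fermat:
  assumes P: "is_prime P" and a: "a \<in> OK" "a \<notin> P"
  shows "a ^ (nrm P - 1) - 1 \<in> P"
proof -
  note D = is_primeD[OF P]
  note D1 = is_idealD[OF D(1)]
  define C where "C = coset_of P ` OK - {coset_of P 0}"
  have finC: "finite C" unfolding C_def using finite_cosets[OF D(1,3)] by simp
  have cardC: "card C = nrm P - 1" unfolding C_def nrm_def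
    using OK_0 finite_cosets[OF D(1,3)] by (subst card_Diff_singleton) auto
  define r where "r Z = (SOME x. x \<in> OK \<and> coset_of P x = Z)" for Z
  have r: "r Z \<in> OK" "coset_of P (r Z) = Z" if "Z \<in> C" for Z
    using someI_ex[of "\<lambda>x. x \<in> OK \<and> coset_of P x = Z"] that by (auto simp: r_def C_def)
  have CP: "coset_of P x \<in> C \<longleftrightarrow> x \<notin> P" if "x \<in> OK" for x
    using that coset_of_eq_iff[OF D1(2), of x 0] by (auto simp: C_def)
  define h where "h Z = coset_of P (a * r Z)" for Z
  have hC: "h ` C \<subseteq> C"
  proof safe
    fix Z assume Z: "Z \<in> C"
    have "r Z \<notin> P" using CP[OF r(1)[OF Z]] r(2)[OF Z] Z by simp
    hence "a * r Z \<notin> P" using D(4)[OF a(1) r(1)[OF Z]] a(2) by blast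
    thus "h Z \<in> C" using CP[OF OK_mult[OF a(1) r(1)[OF Z]]] by (simp add: h_def)
  qed
  have "inj_on h C"
  proof (rule inj_onI)
    fix Z Z' assume Z: "Z \<in> C" "Z' \<in> C" "h Z = h Z'"
    hence "a * (r Z - r Z') \<in> P" by (simp add: h_def coset_of_eq_iff[OF D1(2)] right_diff_distrib)
    hence "r Z - r Z' \<in> P" using D(4)[OF a(1) OK_diff[OF r(1)[OF Z(1)] r(1)[OF Z(2)]]] a(2) by blast
    thus "Z = Z'" using r(2)[OF Z(1)] r(2)[OF Z(2)] coset_of_eq_iff[OF D1(2)] by metis
  qed
  hence hb: "bij_betw h C C" using hC finC by (simp add: bij_betw_def endo_inj_surj)
  have rO: "(\<Prod>Z\<in>T. r (g Z)) \<in> OK" if "\<And>Z. Z \<in> T \<Longrightarrow> g Z \<in> C" for g T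
    by (rule OK_prod) (use r that in auto)
  have cong: "(\<Prod>Z\<in>T. a * r Z) - (\<Prod>Z\<in>T. r (h Z)) \<in> P" if "finite T" "T \<subseteq> C" for T
    using that
  proof (induction T rule: finite_induct)
    case empty thus ?case using addsub_0[OF D1(2)] by simp
  next
    case (insert Z T)
    have Z: "Z \<in> C" "h Z \<in> C" "T \<subseteq> C" using insert.prems hC by auto
    have 1: "a * r Z - r (h Z) \<in> P"
      using r(2)[OF Z(2)] coset_of_eq_iff[OF D1(2), of "a * r Z" "r (h Z)"] by (simp add: h_def)
    have 2: "(\<Prod>Z\<in>T. r (h Z)) \<in> OK" using Z(3) hC by (intro rO) auto
    have "(\<Prod>Z\<in>insert Z T. a * r Z) - (\<Prod>Z\<in>insert Z T. r (h Z)) =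
        (a * r Z) * ((\<Prod>Z\<in>T. a * r Z) - (\<Prod>Z\<in>T. r (h Z))) + (\<Prod>Z\<in>T. r (h Z)) * (a * r Z - r (h Z))"
      using insert.hyps by (simp add: algebra_simps)
    also have "\<dots> \<in> P"
      by (rule addsub_add[OF D1(2) D1(3)[OF OK_mult[OF a(1) r(1)[OF Z(1)]] insert.IH[OF Z(3)]] D1(3)[OF 2 1]])
    finally show ?case .
  qed
  define B where "B = (\<Prod>Z\<in>C. r Z)"
  have "(\<Prod>Z\<in>C. r (h Z)) = B" unfolding B_def by (rule prod.reindex_bij_betw[OF hb])
  moreover have "(\<Prod>Z\<in>C. a * r Z) = a ^ card C * B" by (simp add: prod.distrib B_def)
  ultimately have "B * (a ^ card C - 1) \<in> P" using cong[OF finC order_refl] by (simp add: algebra_simps)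
  moreover have "B \<in> OK" unfolding B_def using rO[of C "\<lambda>Z. Z"] by simp
  moreover have "B \<notin> P"
  proof -
    have "(\<Prod>Z\<in>T. r Z) \<notin> P" if "finite T" "T \<subseteq> C" for T
      using that
    proof (induction T rule: finite_induct)
      case empty thus ?case using D(5) by simp
    next
      case (insert Z T)
      have Z: "Z \<in> C" "T \<subseteq> C" using insert.prems by auto
      have "r Z \<notin> P" using CP[OF r(1)[OF Z(1)]] r(2)[OF Z(1)] Z by simp
      moreover have "(\<Prod>Z\<in>T. r Z) \<in> OK" using rO[of T "\<lambda>Z. Z"] Z by auto
      ultimately show ?case
        using insert.IH[OF Z(2)] insert.hyps D(4)[OF r(1)[OF Z(1)], of "\<Prod>Z\<in>T. r Z"] by auto
    qed
    thus ?thesis using finC by (simp add: B_def)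
  qed
  ultimately have "a ^ card C - 1 \<in> P"
    using D(4)[of B "a ^ card C - 1"] OK_diff[OF OK_power[OF a(1)] OK_1] by blast
  thus ?thesis by (simp add: cardC)
qed

end

section \<open>Primes of cyclotomic fields\<close>

lemma zeta_power_div:
  assumes "m dvd n" "n \<ge> 1"
  shows "zeta n ^ (n div m) = zeta m"
proof -
  have "m > 0" using assms by (intro Nat.gr0I) auto
  hence "2 * pi * real (n div m) / real n = 2 * pi / real m"
    using assms by (simp add: real_of_nat_div)
  thus ?thesis unfolding zeta_pow by (simp add: zeta_def)
qed

lemma zeta_pow_mod: "n \<ge> 1 \<Longrightarrow> zeta n ^ k = zeta n ^ (k mod n)"
proof -
  assume n: "n \<ge> 1"
  have "zeta n ^ (n * (k div n) + k mod n) = zeta n ^ (k mod n)"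
    by (simp only: power_add power_mult zeta_pow_self[OF n] power_one mult_1)
  thus ?thesis by simp
qed

text \<open>Both sides are the value at 1 of (X^m - 1) / (X - 1) = 1 + X + ... + X^(m-1).\<close>

lemma prod_one_minus_zeta:
  assumes m: "m \<ge> 1"
  shows "(\<Prod>k\<in>{1..<m}. 1 - zeta m ^ k) = of_nat m"
proof -
  define p :: "complex poly" where "p = monom 1 m - 1"
  have roots: "poly p z = 0 \<longleftrightarrow> z ^ m = 1" for z by (simp add: p_def poly_monom)
  have "rsquarefree p"
    unfolding rsquarefree_roots
  proof (intro allI notI)
    fix a assume a: "poly p a = 0 \<and> poly (pderiv p) a = 0"
    hence "of_nat m * a ^ (m - 1) = 0" by (simp add: p_def pderiv_diff pderiv_monom poly_monom pderiv_1)
    hence "a = 0" using m by auto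
    thus False using roots[of a] a m by (simp add: power_0_left)
  qed
  hence "p = Polynomial.smult (lead_coeff p) (\<Prod>z | poly p z = 0. [:-z, 1:])"
    using complex_poly_decompose_rsquarefree[of p] by simp
  moreover have dp: "degree p = m"
    unfolding p_def using m by (intro antisym degree_diff_le le_degree) (auto intro: order.trans[OF degree_monom_le])
  moreover have "lead_coeff p = 1" unfolding dp using m by (simp add: p_def)
  ultimately have "p = (\<Prod>z | z ^ m = 1. [:-z, 1:])" by (simp add: roots)
  also have "\<dots> = (\<Prod>k<m. [:- (zeta m ^ k), 1:])"
    by (rule prod.reindex_bij_betw[OF roots_unity_zeta[OF m], symmetric])
  also have "{..<m} = insert 0 {1..<m}" using m by auto
  also have "(\<Prod>k\<in>insert 0 {1..<m}. [:- (zeta m ^ k), 1:]) = [:- 1, 1:] * (\<Prod>k\<in>{1..<m}. [:- (zeta m ^ k), 1:])"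
    by (subst prod.insert) auto
  finally have 1: "p = [:- 1, 1:] * (\<Prod>k\<in>{1..<m}. [:- (zeta m ^ k), 1:])" .
  have "p = [:0, 1:] ^ m - 1" by (simp add: p_def monom_altdef)
  also have "\<dots> = ([:0, 1:] - 1) * (\<Sum>i<m. [:0, 1:] ^ i)" by (rule power_diff_1_eq)
  also have "[:0, 1:] - 1 = [:- 1, 1 :: complex:]" by (simp add: one_pCons)
  finally have "(\<Prod>k\<in>{1..<m}. [:- (zeta m ^ k), 1:]) = (\<Sum>i<m. [:0, 1:] ^ i)"
    using 1 mult_left_cancel[of "[:- 1, 1 :: complex:]"] by (metis one_neq_zero pCons_eq_0_iff)
  hence "poly (\<Prod>k\<in>{1..<m}. [:- (zeta m ^ k), 1:]) 1 = poly (\<Sum>i<m. [:0, 1:] ^ i) 1" by simp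
  thus ?thesis by (simp add: poly_prod poly_sum poly_power)
qed

locale cyclotomic =
  fixes n :: nat
  assumes n1: "n \<ge> 1"
begin

sublocale number_ring "cyclotomic_field n" "totient n"
  by unfold_locales
    (use cyclotomic_field_closed Rats_in_cyclotomic_field cyclotomic_field_independent_card[OF n1] in blast)+

lemma cyclotomic_integers_eq: "cyclotomic_integers n = RK"
  by (simp add: cyclotomic_integers_def RK_def OK_def)

lemma zeta_OK:
  assumes "m dvd n" shows "zeta m \<in> OK"
proof -
  have "algebraic_int (zeta n)"
  proof (rule algebraic_int_root[of 1 "monom 1 n"])
    show "poly (monom 1 n) (zeta n) = 1" using n1 by (simp add: poly_monom)
    show "lead_coeff (monom 1 n :: complex poly) = 1" by (simp add: degree_monom_eq)
    show "degree (monom 1 n :: complex poly) > 0" using n1 by (simp add: degree_monom_eq)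
  qed simp_all
  hence "zeta n \<in> OK" by (simp add: OK_def zeta_in_cyclotomic_field)
  thus ?thesis using OK_power[of "zeta n" "n div m"] zeta_power_div[OF assms n1] by simp
qed

lemma prod_in_prime:
  assumes P: "is_prime P" and "finite T" "\<And>k. k \<in> T \<Longrightarrow> f k \<in> OK" "prod f T \<in> P"
  shows "\<exists>k\<in>T. f k \<in> P"
  using assms(2-)
proof (induction T rule: finite_induct)
  case empty thus ?case using is_primeD(5)[OF P] by simp
next
  case (insert k T)
  hence "f k \<in> P \<or> prod f T \<in> P"
    using is_primeD(4)[OF P, of "f k" "prod f T"] OK_prod[of T f] by auto
  thus ?case using insert by auto
qed

text \<open>By \<open>fermat\<close>, zeta_m^r = 1 modulo P for the remainder r of N(P) - 1 modulo
  m. If r were positive, P would contain the factor 1 - zeta_m^r of m from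
  \<open>prod_one_minus_zeta\<close>, hence m itself, although m is coprime to p.\<close>

lemma nrm_cong_1:
  assumes P: "is_prime P" and p: "prime (p::nat)" "of_nat p \<in> P" and m: "m dvd n" "\<not> p dvd m"
  shows "m dvd nrm P - 1"
proof (rule ccontr)
  assume "\<not> m dvd nrm P - 1"
  define r where "r = (nrm P - 1) mod m"
  have m1: "m \<ge> 1" using m by (cases "m = 0") auto
  have "r \<noteq> 0" using \<open>\<not> m dvd nrm P - 1\<close> by (simp add: r_def dvd_eq_mod_eq_0)
  hence r: "0 < r" "r < m" using m1 by (auto simp: r_def)
  note D = is_primeD[OF P]
  have z: "zeta m \<in> OK" by (rule zeta_OK[OF m(1)])
  have "zeta m \<notin> P"
  proof
    assume zP: "zeta m \<in> P"
    have "zeta m ^ (m - 1) * zeta m = 1" using m1 zeta_pow_self[OF m1] by (simp flip: power_Suc2)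
    thus False using is_idealD(3)[OF D(1) OK_power[OF z, of "m - 1"] zP] D(5) by simp
  qed
  hence "zeta m ^ r - 1 \<in> P" using fermat[OF P z] zeta_pow_mod[OF m1, of "nrm P - 1"] by (simp add: r_def)
  hence 1: "1 - zeta m ^ r \<in> P" using addsub_uminus[OF is_idealD(2)[OF D(1)]] by fastforce
  have "of_nat m = (\<Prod>k\<in>{1..<m}. 1 - zeta m ^ k)" by (rule prod_one_minus_zeta[OF m1, symmetric])
  also have "\<dots> = (1 - zeta m ^ r) * (\<Prod>k\<in>{1..<m} - {r}. 1 - zeta m ^ k)"
    using r by (intro prod.remove) auto
  also have "\<dots> \<in> P" by (intro is_idealD(4)[OF D(1) _ 1] OK_prod OK_diff OK_1 OK_power z)
  finally have mP: "of_nat m \<in> P" .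
  have "coprime p m" using p(1) m(2) by (simp add: prime_imp_coprime)
  hence "gcd (int p) (int m) = 1" by simp
  then obtain s t where st: "s * int p + t * int m = 1" using bezout_int[of "int p" "int m"] by auto
  have "of_int s * of_nat p + of_int t * of_nat m \<in> P"
    by (intro addsub_add[OF is_idealD(2)[OF D(1)]] addsub_of_int_mult[OF is_idealD(2)[OF D(1)]] p mP)
  moreover have "of_int s * of_nat p + of_int t * of_nat m = (of_int (s * int p + t * int m) :: complex)" by simp
  ultimately show False using D(5) unfolding st by simp
qed

text \<open>With q = p^a and u = 1 - zeta_q, p is the product of 1 - zeta_q^k over the k prime to q,
  and each factor is u times a geometric sum. Conversely every factor divides u, because k is
  invertible modulo q, so a prime above p contains u.\<close>

lemma prime_power_ramified:
  assumes p: "prime (p::nat)" and a: "a \<ge> 1" and q: "p ^ a dvd n"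
  shows "\<exists>u\<in>OK. \<exists>v\<in>OK. of_nat p = u ^ totient (p ^ a) * v \<and> (\<forall>P. is_prime P \<and> of_nat p \<in> P \<longrightarrow> u \<in> P)"
proof -
  define q where "q = p ^ a"
  define z where "z = zeta q"
  have p2: "p \<ge> 2" using prime_ge_2_nat[OF p] .
  have q1: "q \<ge> 1" using p2 by (simp add: q_def)
  have q2: "q = p * p ^ (a - 1)" using a by (simp add: q_def flip: power_Suc)
  have qp: "q \<ge> 2" unfolding q2 using p2 by (metis mult_le_mono one_le_power le_trans mult.right_neutral one_le_numeral)
  have cop: "coprime k q \<longleftrightarrow> \<not> p dvd k" for k
    using p a by (simp add: q_def coprime_commute[of k] prime_imp_coprime coprime_absorb_left prime_dvd_power_nat
        prime_elem_not_unit) (metis coprime_common_divisor dvd_refl not_prime_unit prime_imp_coprime)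
  define T where "T = totatives q"
  have T: "T = {k\<in>{1..<q}. \<not> p dvd k}"
  proof -
    have "k \<noteq> q" if "\<not> p dvd k" for k using that q2 by auto
    thus ?thesis unfolding T_def totatives_def using cop by force
  qed
  have finT: "finite T" by (simp add: T)
  have z: "z \<in> OK" unfolding z_def using zeta_OK q q_def by blast
  \<comment> \<open>The exponents divisible by \<open>p\<close> contribute the product belonging to
    p^(a - 1); cancelling it from the two evaluations leaves the totatives.\<close>
  have "{1..<q} = T \<union> (\<lambda>i. p * i) ` {1..<p ^ (a - 1)}"
    using p2 by (auto simp: T q2 elim!: dvdE)
  moreover have "T \<inter> (\<lambda>i. p * i) ` {1..<p ^ (a - 1)} = {}" by (auto simp: T)
  ultimately have "(\<Prod>k\<in>{1..<q}. 1 - z ^ k) =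
      (\<Prod>k\<in>T. 1 - z ^ k) * (\<Prod>k\<in>(\<lambda>i. p * i) ` {1..<p ^ (a - 1)}. 1 - z ^ k)"
    using finT by (simp add: prod.union_disjoint)
  also have "(\<Prod>k\<in>(\<lambda>i. p * i) ` {1..<p ^ (a - 1)}. 1 - z ^ k) = (\<Prod>i\<in>{1..<p ^ (a - 1)}. 1 - z ^ (p * i))"
    using p2 by (subst prod.reindex) (auto intro!: inj_onI)
  also have "\<dots> = (\<Prod>i\<in>{1..<p ^ (a - 1)}. 1 - zeta (p ^ (a - 1)) ^ i)"
  proof -
    have "zeta q ^ (q div p ^ (a - 1)) = zeta (p ^ (a - 1))" using q1 q2 by (intro zeta_power_div) auto
    moreover have "q div p ^ (a - 1) = p" using q2 p2 by simp
    ultimately have "z ^ p = zeta (p ^ (a - 1))" by (simp add: z_def)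
    thus ?thesis by (simp add: power_mult)
  qed
  also have "\<dots> = of_nat (p ^ (a - 1))" using p2 by (intro prod_one_minus_zeta) simp
  also have "(\<Prod>k\<in>{1..<q}. 1 - z ^ k) = of_nat q" unfolding z_def by (rule prod_one_minus_zeta[OF q1])
  finally have "of_nat p * of_nat (p ^ (a - 1)) = (\<Prod>k\<in>T. 1 - z ^ k) * of_nat (p ^ (a - 1))"
    unfolding q2 by (simp only: of_nat_mult)
  moreover have "of_nat (p ^ (a - 1)) \<noteq> (0::complex)" using p2 by simp
  ultimately have pT: "of_nat p = (\<Prod>k\<in>T. 1 - z ^ k)" by (simp only: mult_cancel_right) simp
  define v where "v = (\<Prod>k\<in>T. \<Sum>i<k. z ^ i)"
  have v: "v \<in> OK" unfolding v_def by (intro OK_prod OK_sum OK_power z)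
  have u: "1 - z \<in> OK" by (intro OK_diff OK_1 z)
  have "of_nat p = (\<Prod>k\<in>T. (1 - z) * (\<Sum>i<k. z ^ i))" unfolding pT by (simp only: one_diff_power_eq)
  hence eq: "of_nat p = (1 - z) ^ totient (p ^ a) * v"
    by (simp add: prod.distrib v_def totient_def T_def q_def)
  have "1 - z \<in> P" if P: "is_prime P" and pP: "of_nat p \<in> P" for P
  proof -
    have "\<exists>k\<in>T. 1 - z ^ k \<in> P"
      using pP unfolding pT by (intro prod_in_prime[OF P finT]) (auto intro: OK_diff OK_1 OK_power z)
    then obtain k where k: "k \<in> T" "1 - z ^ k \<in> P" by blast
    hence "coprime k q" using cop T by auto
    then obtain l where l: "[k * l = 1] (mod q)" using cong_solve_coprime_nat by auto
    hence "(k * l) mod q = 1" using qp by (simp add: unique_euclidean_semiring_class.cong_def)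
    hence "z ^ (k * l) = z" unfolding z_def using zeta_pow_mod[OF q1, of "k * l"] by simp
    hence "1 - z = 1 - (z ^ k) ^ l" by (simp add: power_mult)
    also have "\<dots> = (1 - z ^ k) * (\<Sum>i<l. (z ^ k) ^ i)" by (rule one_diff_power_eq)
    also have "\<dots> \<in> P" by (intro is_idealD(4)[OF is_primeD(1)[OF P]] OK_sum OK_power z k)
    finally show ?thesis .
  qed
  thus ?thesis using u v eq by blast
qed

text \<open>With t = phi(p^a) one has phi(n) = t phi(m). By \<open>primes_above_bound\<close> the
  t-th power of a product of norms is at most p^phi(n), while each norm is at least p, so at most
  phi(m) primes lie above p.\<close>

lemma primes_above:
  fixes p :: nat
  assumes p: "prime p"
  defines "m \<equiv> n div p ^ multiplicity p n"
  shows "finite {P. is_prime P \<and> of_nat p \<in> P} \<and> card {P. is_prime P \<and> of_nat p \<in> P} \<le> totient m"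
    "is_prime P \<Longrightarrow> of_nat p \<in> P \<Longrightarrow> m dvd nrm P - 1"
proof -
  define a where "a = multiplicity p n"
  have np: "n = p ^ a * m" unfolding m_def a_def by (simp add: multiplicity_dvd)
  have mp: "\<not> p dvd m" unfolding m_def using n1 p by (intro multiplicity_decompose) (auto dest: not_prime_unit)
  have p2: "p \<ge> 2" using prime_ge_2_nat[OF p] .
  show "is_prime P \<Longrightarrow> of_nat p \<in> P \<Longrightarrow> m dvd nrm P - 1"
    using nrm_cong_1[OF _ p _ _ mp] np by auto
  have "coprime (p ^ a) m" using mp p by (simp add: prime_imp_coprime)
  hence tot: "totient n = totient (p ^ a) * totient m" unfolding np by (rule totient_mult_coprime)
  define t where "t = totient (p ^ a)"
  have t: "t > 0" unfolding t_def using p2 by simp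
  obtain u v where uv: "u \<in> OK" "v \<in> OK" "of_nat p = u ^ t * v"
    "\<And>P. is_prime P \<Longrightarrow> of_nat p \<in> P \<Longrightarrow> u \<in> P"
  proof (cases "a = 0")
    case True
    \<comment> \<open>In the unramified case t = phi(1) = 1, so that u = p and v = 1 do.\<close>
    thus ?thesis using that[of "of_nat p" 1] OK_of_nat OK_1 by (simp add: t_def)
  next
    case False
    thus ?thesis using prime_power_ramified[OF p, of a] that np unfolding t_def by auto
  qed
  have "card G \<le> totient m" if G: "G \<subseteq> {P. is_prime P \<and> of_nat p \<in> P}" "finite G" for G
  proof -
    have "(\<Prod>P\<in>G. nrm P) ^ t \<le> p ^ totient n"
      using G uv(4) by (intro primes_above_bound[OF p uv(1-3)]) auto
    hence "(\<Prod>P\<in>G. nrm P) ^ t \<le> (p ^ totient m) ^ t" by (simp add: tot t_def mult.commute flip: power_mult)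
    hence "(\<Prod>P\<in>G. nrm P) \<le> p ^ totient m" using t by (simp add: power_mono_iff)
    moreover have "(\<Prod>P\<in>G. p) \<le> (\<Prod>P\<in>G. nrm P)"
    proof (rule prod_mono)
      fix P assume "P \<in> G"
      then obtain k where k: "k > 0" "nrm P = p ^ k" using nrm_char[of P p] p G by auto
      thus "0 \<le> p \<and> p \<le> nrm P" using p2 self_le_power[of p k] by simp
    qed
    ultimately have "p ^ card G \<le> p ^ totient m" by simp
    thus ?thesis using p2 by (simp add: power_increasing_iff)
  qed
  from finite_if_finite_subsets_card_bdd[of "{P. is_prime P \<and> of_nat p \<in> P}", OF this]
  show "finite {P. is_prime P \<and> of_nat p \<in> P} \<and> card {P. is_prime P \<and> of_nat p \<in> P} \<le> totient m" by blast
qed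

lemma finite_primes_le: "finite {P. is_prime P \<and> real (nrm P) \<le> x}"
proof (rule finite_subset)
  show "{P. is_prime P \<and> real (nrm P) \<le> x} \<subseteq> (\<Union>p\<in>{p. prime p \<and> p \<le> nat \<lfloor>x\<rfloor>}. {P. is_prime P \<and> of_nat p \<in> P})"
  proof safe
    fix P assume P: "is_prime P" "real (nrm P) \<le> x"
    obtain p :: nat where p: "prime p" "of_nat p \<in> P" using prime_in_prime[OF P(1)] by blast
    obtain k where k: "k > 0" "nrm P = p ^ k" using nrm_char[OF P(1) p] by blast
    have "p \<le> nrm P" using k prime_ge_1_nat[OF p(1)] self_le_power[of p k] by simp
    hence "p \<le> nat \<lfloor>x\<rfloor>" using P(2) by (simp add: le_nat_floor order.trans[OF of_nat_mono])
    thus "P \<in> (\<Union>p\<in>{p. prime p \<and> p \<le> nat \<lfloor>x\<rfloor>}. {P. is_prime P \<and> of_nat p \<in> P})" using P p by blast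
  qed
  show "finite (\<Union>p\<in>{p. prime p \<and> p \<le> nat \<lfloor>x\<rfloor>}. {P. is_prime P \<and> of_nat p \<in> P})"
    using primes_above(1) by (intro finite_UN_I) (auto intro: finite_subset[of _ "{..nat \<lfloor>x\<rfloor>}"])
qed

end

section \<open>The partial sum as a sum over exponent vectors\<close>

context number_ring
begin

lemma fac_extend:
  assumes "finite T" "S \<union> T \<subseteq> Collect is_prime" "finite S" "\<And>P. P \<in> T \<Longrightarrow> P \<notin> S \<Longrightarrow> e P = 0"
  shows "fac e (S \<union> T) = fac e S"
  using assms
proof (induction T rule: finite_induct)
  case (insert P T)
  show ?case
  proof (cases "P \<in> S \<union> T")
    case True
    hence "S \<union> insert P T = S \<union> T" by auto
    thus ?thesis using insert by simp
  next
    case False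
    hence eP: "e P = 0" using insert.prems by simp
    have sub: "S \<union> T \<subseteq> Collect is_prime" using insert.prems by auto
    have "fac e (insert P (S \<union> T)) = ideal_prod RK (P [^]\<^bsub>MK\<^esub> e P) (fac e (S \<union> T))"
      using insert.prems insert.hyps False by (intro fac_insert) auto
    also have "\<dots> = fac e (S \<union> T)" unfolding eP
      using ideal_prod_one[OF is_ideal_is_mod[OF is_ideal_fac[OF sub, of e]]] by simp
    finally show ?thesis using insert by simp
  qed
qed simp

text \<open>Unique factorization indexes the ideals of norm at most x by exponent vectors on the
  primes of norm at most x. Capping the exponents at k makes the index set finite and loses nothing,
  since 2^e <= x < 2^k for every exponent e that occurs.\<close>

lemma ideal_partial_sum_eq:
  assumes Q: "Q = {P. is_prime P \<and> real (nrm P) \<le> x}" and fin: "finite Q" and k: "x < 2 ^ k"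
    and g: "\<And>S e. finite S \<Longrightarrow> S \<subseteq> Collect is_prime \<Longrightarrow> g (fac e S) = (\<Prod>P\<in>S. g P ^ e P)"
  shows "ideal_partial_sum RK g x =
    (\<Sum>e | e \<in> Q \<rightarrow>\<^sub>E {..k} \<and> (\<Prod>P\<in>Q. real (nrm P) ^ e P) \<le> x. \<Prod>P\<in>Q. (g P / real (nrm P)) ^ e P)"
proof -
  define E where "E = {e. e \<in> Q \<rightarrow>\<^sub>E {..k} \<and> (\<Prod>P\<in>Q. real (nrm P) ^ e P) \<le> x}"
  have Qp: "Q \<subseteq> Collect is_prime" using Q by auto
  have nf: "real (nrm (fac e Q)) = (\<Prod>P\<in>Q. real (nrm P) ^ e P)" for e
    using fac_nonzero_nrm[OF fin Qp, of e] by simp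
  have "bij_betw (\<lambda>e. fac e Q) E {I. I \<in> nonzero_ideals RK \<and> real (ideal_norm RK I) \<le> x}"
    unfolding bij_betw_def
  proof (intro conjI inj_onI)
    fix e e' assume e: "e \<in> E" "e' \<in> E" "fac e Q = fac e' Q"
    have "\<forall>P\<in>Q. e P = e' P" by (rule fac_unique[OF fin Qp e(3)])
    thus "e = e'" using e by (intro PiE_ext[of e Q _ e']) (auto simp: E_def)
  next
    show "(\<lambda>e. fac e Q) ` E = {I. I \<in> nonzero_ideals RK \<and> real (ideal_norm RK I) \<le> x}"
    proof safe
      fix e assume e: "e \<in> E"
      have "is_ideal (fac e Q)" by (rule is_ideal_fac[OF Qp])
      thus "fac e Q \<in> nonzero_ideals RK" "real (ideal_norm RK (fac e Q)) \<le> x"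
        using fac_nonzero_nrm[OF fin Qp, of e] nf[of e] e
        by (auto simp: nonzero_ideals_def ideal_iff ideal_norm_eq E_def)
    next
      fix I assume I: "I \<in> nonzero_ideals RK" "real (ideal_norm RK I) \<le> x"
      hence I': "is_ideal I" "I \<noteq> {0}" "real (nrm I) \<le> x" by (auto simp: nonzero_ideals_def ideal_iff ideal_norm_eq)
      obtain S e where S: "finite S" "S \<subseteq> Collect is_prime" "I = fac e S" "\<And>P. P \<notin> S \<Longrightarrow> e P = 0"
        using ideal_factorization[OF I'(1,2)] by blast
      have nI: "nrm I = (\<Prod>P\<in>S. nrm P ^ e P)" using fac_nonzero_nrm[OF S(1,2), of e] S(3) by simp
      have pw: "nrm P ^ e P \<le> nrm I" if P: "P \<in> S" for P
      proof -
        have "nrm I = nrm P ^ e P * (\<Prod>P\<in>S - {P}. nrm P ^ e P)" unfolding nI by (rule prod.remove[OF S(1) P])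
        moreover have "(\<Prod>P\<in>S - {P}. nrm P ^ e P) \<ge> 1"
          using S(2) nrm_prime_ge_2 by (intro prod_ge_1) (force intro: one_le_power)
        ultimately show ?thesis by (metis mult.right_neutral mult_le_mono2)
      qed
      have inQ: "P \<in> Q \<and> e P \<le> k" if P: "P \<in> S" "e P > 0" for P
      proof -
        have pP: "is_prime P" and n2: "nrm P \<ge> 2" using S(2) P nrm_prime_ge_2 by auto
        have "nrm P \<le> nrm P ^ e P" using P n2 self_le_power[of "nrm P" "e P"] by simp
        hence "real (nrm P) \<le> x" using pw[OF P(1)] I'(3) by linarith
        moreover have "2 ^ e P \<le> nrm P ^ e P" using n2 by (rule power_mono) simp
        hence "real (2 ^ e P) \<le> x" using pw[OF P(1)] I'(3) by linarith
        hence "(2::real) ^ e P \<le> x" by simp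
        hence "(2::real) ^ e P < 2 ^ k" using k by (rule le_less_trans)
        hence "e P < k" using power_less_imp_less_exp[of "2::real" "e P" k] by simp
        ultimately show ?thesis using pP Q by simp
      qed
      have "fac e (S \<union> Q) = fac e S" using S Qp by (intro fac_extend fin) auto
      moreover have "fac e (Q \<union> S) = fac e Q"
      proof (rule fac_extend[OF S(1) _ fin])
        show "Q \<union> S \<subseteq> Collect is_prime" using S Qp by auto
        show "e P = 0" if "P \<in> S" "P \<notin> Q" for P using inQ[of P] that by auto
      qed
      ultimately have "I = fac e Q" using S(3) by (simp add: Un_commute)
      moreover have "fac e Q = fac (restrict e Q) Q" by (rule fac_cong[OF Qp]) simp
      ultimately have IQ: "I = fac (restrict e Q) Q" by simp
      have "restrict e Q \<in> E"
      proof -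
        have "e P \<le> k" if "P \<in> Q" for P using inQ[of P] S(4)[of P] by (cases "P \<in> S \<and> e P > 0") auto
        thus ?thesis using I'(3) nf[of "restrict e Q"] IQ by (auto simp: E_def)
      qed
      thus "I \<in> (\<lambda>e. fac e Q) ` E" using IQ by blast
    qed
  qed
  hence "ideal_partial_sum RK g x = (\<Sum>e\<in>E. g (fac e Q) / real (ideal_norm RK (fac e Q)))"
    unfolding ideal_partial_sum_def by (rule sum.reindex_bij_betw[symmetric])
  also have "\<dots> = (\<Sum>e\<in>E. \<Prod>P\<in>Q. (g P / real (nrm P)) ^ e P)"
    by (rule sum.cong) (simp_all add: g[OF fin Qp] ideal_norm_eq is_ideal_fac[OF Qp] nf power_divide prod_dividef)
  finally show ?thesis by (simp add: E_def)
qed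

end

section \<open>Primes in arithmetic progressions\<close>

lemma sum_crt:
  fixes f g :: "nat \<Rightarrow> real"
  assumes ab: "coprime a b" "a > 0" "b > 0"
    and f: "\<And>k. f (k mod a) = f k" and g: "\<And>k. g (k mod b) = g k"
  shows "(\<Sum>k<a * b. f k * g k) = (\<Sum>k<a. f k) * (\<Sum>k<b. g k)"
proof -
  have inj: "inj_on (\<lambda>k. (k mod a, k mod b)) {..<a * b}"
  proof (rule inj_onI)
    fix x y assume xy: "x \<in> {..<a * b}" "y \<in> {..<a * b}" "(x mod a, x mod b) = (y mod a, y mod b)"
    hence "[x = y] (mod a)" "[x = y] (mod b)" by (auto simp: unique_euclidean_semiring_class.cong_def)
    hence "[x = y] (mod (a * b))" using ab(1) coprime_cong_mult_nat by blast
    thus "x = y" using xy by (simp add: unique_euclidean_semiring_class.cong_def)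
  qed
  have sub: "(\<lambda>k. (k mod a, k mod b)) ` {..<a * b} \<subseteq> {..<a} \<times> {..<b}" using ab by auto
  have "card ((\<lambda>k. (k mod a, k mod b)) ` {..<a * b}) = card ({..<a} \<times> {..<b})"
    using card_image[OF inj] by simp
  hence "(\<lambda>k. (k mod a, k mod b)) ` {..<a * b} = {..<a} \<times> {..<b}"
    using card_subset_eq[OF _ sub] by simp
  hence bij: "bij_betw (\<lambda>k. (k mod a, k mod b)) {..<a * b} ({..<a} \<times> {..<b})"
    using inj by (simp add: bij_betw_def)
  have "(\<Sum>k<a * b. f k * g k) = (\<Sum>k<a * b. (\<lambda>(i, j). f i * g j) (k mod a, k mod b))"
    by (simp add: f g)
  also have "\<dots> = (\<Sum>(i, j)\<in>{..<a} \<times> {..<b}. f i * g j)"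
    by (rule sum.reindex_bij_betw[OF bij])
  finally show ?thesis by (simp add: sum_product sum.cartesian_product)
qed

lemma sum_prime_periods:
  fixes h :: "nat \<Rightarrow> nat \<Rightarrow> real"
  assumes "finite U" "\<And>p. p \<in> U \<Longrightarrow> prime p" "\<And>p k. p \<in> U \<Longrightarrow> h p (k mod p) = h p k"
  shows "(\<Sum>k<\<Prod>U. \<Prod>p\<in>U. h p k) = (\<Prod>p\<in>U. \<Sum>k<p. h p k)"
  using assms
proof (induction U rule: finite_induct)
  case (insert q U)
  have per: "(\<Prod>p\<in>U. h p (k mod \<Prod>U)) = (\<Prod>p\<in>U. h p k)" for k
  proof (rule prod.cong[OF refl])
    fix p assume p: "p \<in> U"
    have "p dvd \<Prod>U" using dvd_prodI[of U p "\<lambda>x. x"] p insert.hyps by simp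
    hence "h p (k mod \<Prod>U mod p) = h p (k mod p)" by (simp add: mod_mod_cancel)
    thus "h p (k mod \<Prod>U) = h p k" using insert.prems(2)[of p] p by simp
  qed
  have cop: "coprime q (\<Prod>U)"
    using insert.hyps insert.prems(1) by (intro prod_coprime_right primes_coprime) auto
  have "(\<Sum>k<\<Prod>(insert q U). \<Prod>p\<in>insert q U. h p k) = (\<Sum>k<q * \<Prod>U. h q k * (\<Prod>p\<in>U. h p k))"
    using insert.hyps by simp
  also have "\<dots> = (\<Sum>k<q. h q k) * (\<Sum>k<\<Prod>U. \<Prod>p\<in>U. h p k)"
    using insert.prems prime_gt_0_nat by (intro sum_crt cop per) (auto intro!: prod_pos)
  also have "(\<Sum>k<\<Prod>U. \<Prod>p\<in>U. h p k) = (\<Prod>p\<in>U. \<Sum>k<p. h p k)"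
    using insert.prems by (intro insert.IH) auto
  finally show ?case using insert.hyps by simp
qed simp

lemma sum_periodic:
  fixes g :: "nat \<Rightarrow> real"
  assumes D: "D > 0" and g: "\<And>k. g (k mod D) = g k" and M: "\<And>k. \<bar>g k\<bar> \<le> M"
  shows "\<bar>(\<Sum>k<L. g k) - real (L div D) * (\<Sum>k<D. g k)\<bar> \<le> real D * M"
proof -
  have per: "g (D * q + k) = g k" for q k using g[of "D * q + k"] g[of k] by simp
  have split: "(\<Sum>k<a + b. g k) = (\<Sum>k<a. g k) + (\<Sum>k<b. g (a + k))" for a b
    by (induction b) (simp_all add: add.assoc[symmetric])
  have 1: "(\<Sum>k<D * q. g k) = real q * (\<Sum>k<D. g k)" for q
  proof (induction q)
    case (Suc q)
    have "(\<Sum>k<D * Suc q. g k) = (\<Sum>k<D * q. g k) + (\<Sum>k<D. g (D * q + k))"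
      using split[of "D * q" D] by (simp add: add.commute)
    also have "(\<Sum>k<D. g (D * q + k)) = (\<Sum>k<D. g k)" by (simp only: per)
    finally show ?case using Suc by (simp add: algebra_simps)
  qed simp
  have "(\<Sum>k<L. g k) = (\<Sum>k<D * (L div D) + L mod D. g k)" by simp
  also have "\<dots> = real (L div D) * (\<Sum>k<D. g k) + (\<Sum>k<L mod D. g k)"
    unfolding split 1 by (simp only: per)
  finally have "\<bar>(\<Sum>k<L. g k) - real (L div D) * (\<Sum>k<D. g k)\<bar> = \<bar>\<Sum>k<L mod D. g k\<bar>" by simp
  also have "\<dots> \<le> (\<Sum>k<L mod D. \<bar>g k\<bar>)" by (rule sum_abs)
  also have "\<dots> \<le> real (L mod D) * M" using sum_bounded_above[of "{..<L mod D}" "\<lambda>k. \<bar>g k\<bar>" M] M by simp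
  also have "\<dots> \<le> real D * M"
    using D M[of 0] by (intro mult_right_mono) (auto simp: less_imp_le)
  finally show ?thesis .
qed

text \<open>Products of these weights are, up to sign, the Ramanujan sums occurring in the dual
  form of Selberg's sieve: each weight has mean zero over a period, which makes different products
  orthogonal, and equals \<open>1\<close> whenever \<open>1 + k n\<close> is not divisible by \<open>p\<close>.\<close>

definition ap_weight :: "nat \<Rightarrow> nat \<Rightarrow> nat \<Rightarrow> real" where
  "ap_weight n p k = (if p dvd 1 + k * n then 1 - real p else 1)"

lemma ap_weight_mod: "ap_weight n p (k mod p) = ap_weight n p k"
proof -
  have "(1 + (k mod p) * n) mod p = (1 + k * n) mod p" by (metis mod_add_right_eq mod_mult_left_eq)
  thus ?thesis by (simp add: ap_weight_def dvd_eq_mod_eq_0)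
qed

text \<open>As \<open>p\<close> does not divide \<open>n\<close>, exactly one residue k0 solves 1 +
  k n = 0 modulo p; the weight is 1 - p there and 1 at the other p - 1 residues.\<close>

lemma sum_ap_weight:
  assumes p: "prime p" "\<not> p dvd n"
  shows "(\<Sum>k<p. ap_weight n p k) = 0" "(\<Sum>k<p. (ap_weight n p k)\<^sup>2) = real p * (real p - 1)"
proof -
  have cop: "coprime n p" using prime_imp_coprime[of p n] p by (simp add: coprime_commute)
  have p0: "p > 0" using prime_gt_0_nat[OF p(1)] .
  obtain c0 where c0: "[n * c0 = Suc 0] (mod p)" using cong_solve_coprime_nat[OF cop] by auto
  define c where "c = c0 * (p - 1)"
  have c: "[n * c = p - 1] (mod p)"
    using cong_scalar_right[OF c0, of "p - 1"] by (simp add: c_def mult.assoc)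
  define k0 where "k0 = c mod p"
  have k0: "k0 < p" "p dvd 1 + k0 * n"
  proof -
    show "k0 < p" using p0 by (simp add: k0_def)
    have "[1 + k0 * n = 1 + (p - 1)] (mod p)"
      using c by (intro cong_add cong_refl) (simp add: k0_def unique_euclidean_semiring_class.cong_def mod_mult_left_eq mult.commute[of n c])
    thus "p dvd 1 + k0 * n" using p0 by (simp add: unique_euclidean_semiring_class.cong_def dvd_eq_mod_eq_0)
  qed
  have uniq: "k = k0" if k: "k < p" "p dvd 1 + k * n" for k
  proof -
    have "[1 + k * n = 1 + k0 * n] (mod p)" using k k0 by (simp add: unique_euclidean_semiring_class.cong_def dvd_eq_mod_eq_0)
    hence "[k * n = k0 * n] (mod p)" by (rule cong_add_lcancel_nat[THEN iffD1])
    hence "[k = k0] (mod p)" by (rule cong_mult_rcancel_nat[OF cop, THEN iffD1])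
    thus ?thesis using k k0 by (simp add: unique_euclidean_semiring_class.cong_def)
  qed
  have w: "ap_weight n p k = (if k = k0 then 1 - real p else 1)" if "k < p" for k
  proof (cases "k = k0")
    case True
    thus ?thesis using k0(2) by (simp add: ap_weight_def)
  next
    case False
    hence "\<not> p dvd 1 + k * n" using uniq[OF that] by blast
    thus ?thesis using False by (simp add: ap_weight_def)
  qed
  have s: "(\<Sum>k<p. if k = k0 then a else b) = a + (real p - 1) * b" for a b :: real
  proof -
    have "(\<Sum>k<p. if k = k0 then a else b) = a + (\<Sum>k\<in>{..<p} - {k0}. if k = k0 then a else b)"
      using k0(1) by (subst sum.remove[of _ k0]) auto
    also have "(\<Sum>k\<in>{..<p} - {k0}. if k = k0 then a else b) = (\<Sum>k\<in>{..<p} - {k0}. b)"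
      by (rule sum.cong) auto
    also have "\<dots> = (real p - 1) * b" using k0(1) p0 by (simp add: of_nat_diff Suc_leI)
    finally show ?thesis .
  qed
  have "(\<Sum>k<p. ap_weight n p k) = (\<Sum>k<p. if k = k0 then 1 - real p else 1)"
    by (rule sum.cong) (simp_all add: w)
  thus "(\<Sum>k<p. ap_weight n p k) = 0" by (simp only: s) simp
  have "(\<Sum>k<p. (ap_weight n p k)\<^sup>2) = (\<Sum>k<p. if k = k0 then (1 - real p)\<^sup>2 else 1)"
    by (rule sum.cong) (simp_all add: w)
  thus "(\<Sum>k<p. (ap_weight n p k)\<^sup>2) = real p * (real p - 1)"
    by (simp only: s) (simp add: power2_eq_square algebra_simps)
qed

text \<open>A set S stands for the squarefree number d = \<Prod>S, coprime to n and at most z;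
  \<open>sieve_phi\<close> is then phi(d), and \<open>sieve_G\<close> is Selberg's sum of mu(d)^2 /
  phi(d).\<close>

definition sieve_sets :: "nat \<Rightarrow> nat \<Rightarrow> nat set set" where
  "sieve_sets n z = {S. S \<subseteq> {p. prime p \<and> p \<le> z \<and> \<not> p dvd n} \<and> \<Prod>S \<le> z}"

definition sieve_phi :: "nat set \<Rightarrow> real" where "sieve_phi S = (\<Prod>p\<in>S. real p - 1)"

definition sieve_G :: "nat \<Rightarrow> nat \<Rightarrow> real" where
  "sieve_G n z = (\<Sum>S\<in>sieve_sets n z. 1 / sieve_phi S)"

lemma sieve_setsD:
  assumes "S \<in> sieve_sets n z"
  shows "finite S" "\<And>p. p \<in> S \<Longrightarrow> prime p" "\<And>p. p \<in> S \<Longrightarrow> \<not> p dvd n" "\<And>p. p \<in> S \<Longrightarrow> p \<le> z" "\<Prod>S \<le> z"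
  using assms finite_subset[of S "{..z}"] by (auto simp: sieve_sets_def)

lemma finite_sieve_sets: "finite (sieve_sets n z)"
  by (rule finite_subset[of _ "Pow {..z}"]) (auto simp: sieve_sets_def)

lemma sieve_phi_ge_1: "S \<in> sieve_sets n z \<Longrightarrow> sieve_phi S \<ge> 1"
  unfolding sieve_phi_def by (intro prod_ge_1) (auto dest!: sieve_setsD(2) prime_ge_2_nat)

text \<open>By unique factorization the product of a set of primes determines the set.\<close>

lemma card_sieve_sets: "card (sieve_sets n z) \<le> z"
proof -
  have "inj_on \<Prod> (sieve_sets n z)"
  proof (rule inj_onI)
    fix S T assume S: "S \<in> sieve_sets n z" and T: "T \<in> sieve_sets n z" and eq: "\<Prod>S = \<Prod>T"
    have "prime_factors (\<Prod>S) = S" if "S \<in> sieve_sets n z" for S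
    proof -
      note D = sieve_setsD[OF that]
      have "prime_factors (\<Prod>S) = (\<Union>p\<in>S. prime_factors p)"
        using D prime_gt_0_nat by (subst prime_factors_prod) (auto simp: not_less)
      also have "\<dots> = S" using D by (auto simp: prime_prime_factors)
      finally show ?thesis .
    qed
    thus "S = T" using S T eq by metis
  qed
  moreover have "\<Prod> ` sieve_sets n z \<subseteq> {1..z}"
    using sieve_setsD prime_gt_0_nat by (fastforce intro!: Suc_leI prod_pos)
  ultimately have "card (sieve_sets n z) \<le> card {1..z}" by (intro card_inj_on_le) auto
  thus ?thesis by simp
qed

text \<open>By the Chinese remainder theorem the complete sum factors over the primes, and a prime
  lying in only one of the two sets contributes 0, which leaves the diagonal. Periodicity and the
  size bound feed \<open>sum_periodic\<close>.\<close>

lemma sum_sieve_pair: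
  assumes S: "S \<in> sieve_sets n z" and T: "T \<in> sieve_sets n z"
  shows "(\<Sum>k<\<Prod>(S \<union> T). (\<Prod>p\<in>S. ap_weight n p k) * (\<Prod>p\<in>T. ap_weight n p k)) =
    (if S = T then real (\<Prod>S) * sieve_phi S else 0)"
    "\<And>k. (\<Prod>p\<in>S. ap_weight n p (k mod \<Prod>(S \<union> T))) = (\<Prod>p\<in>S. ap_weight n p k)"
    "\<And>k. \<bar>\<Prod>p\<in>S. ap_weight n p k\<bar> \<le> sieve_phi S"
proof -
  note DS = sieve_setsD[OF S] and DT = sieve_setsD[OF T]
  define h where "h p k = (if p \<in> S then ap_weight n p k else 1) * (if p \<in> T then ap_weight n p k else 1)" for p k
  have fin: "finite (S \<union> T)" using DS DT by auto
  have "(\<Prod>p\<in>S. ap_weight n p k) = (\<Prod>p\<in>S \<union> T. if p \<in> S then ap_weight n p k else 1)" for k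
    using fin by (intro prod.mono_neutral_cong_left) auto
  moreover have "(\<Prod>p\<in>T. ap_weight n p k) = (\<Prod>p\<in>S \<union> T. if p \<in> T then ap_weight n p k else 1)" for k
    using fin by (intro prod.mono_neutral_cong_left) auto
  ultimately have "(\<Sum>k<\<Prod>(S \<union> T). (\<Prod>p\<in>S. ap_weight n p k) * (\<Prod>p\<in>T. ap_weight n p k)) =
      (\<Sum>k<\<Prod>(S \<union> T). \<Prod>p\<in>S \<union> T. h p k)"
    by (simp only: h_def prod.distrib)
  also have "\<dots> = (\<Prod>p\<in>S \<union> T. \<Sum>k<p. h p k)"
    using fin DS DT by (intro sum_prime_periods) (auto simp: h_def ap_weight_mod)
  also have "\<dots> = (if S = T then real (\<Prod>S) * sieve_phi S else 0)"
  proof (cases "S = T")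
    case True
    have "(\<Prod>p\<in>S \<union> T. \<Sum>k<p. h p k) = (\<Prod>p\<in>S. real p * (real p - 1))"
    proof (rule prod.cong)
      fix p assume "p \<in> S"
      thus "(\<Sum>k<p. h p k) = real p * (real p - 1)"
        using sum_ap_weight(2)[of p n] DS True by (simp add: h_def power2_eq_square)
    qed (use True in simp)
    thus ?thesis using True by (simp add: prod.distrib sieve_phi_def)
  next
    case False
    then obtain p where p: "p \<in> S \<union> T" "p \<notin> S \<or> p \<notin> T" by blast
    have "prime p" "\<not> p dvd n" using p DS DT by auto
    moreover have "h p = ap_weight n p" using p by (auto simp: h_def fun_eq_iff)
    ultimately have "(\<Sum>k<p. h p k) = 0" using sum_ap_weight(1) by simp
    thus ?thesis using False p fin by (simp add: prod_zero_iff) blast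
  qed
  finally show "(\<Sum>k<\<Prod>(S \<union> T). (\<Prod>p\<in>S. ap_weight n p k) * (\<Prod>p\<in>T. ap_weight n p k)) =
    (if S = T then real (\<Prod>S) * sieve_phi S else 0)" .
  show "(\<Prod>p\<in>S. ap_weight n p (k mod \<Prod>(S \<union> T))) = (\<Prod>p\<in>S. ap_weight n p k)" for k
  proof (rule prod.cong[OF refl])
    fix p assume p: "p \<in> S"
    have "p dvd \<Prod>(S \<union> T)" using dvd_prodI[of "S \<union> T" p "\<lambda>x. x"] p fin by simp
    hence "ap_weight n p (k mod \<Prod>(S \<union> T) mod p) = ap_weight n p (k mod p)"
      by (simp add: mod_mod_cancel)
    thus "ap_weight n p (k mod \<Prod>(S \<union> T)) = ap_weight n p k" by (simp only: ap_weight_mod)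
  qed
  show "\<bar>\<Prod>p\<in>S. ap_weight n p k\<bar> \<le> sieve_phi S" for k
    unfolding abs_prod sieve_phi_def
  proof (rule prod_mono)
    fix p assume "p \<in> S"
    hence "p \<ge> 2" using prime_ge_2_nat[OF DS(2)] by simp
    thus "0 \<le> \<bar>ap_weight n p k\<bar> \<and> \<bar>ap_weight n p k\<bar> \<le> real p - 1" by (simp add: ap_weight_def)
  qed
qed

text \<open>The test function \<open>h\<close> equals G at every sifted k, so its second moment over
  k < L is at least |A| G^2. In the expanded square the diagonal gives at most L G by orthogonality,
  and each of the at most z^2 pairs adds an error of at most z^2 from an incomplete period.\<close>

lemma selberg_sieve:
  assumes A: "A \<subseteq> {..<L}" "\<And>k p. k \<in> A \<Longrightarrow> prime p \<Longrightarrow> p \<le> z \<Longrightarrow> \<not> p dvd 1 + k * n"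
  shows "real (card A) * (sieve_G n z)\<^sup>2 \<le> real L * sieve_G n z + real z ^ 4"
proof -
  define F where "F = sieve_sets n z"
  define b where "b S k = (\<Prod>p\<in>S. ap_weight n p k)" for S k
  define h where "h k = (\<Sum>S\<in>F. b S k / sieve_phi S)" for k
  have hA: "h k = sieve_G n z" if k: "k \<in> A" for k
  proof -
    have "b S k = 1" if S: "S \<in> F" for S
      unfolding b_def using sieve_setsD[OF S[unfolded F_def]] A(2)[OF k]
      by (intro prod.neutral) (auto simp: ap_weight_def)
    thus ?thesis by (simp add: h_def sieve_G_def F_def)
  qed
  have pair: "(\<Sum>k<L. b S k * b T k) / (sieve_phi S * sieve_phi T) \<le>
      (if S = T then real L / sieve_phi S else 0) + real z ^ 2" if S: "S \<in> F" and T: "T \<in> F" for S T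
  proof -
    have S': "S \<in> sieve_sets n z" and T': "T \<in> sieve_sets n z" using S T by (auto simp: F_def)
    note DS = sieve_setsD[OF S'] and DT = sieve_setsD[OF T']
    note PST = sum_sieve_pair[OF S' T'] and PTS = sum_sieve_pair[OF T' S']
    define D where "D = \<Prod>(S \<union> T)"
    have D0: "D > 0" unfolding D_def using DS DT prime_gt_0_nat by (intro prod_pos) auto
    have "D \<le> \<Prod>S * \<Prod>T"
    proof -
      have "D * \<Prod>(S \<inter> T) = \<Prod>S * \<Prod>T" unfolding D_def using DS DT by (intro prod.union_inter) auto
      moreover have "\<Prod>(S \<inter> T) > 0" using DS DT prime_gt_0_nat by (intro prod_pos) auto
      hence "1 \<le> \<Prod>(S \<inter> T)" by simp
      ultimately show ?thesis by (metis mult.right_neutral mult_le_mono2)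
    qed
    also have "\<dots> \<le> z * z" using DS(5) DT(5) by (rule mult_le_mono)
    finally have Dz: "real D \<le> real z ^ 2" by (simp add: power2_eq_square flip: of_nat_mult)
    have ph: "sieve_phi S \<ge> 1" "sieve_phi T \<ge> 1" using sieve_phi_ge_1 S' T' by auto
    have "\<bar>b S k * b T k\<bar> \<le> sieve_phi S * sieve_phi T" for k
      unfolding abs_mult b_def using PST(3)[of k] PTS(3)[of k] ph by (intro mult_mono) auto
    moreover have "b S (k mod D) * b T (k mod D) = b S k * b T k" for k
      unfolding b_def D_def using PST(2)[of k] PTS(2)[of k] by (simp add: Un_commute)
    ultimately have "\<bar>(\<Sum>k<L. b S k * b T k) - real (L div D) * (\<Sum>k<D. b S k * b T k)\<bar> \<le> real D * (sieve_phi S * sieve_phi T)"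
      by (intro sum_periodic D0)
    hence "(\<Sum>k<L. b S k * b T k) \<le> real (L div D) * (\<Sum>k<D. b S k * b T k) + real D * (sieve_phi S * sieve_phi T)"
      by linarith
    also have "(\<Sum>k<D. b S k * b T k) = (if S = T then real (\<Prod>S) * sieve_phi S else 0)"
      using PST(1) by (simp only: D_def b_def)
    also have "real (L div D) * (if S = T then real (\<Prod>S) * sieve_phi S else 0) \<le> (if S = T then real L * sieve_phi S else 0)"
    proof (cases "S = T")
      case True
      hence "real (L div D) * real (\<Prod>S) \<le> real L" unfolding D_def
        by (simp flip: of_nat_mult del: of_nat_prod add: times_div_less_eq_dividend)
      thus ?thesis using True ph by (simp add: mult.assoc[symmetric] mult_right_mono del: of_nat_prod)
    qed simp
    also have "real D * (sieve_phi S * sieve_phi T) \<le> real z ^ 2 * (sieve_phi S * sieve_phi T)"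
      using Dz ph by (intro mult_right_mono) auto
    finally have "(\<Sum>k<L. b S k * b T k) \<le> (if S = T then real L * sieve_phi S else 0) + real z ^ 2 * (sieve_phi S * sieve_phi T)"
      by simp
    hence "(\<Sum>k<L. b S k * b T k) / (sieve_phi S * sieve_phi T) \<le>
        ((if S = T then real L * sieve_phi S else 0) + real z ^ 2 * (sieve_phi S * sieve_phi T)) / (sieve_phi S * sieve_phi T)"
      using ph by (intro divide_right_mono) auto
    also have "\<dots> = (if S = T then real L / sieve_phi S else 0) + real z ^ 2"
      using ph by (auto simp: field_simps)
    finally show ?thesis .
  qed
  have "real (card A) * (sieve_G n z)\<^sup>2 = (\<Sum>k\<in>A. (h k)\<^sup>2)" by (simp add: hA)
  also have "\<dots> \<le> (\<Sum>k<L. (h k)\<^sup>2)" using A(1) by (intro sum_mono2) auto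
  also have "\<dots> = (\<Sum>k<L. \<Sum>S\<in>F. \<Sum>T\<in>F. b S k * b T k / (sieve_phi S * sieve_phi T))"
    by (simp add: h_def power2_eq_square sum_product)
  also have "\<dots> = (\<Sum>S\<in>F. \<Sum>T\<in>F. (\<Sum>k<L. b S k * b T k) / (sieve_phi S * sieve_phi T))"
    unfolding sum_divide_distrib by (subst sum.swap, rule sum.cong[OF refl], rule sum.swap)
  also have "\<dots> \<le> (\<Sum>S\<in>F. \<Sum>T\<in>F. (if S = T then real L / sieve_phi S else 0) + real z ^ 2)"
    by (intro sum_mono pair)
  also have "\<dots> = real L * sieve_G n z + real (card F) ^ 2 * real z ^ 2"
    using finite_sieve_sets[of n z]
    by (simp add: sum.distrib F_def sieve_G_def sum_distrib_left power2_eq_square mult_ac)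
  also have "real (card F) ^ 2 * real z ^ 2 \<le> real z ^ 2 * real z ^ 2"
    using card_sieve_sets[of n z] by (intro mult_right_mono power_mono) (auto simp: F_def)
  finally show ?thesis by (simp flip: power_add)
qed

text \<open>Numbers whose set of prime factors is U correspond to positive exponents on U, and the
  geometric series from exponent 1 on sums to 1 / (p - 1).\<close>

lemma sum_inverse_prime_factors:
  assumes U: "finite U" "\<And>p. p \<in> U \<Longrightarrow> prime p"
  shows "(\<Sum>m | m \<in> {1..z} \<and> prime_factors m = U. 1 / real m) \<le> (\<Prod>p\<in>U. 1 / (real p - 1))"
proof -
  define A where "A = {m \<in> {1..z}. prime_factors m = U}"
  define \<phi> where "\<phi> m = restrict (\<lambda>p. multiplicity p m) U" for m :: nat
  have dec: "m = (\<Prod>p\<in>U. p ^ \<phi> m p)" if "m \<in> A" for m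
  proof -
    have "m = (\<Prod>p\<in>prime_factors m. p ^ multiplicity p m)"
      using that by (intro prime_factorization_nat) (auto simp: A_def)
    thus ?thesis using that by (simp add: A_def \<phi>_def)
  qed
  have inj: "inj_on \<phi> A" by (rule inj_onI) (metis dec)
  have img: "\<phi> ` A \<subseteq> U \<rightarrow>\<^sub>E {1..z}"
  proof (rule image_subsetI)
    fix m assume m: "m \<in> A"
    have "multiplicity p m \<in> {1..z}" if p: "p \<in> U" for p
    proof -
      have m0: "m > 0" "m \<le> z" "p \<in> prime_factors m" using m p by (auto simp: A_def)
      hence pd: "prime p" "p dvd m" by (auto simp: in_prime_factors_iff)
      have "multiplicity p m > 0" using pd m0 by (simp add: prime_multiplicity_gt_zero_iff)
      moreover have "p ^ multiplicity p m \<le> m" using m0 by (intro dvd_imp_le multiplicity_dvd) auto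
      hence "multiplicity p m \<le> z" using less_exp[of "multiplicity p m"] power_mono[of 2 p "multiplicity p m"]
          prime_ge_2_nat[OF pd(1)] m0(2) by linarith
      ultimately show ?thesis by simp
    qed
    thus "\<phi> m \<in> U \<rightarrow>\<^sub>E {1..z}" by (auto simp: \<phi>_def)
  qed
  have "(\<Sum>m\<in>A. 1 / real m) = (\<Sum>m\<in>A. \<Prod>p\<in>U. (1 / real p) ^ \<phi> m p)"
  proof (rule sum.cong[OF refl])
    fix m assume "m \<in> A"
    from arg_cong[OF dec[OF this], of real]
    have "real m = (\<Prod>p\<in>U. real p ^ \<phi> m p)" by simp
    thus "1 / real m = (\<Prod>p\<in>U. (1 / real p) ^ \<phi> m p)" by (simp add: power_divide prod_dividef)
  qed
  also have "\<dots> = (\<Sum>e\<in>\<phi> ` A. \<Prod>p\<in>U. (1 / real p) ^ e p)"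
    by (simp add: sum.reindex[OF inj])
  also have "\<dots> \<le> (\<Sum>e\<in>U \<rightarrow>\<^sub>E {1..z}. \<Prod>p\<in>U. (1 / real p) ^ e p)"
    using U(1) by (intro sum_mono2 img finite_PiE) (auto intro!: prod_nonneg)
  also have "\<dots> = (\<Prod>p\<in>U. \<Sum>j\<in>{1..z}. (1 / real p) ^ j)"
    using U(1) by (simp add: prod_sum_PiE)
  also have "\<dots> \<le> (\<Prod>p\<in>U. 1 / (real p - 1))"
  proof (rule prod_mono)
    fix p assume "p \<in> U"
    hence p2: "real p \<ge> 2" using U(2) prime_ge_2_nat by fastforce
    have "(\<Sum>j\<in>{1..z}. (1 / real p) ^ j) \<le> (1 - (1 / real p) ^ z) / (real p - 1)"
    proof (induction z)
      case (Suc z)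
      have "(\<Sum>j\<in>{1..Suc z}. (1 / real p) ^ j) \<le> (1 - (1 / real p) ^ z) / (real p - 1) + (1 / real p) ^ Suc z"
        using Suc by simp
      also have "\<dots> = (1 - (1 / real p) ^ Suc z) / (real p - 1)" using p2 by (simp add: field_simps)
      finally show ?case .
    qed simp
    also have "\<dots> \<le> 1 / (real p - 1)" using p2 by (intro divide_right_mono) auto
    finally show "0 \<le> (\<Sum>j\<in>{1..z}. (1 / real p) ^ j) \<and> (\<Sum>j\<in>{1..z}. (1 / real p) ^ j) \<le> 1 / (real p - 1)"
      by (auto intro!: sum_nonneg)
  qed
  finally show ?thesis by (simp add: A_def)
qed

text \<open>Group the m <= z by their prime factors off n, which form a sieve set, and those
  dividing n. This bounds the harmonic sum by G times the product of p / (p - 1) over p dividing n,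
  which is n / phi(n). The factor phi(n) / n later turns the density 1 / n of the progression into 1
  / phi(n).\<close>

lemma sieve_G_lower:
  assumes n: "n \<ge> 1" and z: "z \<ge> 1"
  shows "real (totient n) / real n * ln (real z) \<le> sieve_G n z"
proof -
  define N where "N = prime_factors n"
  have finN: "finite N" by (simp add: N_def)
  have Np: "prime p" "real p \<ge> 2" if "p \<in> N" for p using that prime_ge_2_nat[of p] by (auto simp: N_def)
  define \<phi> where "\<phi> m = (prime_factors m - N, prime_factors m \<inter> N)" for m :: nat
  have map: "\<phi> ` {1..z} \<subseteq> sieve_sets n z \<times> Pow N"
  proof (rule image_subsetI)
    fix m assume m: "m \<in> {1..z}"
    have "\<Prod>(prime_factors m - N) \<le> m"
    proof (rule dvd_imp_le)
      have "\<Prod>(prime_factors m - N) dvd (\<Prod>p\<in>prime_factors m. p)" by (rule prod_dvd_prod_subset) auto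
      also have "\<dots> dvd (\<Prod>p\<in>prime_factors m. p ^ multiplicity p m)"
        using m by (intro prod_dvd_prod) (auto simp: prime_factors_multiplicity intro: dvd_power)
      also have "\<dots> = m" using m by (intro prime_factorization_nat[symmetric]) auto
      finally show "\<Prod>(prime_factors m - N) dvd m" .
    qed (use m in auto)
    moreover have "p \<le> z" if "p \<in> prime_factors m" for p
      using that m by (auto simp: in_prime_factors_iff dest: dvd_imp_le)
    ultimately have "prime_factors m - N \<in> sieve_sets n z"
      using m n by (auto simp: sieve_sets_def N_def in_prime_factors_iff)
    thus "\<phi> m \<in> sieve_sets n z \<times> Pow N" by (simp add: \<phi>_def)
  qed
  have "harm z = (\<Sum>m\<in>{1..z}. 1 / real m)" by (simp add: harm_def inverse_eq_divide)
  also have "\<dots> = (\<Sum>y\<in>sieve_sets n z \<times> Pow N. \<Sum>m\<in>{m \<in> {1..z}. \<phi> m = y}. 1 / real m)"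
    by (rule sum.group[symmetric]) (use finN finite_sieve_sets map in auto)
  also have "\<dots> \<le> (\<Sum>y\<in>sieve_sets n z \<times> Pow N. 1 / sieve_phi (fst y) * (\<Prod>p\<in>snd y. 1 / (real p - 1)))"
  proof (rule sum_mono)
    fix y assume y: "y \<in> sieve_sets n z \<times> Pow N"
    obtain S T where ST: "y = (S, T)" "S \<in> sieve_sets n z" "T \<subseteq> N" using y by auto
    note D = sieve_setsD[OF ST(2)]
    have dis: "S \<inter> T = {}" using D(3) ST(3) by (auto simp: N_def in_prime_factors_iff)
    have finT: "finite T" using finite_subset[OF ST(3) finN] .
    have "(\<Sum>m\<in>{m \<in> {1..z}. \<phi> m = y}. 1 / real m) \<le> (\<Sum>m | m \<in> {1..z} \<and> prime_factors m = S \<union> T. 1 / real m)"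
      by (rule sum_mono2) (auto simp: \<phi>_def ST)
    also have "\<dots> \<le> (\<Prod>p\<in>S \<union> T. 1 / (real p - 1))"
      using D finT Np ST(3) by (intro sum_inverse_prime_factors) auto
    also have "\<dots> = (\<Prod>p\<in>S. 1 / (real p - 1)) * (\<Prod>p\<in>T. 1 / (real p - 1))"
      using D finT dis by (intro prod.union_disjoint) auto
    also have "(\<Prod>p\<in>S. 1 / (real p - 1)) = 1 / sieve_phi S" by (simp add: sieve_phi_def prod_dividef)
    finally show "(\<Sum>m\<in>{m \<in> {1..z}. \<phi> m = y}. 1 / real m) \<le> 1 / sieve_phi (fst y) * (\<Prod>p\<in>snd y. 1 / (real p - 1))"
      by (simp add: ST)
  qed
  also have "\<dots> = sieve_G n z * (\<Sum>T\<in>Pow N. \<Prod>p\<in>T. 1 / (real p - 1))"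
    by (simp add: sieve_G_def sum_product sum.cartesian_product case_prod_unfold)
  also have "(\<Sum>T\<in>Pow N. \<Prod>p\<in>T. 1 / (real p - 1)) = (\<Prod>p\<in>N. 1 / (real p - 1) + 1)"
    by (subst prod_add[OF finN]) simp
  also have "\<dots> = (\<Prod>p\<in>N. 1 / (1 - 1 / real p))"
    by (rule prod.cong) (use Np in \<open>force simp: field_simps\<close>)+
  also have "\<dots> = 1 / (\<Prod>p\<in>N. 1 - 1 / real p)" by (simp add: prod_dividef)
  finally have h: "harm z \<le> sieve_G n z * (1 / (\<Prod>p\<in>N. 1 - 1 / real p))" .
  have tot: "real (totient n) / real n = (\<Prod>p\<in>N. 1 - 1 / real p)"
    using n by (simp add: totient_formula2 N_def)
  have pos: "(\<Prod>p\<in>N. 1 - 1 / real p) > 0" using Np by (intro prod_pos) (force simp: field_simps)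
  have "ln (real z) \<le> ln (real z + 1)" using z by simp
  also have "\<dots> \<le> harm z" by (rule ln_le_harm)
  finally have "ln (real z) * (\<Prod>p\<in>N. 1 - 1 / real p) \<le> harm z * (\<Prod>p\<in>N. 1 - 1 / real p)"
    using pos by (intro mult_right_mono) auto
  also have "\<dots> \<le> sieve_G n z" using h pos by (simp add: field_simps)
  finally have "ln (real z) * (\<Prod>p\<in>N. 1 - 1 / real p) \<le> sieve_G n z" .
  thus ?thesis unfolding tot by (simp add: mult.commute)
qed

lemma sieve_G_ge_1: "z \<ge> 1 \<Longrightarrow> sieve_G n z \<ge> 1"
proof -
  assume "z \<ge> 1"
  hence "{} \<in> sieve_sets n z" by (simp add: sieve_sets_def)
  hence "1 / sieve_phi {} \<le> sieve_G n z"
    unfolding sieve_G_def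
    using sieve_phi_ge_1[of _ n z] by (intro member_le_sum finite_sieve_sets) (fastforce intro: divide_nonneg_nonneg)+
  thus ?thesis by (simp add: sieve_phi_def)
qed

text \<open>Brun-Titchmarsh for a dyadic block: the progression has O(2^j / n) members, and the
  sieve divides this by G, which is at least a constant times j phi(n) / n.\<close>

lemma ap_prime_count:
  assumes n: "n \<ge> 1" and j: "j \<ge> 1" and nj: "n ^ 4 \<le> 2 ^ (j + 1)"
  defines "A \<equiv> {p. prime p \<and> n dvd p - 1 \<and> 2 ^ j \<le> p \<and> p < 2 ^ (j + 1)}"
  shows "real (totient n) * real (card A) \<le> 400 * 2 ^ j / real j"
proof -
  define B where "B = {k. prime (1 + k * n) \<and> 2 ^ j \<le> 1 + k * n \<and> 1 + k * n < 2 ^ (j + 1)}"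
  define L where "L = 2 ^ (j + 1) div n + 1"
  have BL: "B \<subseteq> {..<L}"
  proof
    fix k assume "k \<in> B"
    hence "k * n \<le> 2 ^ (j + 1)" by (simp add: B_def)
    hence "k \<le> 2 ^ (j + 1) div n" using n by (simp add: less_eq_div_iff_mult_less_eq)
    thus "k \<in> {..<L}" by (simp add: L_def)
  qed
  have "A \<subseteq> (\<lambda>k. 1 + k * n) ` B"
  proof
    fix p assume p: "p \<in> A"
    hence p1: "p \<ge> 1" using prime_ge_1_nat[of p] by (simp add: A_def)
    obtain k where "p - 1 = n * k" using p by (auto simp: A_def elim: dvdE)
    hence "p = 1 + k * n" using p1 by (simp add: mult.commute)
    thus "p \<in> (\<lambda>k. 1 + k * n) ` B" using p by (auto simp: A_def B_def)
  qed
  hence AB: "card A \<le> card B" using finite_subset[OF BL] by (meson finite_lessThan surj_card_le)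
  have "n \<le> n ^ 4" using n by (simp add: self_le_power)
  hence n2: "n \<le> 2 ^ (j + 1)" using nj by linarith
  have "real L \<le> 2 ^ (j + 1) / real n + 1"
    unfolding L_def using of_nat_div_le_of_nat[of "2 ^ (j + 1)" n, where ?'a = real] by simp
  also have "1 \<le> 2 ^ (j + 1) / real n"
    using n n2 by (simp add: le_divide_eq) (metis of_nat_le_iff of_nat_numeral of_nat_power power_Suc of_nat_mult)
  finally have L: "real L \<le> 4 * 2 ^ j / real n" by simp
  have tn: "totient n \<le> n" by (rule totient_le)
  show ?thesis
  proof (cases "j < 16")
    case True
    \<comment> \<open>For j < 16 counting all members of the progression suffices, as 4 <= 400 /
      j.\<close>
    have "card B \<le> L" using card_mono[OF _ BL] by simp
    hence "real (totient n) * real (card A) \<le> real n * (4 * 2 ^ j / real n)"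
      using AB L tn by (intro mult_mono) auto
    also have "\<dots> = 4 * 2 ^ j" using n by simp
    also have "\<dots> \<le> 400 * 2 ^ j / real j" using True j by (simp add: field_simps)
    finally show ?thesis .
  next
    case False
    \<comment> \<open>The level keeps z^4 at most 2^(j/4). With n also at most about 2^(j/4) and j
      at most about 2^(j/2), the sieve error satisfies n z^4 = O(2^j / j).\<close>
    define z where "z = (2::nat) ^ (j div 16)"
    have z1: "z \<ge> 1" by (simp add: z_def)
    have "j \<le> 32 * (j div 16)" using False by presburger
    hence "real j \<le> real (32 * (j div 16))" by (rule of_nat_mono)
    hence q: "j div 16 \<ge> 1" "real j \<le> 32 * real (j div 16)" using False by auto
    have zj: "z < 2 ^ j" unfolding z_def using False by (intro power_strict_increasing) auto
    define G where "G = sieve_G n z"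
    have "real (card B) * G\<^sup>2 \<le> real L * G + real z ^ 4"
      unfolding G_def
    proof (rule selberg_sieve[OF BL])
      fix k p assume k: "k \<in> B" and p: "prime p" "p \<le> z"
      show "\<not> p dvd 1 + k * n"
      proof
        assume "p dvd 1 + k * n"
        hence "p = 1 + k * n" using k p(1) by (intro primes_dvd_imp_eq) (auto simp: B_def)
        thus False using k p(2) zj by (simp add: B_def)
      qed
    qed
    moreover have G1: "G \<ge> 1" unfolding G_def by (rule sieve_G_ge_1[OF z1])
    ultimately have "real (card B) \<le> (real L * G + real z ^ 4) / G\<^sup>2"
      by (simp add: le_divide_eq)
    also have "\<dots> = real L / G + real z ^ 4 / G\<^sup>2"
      using G1 by (simp add: add_divide_distrib power2_eq_square)
    also have "real z ^ 4 / G\<^sup>2 \<le> real z ^ 4 / 1"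
      using G1 by (intro divide_left_mono) (auto simp: one_le_power)
    finally have cB: "real (card B) \<le> real L / G + real z ^ 4" by simp
    have "ln (real z) = real (j div 16) * ln 2" by (simp add: z_def ln_realpow)
    also have "\<dots> \<ge> real (j div 16) * (2 / 3)" using ln2_ge_two_thirds by (intro mult_left_mono) auto
    finally have lnz: "ln (real z) \<ge> real j / 48" using q by simp
    have tpos: "real (totient n) > 0" using n by simp
    have "real (totient n) / real n * (real j / 48) \<le> real (totient n) / real n * ln (real z)"
      using lnz by (intro mult_left_mono) auto
    also have "\<dots> \<le> G" unfolding G_def by (rule sieve_G_lower[OF n z1])
    finally have Gl: "real (totient n) * real j / (48 * real n) \<le> G" by (simp add: mult_ac)
    have gpos: "0 < real (totient n) * real j / (48 * real n)" using tpos j n by simp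
    have "real (totient n) * (real L / G) \<le> real (totient n) * ((4 * 2 ^ j / real n) / (real (totient n) * real j / (48 * real n)))"
      using Gl gpos L by (intro mult_left_mono frac_le) auto
    also have "\<dots> = 192 * 2 ^ j / real j" using tpos j n by (simp add: field_simps)
    finally have t1: "real (totient n) * (real L / G) \<le> 192 * 2 ^ j / real j" .
    define m where "m = (j + 1) div 4 + 1"
    have "n \<le> 2 ^ m"
    proof (rule ccontr)
      assume "\<not> n \<le> 2 ^ m"
      hence "((2::nat) ^ m) ^ 4 < n ^ 4" by (intro power_strict_mono) auto
      moreover have "(2::nat) ^ (j + 1) \<le> (2 ^ m) ^ 4"
        unfolding power_mult[symmetric] by (intro power_increasing) (auto simp: m_def)
      ultimately show False using nj by linarith
    qed
    moreover have "j \<le> 2 * 2 ^ (j div 2)"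
    proof -
      have "j div 2 < 2 ^ (j div 2)" by (rule less_exp)
      thus ?thesis by linarith
    qed
    ultimately have "n * z ^ 4 * j \<le> 2 ^ m * (2 ^ (j div 16)) ^ 4 * (2 * 2 ^ (j div 2))"
      unfolding z_def by (intro mult_le_mono order_refl)
    also have "\<dots> = 2 ^ (m + 4 * (j div 16) + 1 + j div 2)"
      by (simp add: power_add mult_ac flip: power_mult)
    also have "\<dots> \<le> 2 ^ (j + 2)"
      by (intro power_increasing) (auto simp: m_def)
    finally have "real (n * z ^ 4 * j) \<le> real (2 ^ (j + 2))" by (simp only: of_nat_le_iff)
    hence "real n * real z ^ 4 * real j \<le> 4 * 2 ^ j" by simp
    hence "real n * real z ^ 4 \<le> 4 * 2 ^ j / real j" using j by (simp add: le_divide_eq)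
    moreover have "real (totient n) * real z ^ 4 \<le> real n * real z ^ 4" using tn by (intro mult_right_mono) auto
    ultimately have t2: "real (totient n) * real z ^ 4 \<le> 4 * 2 ^ j / real j" by linarith
    have "real (totient n) * real (card A) \<le> real (totient n) * (real L / G + real z ^ 4)"
      using AB cB by (intro mult_left_mono) auto
    also have "\<dots> \<le> 192 * 2 ^ j / real j + 4 * 2 ^ j / real j" using t1 t2 by (simp add: distrib_left)
    also have "\<dots> \<le> 400 * 2 ^ j / real j" using j by (simp add: field_simps)
    finally show ?thesis .
  qed
qed

lemma harm_le_ln: "k \<ge> 1 \<Longrightarrow> harm k \<le> 1 + ln (real k)"
  using euler_mascheroni_sequence_decreasing[of 1 k] by (simp add: harm_def)

text \<open>Block j of a dyadic decomposition contributes at most 400 / j, and summing over j up to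
  log_2 x gives a harmonic sum of size ln ln x.\<close>

lemma sum_ap_primes:
  assumes n: "n \<ge> 1" and x: "x \<ge> 3" and fin: "finite T"
    and T: "\<And>p. p \<in> T \<Longrightarrow> prime p \<and> n dvd p - 1 \<and> n ^ 4 < p \<and> real p \<le> x"
  shows "(\<Sum>p\<in>T. real (totient n) / real p) \<le> 400 * (2 + ln (ln x))"
proof -
  define J where "J = nat \<lfloor>log 2 x\<rfloor>"
  have "\<forall>p\<in>T. \<exists>j. 2 ^ j \<le> p \<and> p < 2 ^ (j + 1)"
    using ex_power_ivl1[of 2] T prime_ge_1_nat by simp
  then obtain \<iota> where \<iota>: "\<And>p. p \<in> T \<Longrightarrow> 2 ^ \<iota> p \<le> p \<and> p < 2 ^ (\<iota> p + 1)" by metis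
  have \<iota>J: "\<iota> p \<in> {1..J}" if p: "p \<in> T" for p
  proof -
    have "\<iota> p \<noteq> 0" using \<iota>[OF p] T[OF p] prime_ge_2_nat[of p] by (intro notI) simp
    moreover have "2 ^ \<iota> p \<le> x" using \<iota>[OF p] T[OF p] by (metis le_trans of_nat_le_iff of_nat_numeral of_nat_power order.trans)
    hence "real (\<iota> p) \<le> log 2 x" by (simp add: le_log_iff powr_realpow x order.strict_trans2[of 0 3 x])
    hence "\<iota> p \<le> J" unfolding J_def by (simp add: le_nat_floor)
    ultimately show ?thesis by simp
  qed
  have "(\<Sum>p\<in>T. real (totient n) / real p) = (\<Sum>j\<in>{1..J}. \<Sum>p\<in>{p\<in>T. \<iota> p = j}. real (totient n) / real p)"
    by (rule sum.group[symmetric]) (use fin \<iota>J in auto)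
  also have "\<dots> \<le> (\<Sum>j\<in>{1..J}. 400 / real j)"
  proof (rule sum_mono)
    fix j assume j: "j \<in> {1..J}"
    define A where "A = {p. prime p \<and> n dvd p - 1 \<and> 2 ^ j \<le> p \<and> p < 2 ^ (j + 1)}"
    show "(\<Sum>p\<in>{p\<in>T. \<iota> p = j}. real (totient n) / real p) \<le> 400 / real j"
    \<comment> \<open>The count is available when n^4 <= 2^(j + 1), which any member of the block
      guarantees; empty blocks are therefore treated apart.\<close>
    proof (cases "{p\<in>T. \<iota> p = j} = {}")
      case True
      thus ?thesis by (simp only: True sum.empty) simp
    next
      case False
      then obtain p where p: "p \<in> T" "\<iota> p = j" by blast
      have "p < 2 ^ (j + 1)" "n ^ 4 < p" using \<iota>[OF p(1)] T[OF p(1)] p(2) by auto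
      hence "n ^ 4 \<le> 2 ^ (j + 1)" by linarith
      hence cA: "real (totient n) * real (card A) \<le> 400 * 2 ^ j / real j"
        unfolding A_def using j n by (intro ap_prime_count) auto
      have finA: "finite A" by (rule finite_subset[of _ "{..<2 ^ (j + 1)}"]) (auto simp: A_def)
      have sub: "{p\<in>T. \<iota> p = j} \<subseteq> A" using \<iota> T by (auto simp: A_def)
      have "(\<Sum>p\<in>{p\<in>T. \<iota> p = j}. real (totient n) / real p) \<le> (\<Sum>p\<in>{p\<in>T. \<iota> p = j}. real (totient n) / 2 ^ j)"
      proof (intro sum_mono divide_left_mono)
        fix p assume "p \<in> {p\<in>T. \<iota> p = j}"
        hence "2 ^ j \<le> p" using \<iota> by auto
        thus le: "2 ^ j \<le> real p" by (metis of_nat_le_iff of_nat_numeral of_nat_power)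
        have "(0::real) < 2 ^ j" by simp
        with le have "0 < real p" by linarith
        thus "0 < real p * 2 ^ j" by simp
      qed auto
      also have "\<dots> = real (totient n) * real (card {p\<in>T. \<iota> p = j}) / 2 ^ j" by simp
      also have "\<dots> \<le> real (totient n) * real (card A) / 2 ^ j"
        using card_mono[OF finA sub] by (intro divide_right_mono mult_left_mono) auto
      also have "\<dots> \<le> (400 * 2 ^ j / real j) / 2 ^ j" using cA by (intro divide_right_mono) auto
      finally show ?thesis by simp
    qed
  qed
  also have "\<dots> = 400 * harm J" by (simp add: harm_def sum_distrib_left inverse_eq_divide)
  also have "harm J \<le> 2 + ln (ln x)"
  proof -
    have lx: "ln x \<ge> 1" using x by (metis exp_le order.trans ln_ge_iff less_le_trans zero_less_numeral)
    have lg: "log 2 x \<le> 2 * ln x"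
    proof -
      have "ln x * 1 \<le> ln x * (2 * ln 2)" using ln2_ge_two_thirds lx by (intro mult_left_mono) auto
      thus ?thesis by (simp add: log_def divide_le_eq mult_ac)
    qed
    have "log 2 x \<ge> 1" using x by (simp add: le_log_iff)
    hence J1: "J \<ge> 1" "real J \<le> log 2 x" unfolding J_def by linarith+
    have "harm J \<le> 1 + ln (real J)" by (rule harm_le_ln[OF J1(1)])
    also have "ln (real J) \<le> ln (2 * ln x)" using J1 lg by (intro ln_mono) auto
    also have "\<dots> = ln 2 + ln (ln x)" using lx by (simp add: ln_mult)
    finally show ?thesis using ln_2_less_1 by simp
  qed
  finally show ?thesis by simp
qed

lemma sum_inverse_squares_le:
  assumes "finite F" "\<And>p. p \<in> F \<Longrightarrow> p > N" "N \<ge> (1::nat)"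
  shows "(\<Sum>p\<in>F. 1 / (real p)\<^sup>2) \<le> 1 / real N"
proof -
  define M where "M = Max (insert N F)"
  have MN: "M \<ge> N" "F \<subseteq> {N<..M}" using assms by (auto simp: M_def)
  have "(\<Sum>p\<in>F. 1 / (real p)\<^sup>2) \<le> (\<Sum>p\<in>{N<..M}. 1 / (real p)\<^sup>2)"
    using MN by (intro sum_mono2) auto
  also have "\<dots> \<le> 1 / real N - 1 / real M"
    using MN(1)
  proof (induction M rule: dec_induct)
    case (step m)
    have "{N<..Suc m} = insert (Suc m) {N<..m}" using step by auto
    hence "(\<Sum>p\<in>{N<..Suc m}. 1 / (real p)\<^sup>2) = 1 / (real (Suc m))\<^sup>2 + (\<Sum>p\<in>{N<..m}. 1 / (real p)\<^sup>2)" by simp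
    also have "\<dots> \<le> 1 / (real (Suc m))\<^sup>2 + (1 / real N - 1 / real m)" using step by simp
    also have "1 / (real (Suc m))\<^sup>2 \<le> 1 / real m - 1 / real (Suc m)"
    proof -
      have "m > 0" using step assms(3) by simp
      hence "1 / real m - 1 / real (Suc m) = 1 / (real m * real (Suc m))" by (simp add: divide_simps)
      moreover have "1 / (real (Suc m))\<^sup>2 \<le> 1 / (real m * real (Suc m))"
        unfolding power2_eq_square using \<open>m > 0\<close> by (intro divide_left_mono mult_right_mono) auto
      ultimately show ?thesis by simp
    qed
    finally show ?case by simp
  qed simp
  also have "\<dots> \<le> 1 / real N" by simp
  finally show ?thesis .
qed

lemma sum_prime_powers_cong_1:
  assumes n: "n \<ge> 1" and x: "x \<ge> 3" and fin: "finite T"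
    and T: "\<And>p. p \<in> T \<Longrightarrow> prime p \<and> f p \<ge> 1 \<and> q p = p ^ f p \<and> n dvd q p - 1 \<and> real (q p) \<le> x"
  shows "(\<Sum>p\<in>T. real (totient n) / real (q p)) \<le> 3 + 3 * ln (real n) + 400 * (2 + ln (ln x))"
proof -
  define T1 where "T1 = {p\<in>T. q p \<le> n ^ 4}"
  \<comment> \<open>Proper powers beyond n^4 are split at p = n^2: below it there are at most n^2 of
    them with terms at most 1 / n^2, beyond it the terms are at most n / p^2 and the tail of the
    inverse squares is at most 1 / n^2.\<close>
  define T2 where "T2 = {p\<in>T. q p > n ^ 4 \<and> f p \<ge> 2 \<and> p \<le> n\<^sup>2}"
  define T3 where "T3 = {p\<in>T. q p > n ^ 4 \<and> f p \<ge> 2 \<and> p > n\<^sup>2}"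
  define T4 where "T4 = {p\<in>T. q p > n ^ 4 \<and> f p = 1}"
  have split: "T = T1 \<union> (T2 \<union> (T3 \<union> T4))"
    using T by (force simp: T1_def T2_def T3_def T4_def)
  have fins: "finite T1" "finite T2" "finite T3" "finite T4"
    using fin by (auto simp: T1_def T2_def T3_def T4_def)
  have dis: "T1 \<inter> (T2 \<union> (T3 \<union> T4)) = {}" "T2 \<inter> (T3 \<union> T4) = {}" "T3 \<inter> T4 = {}"
    by (auto simp: T1_def T2_def T3_def T4_def)
  let ?g = "\<lambda>p. real (totient n) / real (q p)"
  have eq: "sum ?g T = sum ?g T1 + (sum ?g T2 + (sum ?g T3 + sum ?g T4))"
    unfolding split using fins dis by (simp only: sum.union_disjoint finite_Un simp_thms)
  have tn: "real (totient n) \<le> real n" using totient_le[of n] by simp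
  have q2: "q p \<ge> 2" if "p \<in> T" for p
  proof -
    have "p \<ge> 2" "f p \<ge> 1" "q p = p ^ f p" using T[OF that] prime_ge_2_nat by auto
    thus ?thesis using self_le_power[of p "f p"] by simp
  qed
  have s1: "sum ?g T1 \<le> 1 + 3 * ln (real n)"
  proof -
    \<comment> \<open>The index of \<open>q p\<close> in the progression. It determines
      \<open>q p\<close> and hence the prime \<open>p\<close>, and phi(n) / q <= 1 /
      \<kappa>.\<close>
    define \<kappa> where "\<kappa> p = (q p - 1) div n" for p
    have \<kappa>: "q p = 1 + n * \<kappa> p" "\<kappa> p \<in> {1..n ^ 3}" if p: "p \<in> T1" for p
    proof -
      have pT: "p \<in> T" "q p \<le> n ^ 4" using p by (auto simp: T1_def)
      have "n dvd q p - 1" using T[OF pT(1)] by blast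
      hence "n * \<kappa> p = q p - 1" unfolding \<kappa>_def by (rule dvd_mult_div_cancel)
      thus eq: "q p = 1 + n * \<kappa> p" using q2[OF pT(1)] by simp
      have "\<kappa> p \<noteq> 0" using eq q2[OF pT(1)] by (intro notI) simp
      moreover have "n * \<kappa> p \<le> n * n ^ 3" using eq pT(2) by (simp flip: power_Suc)
      hence "\<kappa> p \<le> n ^ 3" using n by simp
      ultimately show "\<kappa> p \<in> {1..n ^ 3}" by simp
    qed
    have inj: "inj_on \<kappa> T1"
    proof (rule inj_onI)
      fix p p' assume p: "p \<in> T1" "p' \<in> T1" "\<kappa> p = \<kappa> p'"
      hence "q p = q p'" using \<kappa>(1) by metis
      moreover have "p \<in> T" "p' \<in> T" using p by (auto simp: T1_def)
      ultimately have "p ^ f p = p' ^ f p'" "prime p" "prime p'" "f p \<ge> 1" using T by auto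
      hence "p dvd p' ^ f p'" by (metis One_nat_def Suc_le_eq dvd_power)
      hence "p dvd p'" using \<open>prime p\<close> prime_dvd_power by blast
      thus "p = p'" using \<open>prime p\<close> \<open>prime p'\<close> by (intro primes_dvd_imp_eq)
    qed
    have "sum ?g T1 \<le> (\<Sum>p\<in>T1. 1 / real (\<kappa> p))"
    proof (rule sum_mono)
      fix p assume p: "p \<in> T1"
      have "real (totient n) / real (q p) \<le> real n / (real n * real (\<kappa> p))"
        using \<kappa>[OF p] n tn by (intro frac_le) auto
      thus "real (totient n) / real (q p) \<le> 1 / real (\<kappa> p)" using n by simp
    qed
    also have "\<dots> = (\<Sum>k\<in>\<kappa> ` T1. 1 / real k)" by (simp add: sum.reindex[OF inj])
    also have "\<dots> \<le> (\<Sum>k\<in>{1..n ^ 3}. 1 / real k)" using \<kappa>(2) by (intro sum_mono2) auto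
    also have "\<dots> = harm (n ^ 3)" by (simp add: harm_def inverse_eq_divide)
    also have "\<dots> \<le> 1 + ln (real (n ^ 3))" using n by (intro harm_le_ln) simp
    also have "ln (real (n ^ 3)) = 3 * ln (real n)" using n by (simp add: ln_realpow)
    finally show ?thesis .
  qed
  have s2: "sum ?g T2 \<le> 1"
  proof -
    have "sum ?g T2 \<le> (\<Sum>p\<in>T2. 1 / (real n)\<^sup>2)"
    proof (rule sum_mono)
      fix p assume "p \<in> T2"
      hence "n ^ 4 \<le> q p" by (simp add: T2_def)
      hence "real n ^ 4 \<le> real (q p)" by (metis of_nat_le_iff of_nat_power)
      hence "real (totient n) / real (q p) \<le> real n / real n ^ 4"
        using tn n by (intro frac_le) auto
      also have "\<dots> \<le> 1 / (real n)\<^sup>2" using n by (simp add: field_simps power4_eq_xxxx power2_eq_square)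
      finally show "real (totient n) / real (q p) \<le> 1 / (real n)\<^sup>2" .
    qed
    also have "\<dots> = real (card T2) / (real n)\<^sup>2" by simp
    also have "card T2 \<le> card {1..n\<^sup>2}"
      using T prime_ge_1_nat by (intro card_mono) (auto simp: T2_def)
    hence "real (card T2) / (real n)\<^sup>2 \<le> (real n)\<^sup>2 / (real n)\<^sup>2"
      by (intro divide_right_mono) (simp_all flip: of_nat_power)
    also have "\<dots> = 1" using n by simp
    finally show ?thesis .
  qed
  have s3: "sum ?g T3 \<le> 1"
  proof -
    have "sum ?g T3 \<le> (\<Sum>p\<in>T3. real n * (1 / (real p)\<^sup>2))"
    proof (rule sum_mono)
      fix p assume p: "p \<in> T3"
      hence p': "p \<ge> 1" "f p \<ge> 2" "q p = p ^ f p" using T prime_ge_1_nat by (auto simp: T3_def)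
      hence "p\<^sup>2 \<le> q p" by (simp add: power_increasing)
      hence "(real p)\<^sup>2 \<le> real (q p)" by (metis of_nat_le_iff of_nat_power)
      hence "real (totient n) / real (q p) \<le> real n / (real p)\<^sup>2"
        using tn p' by (intro frac_le) auto
      thus "real (totient n) / real (q p) \<le> real n * (1 / (real p)\<^sup>2)" by simp
    qed
    also have "\<dots> = real n * (\<Sum>p\<in>T3. 1 / (real p)\<^sup>2)" by (simp add: sum_distrib_left)
    also have "\<dots> \<le> real n * (1 / real (n\<^sup>2))"
      using n by (intro mult_left_mono sum_inverse_squares_le fins) (auto simp: T3_def)
    also have "\<dots> \<le> 1" using n by (simp add: field_simps power2_eq_square)
    finally show ?thesis .
  qed
  have "sum ?g T4 = (\<Sum>p\<in>T4. real (totient n) / real p)"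
    by (rule sum.cong) (use T in \<open>auto simp: T4_def\<close>)
  also have "\<dots> \<le> 400 * (2 + ln (ln x))"
  proof (rule sum_ap_primes[OF n x fins(4)])
    fix p assume p: "p \<in> T4"
    hence pT: "p \<in> T" "f p = 1" "q p > n ^ 4" by (auto simp: T4_def)
    have "q p = p" using T[OF pT(1)] pT(2) by simp
    thus "prime p \<and> n dvd p - 1 \<and> n ^ 4 < p \<and> real p \<le> x" using T[OF pT(1)] pT(3) by metis
  qed
  finally show ?thesis using s1 s2 s3 eq by linarith
qed

section \<open>The sum of the inverse norms of the prime ideals\<close>

lemma card_prime_factors_le:
  assumes "n \<ge> 1"
  shows "real (card (prime_factors n)) \<le> 2 * ln (real n)"
proof -
  have "2 ^ card (prime_factors n) = (\<Prod>p\<in>prime_factors n. 2)" by simp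
  also have "\<dots> \<le> (\<Prod>p\<in>prime_factors n. p ^ multiplicity p n)"
  proof (rule prod_mono)
    fix p assume p: "p \<in> prime_factors n"
    hence "prime p" "multiplicity p n > 0" by (auto simp: prime_factors_multiplicity)
    thus "0 \<le> (2::nat) \<and> 2 \<le> p ^ multiplicity p n"
      using prime_ge_2_nat[of p] self_le_power[of p "multiplicity p n"] by simp
  qed
  also have "\<dots> = n" using assms by (intro prime_factorization_nat[symmetric]) simp
  finally have "real (2 ^ card (prime_factors n)) \<le> real n" by (simp only: of_nat_le_iff)
  hence "ln (2 ^ card (prime_factors n)) \<le> ln (real n)" by (intro ln_mono) auto
  hence "real (card (prime_factors n)) * ln 2 \<le> ln (real n)" by (simp add: ln_realpow)
  moreover have "real (card (prime_factors n)) * (1 / 2) \<le> real (card (prime_factors n)) * ln 2"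
    using ln2_ge_two_thirds by (intro mult_left_mono) auto
  ultimately show ?thesis by linarith
qed

context cyclotomic
begin

text \<open>Prime ideals are grouped by a rational prime \<open>c P\<close> that they contain. Above
  p there are at most phi(m p) of them, of norm at least the minimum \<open>q p\<close>. If p
  divides n, then \<open>m p\<close> divides \<open>q p - 1\<close> and the group contributes at
  most 1; there are at most 2 ln n such p. Otherwise m p = n and the progression estimate adds
  another 3 ln n.\<close>

lemma sum_inverse_nrm:
  assumes x: "x \<ge> 3" and Q: "Q = {P. is_prime P \<and> real (nrm P) \<le> x}"
  shows "(\<Sum>P\<in>Q. 1 / real (nrm P)) \<le> 5 * ln (real n) + 3 + 400 * (2 + ln (ln x))"
proof -
  have finQ: "finite Q" unfolding Q by (rule finite_primes_le)
  define c where "c P = (SOME p::nat. prime p \<and> of_nat p \<in> P)" for P :: "complex set"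
  have c: "prime (c P)" "of_nat (c P) \<in> P" if "P \<in> Q" for P
    using someI_ex[OF prime_in_prime, of P] that by (auto simp: c_def Q)
  define T where "T = c ` Q"
  define S where "S p = {P\<in>Q. c P = p}" for p
  define q where "q p = Min (nrm ` S p)" for p
  define m where "m p = n div p ^ multiplicity p n" for p
  have finS: "finite (S p)" for p using finQ by (simp add: S_def)
  have qS: "\<exists>P\<in>S p. q p = nrm P" if p: "p \<in> T" for p
  proof -
    have "nrm ` S p \<noteq> {}" using p by (auto simp: S_def T_def)
    hence "q p \<in> nrm ` S p" unfolding q_def using finS by (intro Min_in) auto
    thus ?thesis by blast
  qed
  have q: "prime p" "q p \<ge> 2" "m p dvd q p - 1" "\<exists>k>0. q p = p ^ k" "real (q p) \<le> x" if p: "p \<in> T" for p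
  proof -
    obtain P where P: "P \<in> Q" "c P = p" "q p = nrm P" using qS[OF p] by (auto simp: S_def)
    have pP: "is_prime P" "prime p" "of_nat p \<in> P" using c[OF P(1)] P by (auto simp: Q)
    show "prime p" by (rule pP)
    show "q p \<ge> 2" using nrm_prime_ge_2[OF pP(1)] P by simp
    show "m p dvd q p - 1" using primes_above(2)[OF pP(2,1,3)] P by (simp add: m_def)
    show "\<exists>k>0. q p = p ^ k" using nrm_char[OF pP] P by simp
    show "real (q p) \<le> x" using P by (simp add: Q)
  qed
  have inner: "(\<Sum>P\<in>S p. 1 / real (nrm P)) \<le> real (totient (m p)) / real (q p)" if p: "p \<in> T" for p
  proof -
    have "(\<Sum>P\<in>S p. 1 / real (nrm P)) \<le> (\<Sum>P\<in>S p. 1 / real (q p))"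
    proof (rule sum_mono)
      fix P assume "P \<in> S p"
      hence "q p \<le> nrm P" unfolding q_def using finS by (intro Min_le) auto
      thus "1 / real (nrm P) \<le> 1 / real (q p)" using q(2)[OF p] by (intro divide_left_mono) auto
    qed
    also have "\<dots> = real (card (S p)) / real (q p)" by simp
    also have "\<dots> \<le> real (totient (m p)) / real (q p)"
    proof (intro divide_right_mono)
      have "S p \<subseteq> {P. is_prime P \<and> of_nat p \<in> P}" using c by (auto simp: S_def Q)
      hence "card (S p) \<le> card {P. is_prime P \<and> of_nat p \<in> P}"
        using primes_above(1)[OF q(1)[OF p]] by (intro card_mono) auto
      also have "\<dots> \<le> totient (m p)" using primes_above(1)[OF q(1)[OF p]] by (simp add: m_def)
      finally show "real (card (S p)) \<le> real (totient (m p))" by simp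
    qed simp
    finally show ?thesis .
  qed
  define Ta where "Ta = {p\<in>T. p dvd n}"
  define Tb where "Tb = {p\<in>T. \<not> p dvd n}"
  have finT: "finite T" unfolding T_def using finQ by simp
  have "(\<Sum>P\<in>Q. 1 / real (nrm P)) = (\<Sum>p\<in>T. \<Sum>P\<in>S p. 1 / real (nrm P))"
    unfolding S_def by (rule sum.group[symmetric]) (use finQ finT in \<open>auto simp: T_def\<close>)
  also have "\<dots> \<le> (\<Sum>p\<in>T. real (totient (m p)) / real (q p))" by (intro sum_mono inner)
  also have "T = Ta \<union> Tb" by (auto simp: Ta_def Tb_def)
  also have "(\<Sum>p\<in>Ta \<union> Tb. real (totient (m p)) / real (q p)) =
      (\<Sum>p\<in>Ta. real (totient (m p)) / real (q p)) + (\<Sum>p\<in>Tb. real (totient (m p)) / real (q p))"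
    using finT by (intro sum.union_disjoint) (auto simp: Ta_def Tb_def)
  also have "(\<Sum>p\<in>Ta. real (totient (m p)) / real (q p)) \<le> (\<Sum>p\<in>Ta. 1)"
  proof (rule sum_mono)
    fix p assume "p \<in> Ta"
    hence p: "p \<in> T" by (simp add: Ta_def)
    have "m p \<le> q p - 1" using q(2,3)[OF p] by (intro dvd_imp_le) auto
    hence "totient (m p) \<le> q p" using totient_le[of "m p"] by linarith
    thus "real (totient (m p)) / real (q p) \<le> 1" using q(2)[OF p] by (simp add: divide_le_eq)
  qed
  also have "(\<Sum>p\<in>Ta. 1) \<le> 2 * ln (real n)"
  proof -
    have "Ta \<subseteq> prime_factors n" using q(1) n1 by (auto simp: Ta_def in_prime_factors_iff)
    hence "card Ta \<le> card (prime_factors n)" by (intro card_mono) auto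
    thus ?thesis using card_prime_factors_le[OF n1] by simp
  qed
  also have "(\<Sum>p\<in>Tb. real (totient (m p)) / real (q p)) = (\<Sum>p\<in>Tb. real (totient n) / real (q p))"
    by (rule sum.cong) (simp_all add: Tb_def m_def not_dvd_imp_multiplicity_0)
  also have "\<dots> \<le> 3 + 3 * ln (real n) + 400 * (2 + ln (ln x))"
  proof -
    have "\<forall>p\<in>Tb. \<exists>k>0. q p = p ^ k" using q(4) by (simp add: Tb_def)
    then obtain f where f: "\<And>p. p \<in> Tb \<Longrightarrow> f p > 0 \<and> q p = p ^ f p" by metis
    show ?thesis
    proof (rule sum_prime_powers_cong_1[OF n1 x, of Tb f q])
      show "finite Tb" using finT by (simp add: Tb_def)
      fix p assume p: "p \<in> Tb"
      hence pT: "p \<in> T" "\<not> p dvd n" by (auto simp: Tb_def)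
      hence "m p = n" by (simp add: m_def not_dvd_imp_multiplicity_0)
      hence "n dvd q p - 1" using q(3)[OF pT(1)] by simp
      moreover have "f p \<ge> 1" "q p = p ^ f p" using f[OF p] by auto
      ultimately show "prime p \<and> f p \<ge> 1 \<and> q p = p ^ f p \<and> n dvd q p - 1 \<and> real (q p) \<le> x"
        using q(1,5)[OF pT(1)] by blast
    qed
  qed
  finally show ?thesis by simp
qed

end

section \<open>Random sums over smooth elements\<close>

text \<open>The weights \<open>s p / N p\<close> play the role of \<open>f(\<pp>) / N(\<pp>)\<close>, and \<open>K\<close> truncates the exponents.\<close>

definition smooth_sum :: "nat \<Rightarrow> ('a \<Rightarrow> real) \<Rightarrow> 'a set \<Rightarrow> real \<Rightarrow> ('a \<Rightarrow> real) \<Rightarrow> real" where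
  "smooth_sum K N P t s =
     (\<Sum>e\<in>P \<rightarrow>\<^sub>E {..K}. if (\<Prod>p\<in>P. N p ^ e p) \<le> t then \<Prod>p\<in>P. (s p / N p) ^ e p else 0)"

text \<open>The truncated Euler product with all signs positive; it dominates
  \<open>smooth_sum\<close> for every threshold and every choice of signs.\<close>

definition euler_bound :: "nat \<Rightarrow> ('a \<Rightarrow> real) \<Rightarrow> 'a set \<Rightarrow> real" where
  "euler_bound K N P = (\<Prod>p\<in>P. \<Sum>i\<le>K. (1 / N p) ^ i)"

lemma smooth_sum_cong:
  assumes "\<And>p. p \<in> P \<Longrightarrow> s p = s' p"
  shows "smooth_sum K N P t s = smooth_sum K N P t s'"
  unfolding smooth_sum_def by (intro sum.cong if_cong prod.cong refl) (simp add: assms)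

lemma smooth_sum_insert:
  assumes P: "finite P" "q \<notin> P" and N: "N q > 0"
  shows "smooth_sum K N (insert q P) t s = (\<Sum>i\<le>K. (s q / N q) ^ i * smooth_sum K N P (t / N q ^ i) s)"
proof -
  have inj: "inj_on (\<lambda>(y, g). g(q := y)) ({..K} \<times> (P \<rightarrow>\<^sub>E {..K}))"
    using P(2) by (rule inj_combinator)
  have prod_upd: "(\<Prod>p\<in>insert q P. h p ((g(q := i)) p)) = h q i * (\<Prod>p\<in>P. h p (g p))"
    for h :: "'a \<Rightarrow> nat \<Rightarrow> real" and g i
  proof -
    have "(\<Prod>p\<in>P. h p ((g(q := i)) p)) = (\<Prod>p\<in>P. h p (g p))"
      using P(2) by (intro prod.cong) auto
    thus ?thesis using P by simp
  qed
  have "smooth_sum K N (insert q P) t s =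
    (\<Sum>(i, g)\<in>{..K} \<times> (P \<rightarrow>\<^sub>E {..K}).
       if N q ^ i * (\<Prod>p\<in>P. N p ^ g p) \<le> t then (s q / N q) ^ i * (\<Prod>p\<in>P. (s p / N p) ^ g p) else 0)"
    unfolding smooth_sum_def PiE_insert_eq sum.reindex[OF inj]
    by (intro sum.cong refl)
      (simp only: o_def case_prod_unfold prod_upd[of "\<lambda>p i. N p ^ i"] prod_upd[of "\<lambda>p i. (s p / N p) ^ i"])
  also have "\<dots> = (\<Sum>i\<le>K. \<Sum>g\<in>P \<rightarrow>\<^sub>E {..K}.
       if N q ^ i * (\<Prod>p\<in>P. N p ^ g p) \<le> t then (s q / N q) ^ i * (\<Prod>p\<in>P. (s p / N p) ^ g p) else 0)"
    by (rule sum.cartesian_product[symmetric])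
  also have "\<dots> = (\<Sum>i\<le>K. (s q / N q) ^ i * smooth_sum K N P (t / N q ^ i) s)"
    unfolding smooth_sum_def sum_distrib_left
    using N by (intro sum.cong refl) (simp add: le_divide_eq mult.commute)
  finally show ?thesis .
qed

lemma abs_smooth_sum_le:
  assumes P: "finite P" "\<And>p. p \<in> P \<Longrightarrow> N p > 0" "\<And>p. p \<in> P \<Longrightarrow> \<bar>s p\<bar> = 1"
  shows "\<bar>smooth_sum K N P t s\<bar> \<le> euler_bound K N P"
proof -
  have "\<bar>smooth_sum K N P t s\<bar> \<le> (\<Sum>e\<in>P \<rightarrow>\<^sub>E {..K}. \<Prod>p\<in>P. (1 / N p) ^ e p)"
    unfolding smooth_sum_def
  proof (rule order.trans[OF sum_abs sum_mono])
    fix e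
    have "(\<Prod>p\<in>P. \<bar>(s p / N p) ^ e p\<bar>) = (\<Prod>p\<in>P. (1 / N p) ^ e p)"
    proof (rule prod.cong[OF refl])
      fix p assume p: "p \<in> P"
      show "\<bar>(s p / N p) ^ e p\<bar> = (1 / N p) ^ e p"
        using P(2)[OF p] P(3)[OF p] by (simp add: power_abs abs_mult)
    qed
    moreover have "0 \<le> (\<Prod>p\<in>P. (1 / N p) ^ e p)" using P(2) by (intro prod_nonneg zero_le_power) (simp add: less_imp_le)
    ultimately show "\<bar>if (\<Prod>p\<in>P. N p ^ e p) \<le> t then \<Prod>p\<in>P. (s p / N p) ^ e p else 0\<bar> \<le> (\<Prod>p\<in>P. (1 / N p) ^ e p)"
      by (simp add: abs_prod)
  qed
  also have "\<dots> = euler_bound K N P" unfolding euler_bound_def using P(1) by (simp add: prod_sum_PiE)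
  finally show ?thesis .
qed

lemma exp_minus_2_le: "0 \<le> v \<Longrightarrow> v \<le> 1 / 2 \<Longrightarrow> exp (- (2 * v)) \<le> 1 - (v::real)"
proof -
  assume v: "0 \<le> v" "v \<le> 1 / 2"
  have "v\<^sup>2 \<le> v * (1 / 2)" unfolding power2_eq_square using v by (intro mult_left_mono) auto
  hence "- (2 * v) \<le> ln (1 - v)" using ln_one_minus_pos_lower_bound[OF v] by linarith
  hence "exp (- (2 * v)) \<le> exp (ln (1 - v))" by simp
  thus ?thesis using v by simp
qed

lemma geometric_le: "0 \<le> v \<Longrightarrow> v < 1 \<Longrightarrow> (\<Sum>i\<le>K. v ^ i) \<le> 1 / (1 - (v::real))"
proof -
  assume v: "0 \<le> v" "v < 1"
  have "(1 - v) * (\<Sum>i\<le>K. v ^ i) = 1 - v ^ Suc K" by (rule sum_gp_basic)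
  hence "(1 - v) * (\<Sum>i\<le>K. v ^ i) \<le> 1" using v by simp
  thus ?thesis using v by (simp add: le_divide_eq mult.commute)
qed

lemma euler_bound_le_exp:
  assumes P: "\<And>p. p \<in> P \<Longrightarrow> N p \<ge> 2"
  shows "euler_bound K N P \<le> exp (2 * (\<Sum>p\<in>P. 1 / N p))"
proof (cases "finite P")
  case True
  have "euler_bound K N P \<le> (\<Prod>p\<in>P. exp (2 * (1 / N p)))"
    unfolding euler_bound_def
  proof (rule prod_mono)
    fix p assume "p \<in> P"
    hence "N p \<ge> 2" by (rule P)
    hence v: "0 \<le> 1 / N p" "1 / N p \<le> 1 / 2" by (auto simp: field_simps)
    have "(\<Sum>i\<le>K. (1 / N p) ^ i) \<le> 1 / (1 - 1 / N p)" using v by (intro geometric_le) auto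
    also have "\<dots> \<le> 1 / exp (- (2 * (1 / N p)))"
      using exp_minus_2_le[OF v] v by (intro divide_left_mono) auto
    also have "\<dots> = exp (2 * (1 / N p))" by (simp add: exp_minus field_simps)
    finally show "0 \<le> (\<Sum>i\<le>K. (1 / N p) ^ i) \<and> (\<Sum>i\<le>K. (1 / N p) ^ i) \<le> exp (2 * (1 / N p))"
      using v by (auto intro!: sum_nonneg)
  qed
  also have "\<dots> = exp (2 * (\<Sum>p\<in>P. 1 / N p))" using True by (simp add: exp_sum sum_distrib_left)
  finally show ?thesis .
qed (simp add: euler_bound_def)

text \<open>Rankin's trick: on the discarded terms \<open>(\<Prod>p\<in>P. N p ^ e p) powr \<sigma>\<close> exceeds \<open>t powr \<sigma>\<close>,
  and \<open>N p powr \<sigma> \<le> 5 / 3\<close> for \<open>N p \<le> y\<close>.\<close>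

lemma smooth_sum_lower:
  assumes P: "finite P" "\<And>p. p \<in> P \<Longrightarrow> N p \<ge> 2" "\<And>p. p \<in> P \<Longrightarrow> N p \<le> y" "\<And>p. p \<in> P \<Longrightarrow> \<bar>s p\<bar> = 1"
    and K: "K \<ge> 1" and y: "y > 1" and t: "t > 0"
  shows "exp (- (2 * (\<Sum>p\<in>P. 1 / N p))) - exp (10 * (\<Sum>p\<in>P. 1 / N p) - ln t / (2 * ln y)) \<le> smooth_sum K N P t s"
proof -
  define E where "E = (\<Sum>p\<in>P. 1 / N p)"
  define \<sigma> where "\<sigma> = 1 / (2 * ln y)"
  have \<sigma>: "\<sigma> > 0" using y by (simp add: \<sigma>_def)
  define full where "full = (\<Sum>e\<in>P \<rightarrow>\<^sub>E {..K}. \<Prod>p\<in>P. (s p / N p) ^ e p)"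
  have "exp (- (2 * E)) = (\<Prod>p\<in>P. exp (- (2 * (1 / N p))))"
    using P(1) by (simp add: E_def exp_sum sum_distrib_left flip: sum_negf)
  also have "\<dots> \<le> (\<Prod>p\<in>P. \<Sum>i\<le>K. (s p / N p) ^ i)"
  proof (rule prod_mono, safe)
    fix p assume p: "p \<in> P"
    define w where "w = 1 / N p"
    have w: "0 < w" "w \<le> 1 / 2" using P(2)[OF p] by (auto simp: w_def field_simps)
    have "exp (- (2 * w)) \<le> 1 - w" using w by (intro exp_minus_2_le) auto
    also have "1 - w \<le> (\<Sum>i\<le>K. (s p / N p) ^ i)"
    proof (cases "s p = 1")
      case True
      have "(\<Sum>i\<in>{0}. w ^ i) \<le> (\<Sum>i\<le>K. w ^ i)" using w by (intro sum_mono2) auto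
      moreover have sw: "s p / N p = w" using True by (simp add: w_def)
      ultimately show ?thesis unfolding sw using w by simp
    next
      case False
      hence "s p = - 1" using P(4)[OF p] by (auto simp: abs_if split: if_splits)
      hence v: "s p / N p = - w" by (simp add: w_def)
      \<comment> \<open>For the sign -1 the factor is an alternating sum. As K >= 1, the power left
        over is at most w^2, so that 1 - w survives after cancelling 1 + w.\<close>
      have "(1 - (- w)) * (\<Sum>i\<le>K. (- w) ^ i) = 1 - (- w) ^ Suc K" by (rule sum_gp_basic)
      moreover have "(- w) ^ Suc K \<le> \<bar>(- w) ^ Suc K\<bar>" by simp
      moreover have "\<bar>(- w) ^ Suc K\<bar> = w ^ Suc K" using w by (simp add: power_abs abs_mult)
      moreover have "w ^ Suc K \<le> w ^ 2" using w K by (intro power_decreasing) auto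
      ultimately have "(1 - w) * (1 + w) \<le> (\<Sum>i\<le>K. (- w) ^ i) * (1 + w)"
        by (simp add: power2_eq_square algebra_simps)
      thus ?thesis unfolding v using w by simp
    qed
    finally show "exp (- (2 * (1 / N p))) \<le> (\<Sum>i\<le>K. (s p / N p) ^ i)" by (simp add: w_def)
  qed simp
  also have "\<dots> = full" unfolding full_def using P(1) by (simp add: prod_sum_PiE)
  finally have 1: "exp (- (2 * E)) \<le> full" .
  have "full - smooth_sum K N P t s \<le> (\<Sum>e\<in>P \<rightarrow>\<^sub>E {..K}. exp (- (\<sigma> * ln t)) * (\<Prod>p\<in>P. (N p powr \<sigma> / N p) ^ e p))"
    unfolding full_def smooth_sum_def sum_subtractf[symmetric]
  proof (rule sum_mono)
    fix e
    define n where "n = (\<Prod>p\<in>P. N p ^ e p)"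
    have n: "n > 0" unfolding n_def using P(2) by (intro prod_pos zero_less_power) (force intro: less_le_trans[of 0 2])
    have Np: "N p > 0" if "p \<in> P" for p using P(2)[OF that] by simp
    have "(\<Prod>p\<in>P. (N p powr \<sigma> / N p) ^ e p) = (\<Prod>p\<in>P. (N p ^ e p) powr \<sigma> / N p ^ e p)"
    proof (rule prod.cong[OF refl])
      fix p assume p: "p \<in> P"
      have "(N p powr \<sigma>) ^ e p = (N p ^ e p) powr \<sigma>"
        using Np[OF p] by (simp add: powr_power powr_powr mult.commute flip: powr_realpow)
      thus "(N p powr \<sigma> / N p) ^ e p = (N p ^ e p) powr \<sigma> / N p ^ e p" by (simp add: power_divide)
    qed
    also have "\<dots> = n powr \<sigma> / n"
      using Np by (simp add: n_def prod_dividef prod_powr_distrib less_imp_le)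
    finally have rank: "(\<Prod>p\<in>P. (N p powr \<sigma> / N p) ^ e p) = n powr \<sigma> / n" .
    have ab: "\<bar>\<Prod>p\<in>P. (s p / N p) ^ e p\<bar> = 1 / n"
    proof -
      have "\<bar>\<Prod>p\<in>P. (s p / N p) ^ e p\<bar> = (\<Prod>p\<in>P. 1 / N p ^ e p)"
        unfolding abs_prod
      proof (rule prod.cong[OF refl])
        fix p assume p: "p \<in> P"
        show "\<bar>(s p / N p) ^ e p\<bar> = 1 / N p ^ e p"
          using Np[OF p] P(4)[OF p] by (simp add: power_abs abs_mult power_divide)
      qed
      thus ?thesis by (simp add: n_def prod_dividef)
    qed
    show "(\<Prod>p\<in>P. (s p / N p) ^ e p) - (if (\<Prod>p\<in>P. N p ^ e p) \<le> t then \<Prod>p\<in>P. (s p / N p) ^ e p else 0)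
        \<le> exp (- (\<sigma> * ln t)) * (\<Prod>p\<in>P. (N p powr \<sigma> / N p) ^ e p)"
    proof (cases "n \<le> t")
      case True
      thus ?thesis using n unfolding rank by (simp add: n_def)
    next
      case False
      have "(\<Prod>p\<in>P. (s p / N p) ^ e p) \<le> 1 * (1 / n)" using ab by (simp add: abs_le_iff)
      also have "1 \<le> exp (- (\<sigma> * ln t)) * n powr \<sigma>"
      proof -
        have "ln t \<le> ln n" using False t n by simp
        hence "\<sigma> * ln t \<le> \<sigma> * ln n" using \<sigma> by (intro mult_left_mono) auto
        thus ?thesis using n by (simp add: powr_def flip: exp_add)
      qed
      hence "1 * (1 / n) \<le> exp (- (\<sigma> * ln t)) * n powr \<sigma> * (1 / n)" using n by (intro mult_right_mono) auto
      finally show ?thesis using False unfolding rank by (simp add: n_def)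
    qed
  qed
  also have "\<dots> = exp (- (\<sigma> * ln t)) * (\<Prod>p\<in>P. \<Sum>i\<le>K. (N p powr \<sigma> / N p) ^ i)"
    using P(1) by (simp add: prod_sum_PiE sum_distrib_left)
  also have "(\<Prod>p\<in>P. \<Sum>i\<le>K. (N p powr \<sigma> / N p) ^ i) \<le> (\<Prod>p\<in>P. exp (10 * (1 / N p)))"
  proof (rule prod_mono)
    fix p assume p: "p \<in> P"
    have Np: "N p \<ge> 2" "N p \<le> y" using P p by auto
    have "\<sigma> * ln (N p) \<le> \<sigma> * ln y" using Np y \<sigma> by (intro mult_left_mono) auto
    also have "\<dots> = 1 / 2" using y by (simp add: \<sigma>_def)
    finally have "N p powr \<sigma> \<le> exp (1 / 2)" using Np by (simp add: powr_def)
    also have "exp (1 / 2 :: real) \<le> 5 / 3"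
    proof (rule power_le_imp_le_base[of _ 1])
      have "exp (1 / 2 :: real) ^ 2 = exp 1" by (simp add: power2_eq_square flip: exp_add)
      also have "\<dots> \<le> 272 / 100" using e_less_272 by simp
      also have "\<dots> \<le> (5 / 3) ^ 2" by (simp add: power2_eq_square)
      finally show "exp (1 / 2 :: real) ^ Suc 1 \<le> (5 / 3) ^ Suc 1" by (simp add: numeral_2_eq_2)
    qed simp
    finally have N\<sigma>: "N p powr \<sigma> \<le> 5 / 3" .
    define v where "v = N p powr \<sigma> / N p"
    have v: "0 \<le> v" using Np by (simp add: v_def)
    have v2: "v \<le> (5 / 3) / N p" unfolding v_def using N\<sigma> Np by (intro divide_right_mono) auto
    have "(5 / 3) / N p \<le> (5 / 3) / 2" using Np by (intro divide_left_mono) auto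
    hence v56: "v \<le> 5 / 6" using v2 by simp
    have "(\<Sum>i\<le>K. v ^ i) \<le> 1 / (1 - v)" using v v56 by (intro geometric_le) auto
    \<comment> \<open>Expanding (1 + 6 v)(1 - v) shows that this holds for 0 <= v <= 5/6, which is
      what N p powr \<sigma> <= 5/3 ensures even for N p = 2. The constant 10 is 6 times
      5/3.\<close>
    also have "\<dots> \<le> 1 + 6 * v"
    proof -
      have "v * v \<le> v * (5 / 6)" using v v56 by (intro mult_left_mono) auto
      hence "1 \<le> (1 + 6 * v) * (1 - v)" by (simp add: algebra_simps)
      thus ?thesis using v56 by (simp add: divide_le_eq)
    qed
    also have "\<dots> \<le> exp (6 * v)" by (rule exp_ge_add_one_self)
    also have "\<dots> \<le> exp (10 * (1 / N p))" using v2 by simp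
    finally show "0 \<le> (\<Sum>i\<le>K. (N p powr \<sigma> / N p) ^ i) \<and> (\<Sum>i\<le>K. (N p powr \<sigma> / N p) ^ i) \<le> exp (10 * (1 / N p))"
      using v by (auto simp: v_def intro!: sum_nonneg)
  qed
  also have "(\<Prod>p\<in>P. exp (10 * (1 / N p))) = exp (10 * E)" using P(1) by (simp add: E_def exp_sum sum_distrib_left)
  finally have "full - smooth_sum K N P t s \<le> exp (- (\<sigma> * ln t)) * exp (10 * E)" by simp
  also have "\<dots> = exp (10 * E - ln t / (2 * ln y))" by (simp add: \<sigma>_def algebra_simps flip: exp_add)
  finally show ?thesis using 1 by (simp add: E_def)
qed

section \<open>Exponential moments of the sum over random signs\<close>

lemma exp_add_exp_minus_le: "exp x + exp (- x) \<le> 2 * exp ((x::real)\<^sup>2)"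
proof -
  have pos: "exp x + exp (- x) \<le> 2 * exp (x\<^sup>2)" if x: "x \<ge> 0" for x :: real
  proof -
    \<comment> \<open>Hoeffding's lemma for a fair sign: mean 1/2 on an interval of length 2 x gives
      cosh x <= exp (x^2 / 2), weakened below to exp (x^2).\<close>
    have h: "- (2 * x) * (1 / 2) + ln (1 + (1 / 2) * (exp (2 * x) - 1)) \<le> (2 * x)\<^sup>2 / 8"
      using Hoeffdings_lemma_aux[of "2 * x" "1 / 2"] x by simp
    have eq: "1 + (1 / 2) * (exp (2 * x) - 1) = (1 + exp (2 * x)) / 2" by (simp add: field_simps)
    have "(2 * x)\<^sup>2 / 8 \<le> x\<^sup>2" by (simp add: power2_eq_square)
    hence "ln ((1 + exp (2 * x)) / 2) \<le> x + x\<^sup>2" using h unfolding eq by linarith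
    hence "exp (ln ((1 + exp (2 * x)) / 2)) \<le> exp (x + x\<^sup>2)" by (simp only: exp_le_cancel_iff)
    moreover have "exp (ln ((1 + exp (2 * x)) / 2)) = (1 + exp (2 * x)) / 2"
      by (rule exp_ln) (simp add: add_pos_pos)
    ultimately have "(1 + exp (2 * x)) / 2 \<le> exp (x + x\<^sup>2)" by (simp only:)
    hence "1 + exp (2 * x) \<le> 2 * exp (x + x\<^sup>2)" by (simp add: field_simps)
    hence "exp (- x) * (1 + exp (2 * x)) \<le> exp (- x) * (2 * exp (x + x\<^sup>2))" by (intro mult_left_mono) auto
    thus ?thesis by (simp add: distrib_left algebra_simps flip: exp_add)
  qed
  show ?thesis using pos[of x] pos[of "- x"] by (cases "x \<ge> 0") auto
qed

lemma geometric_tail_le: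
  assumes v: "0 \<le> v" "v \<le> 1 / 2"
  shows "(\<Sum>i\<le>K. if c \<le> i then v ^ i else 0) \<le> 2 * (v::real) ^ c"
proof -
  \<comment> \<open>The extra term stands for the tail beyond K and lets the induction
    close.\<close>
  have "(\<Sum>i\<le>K. if c \<le> i then v ^ i else 0) + 2 * v ^ max c (Suc K) \<le> 2 * v ^ c"
  proof (induction K)
    case 0
    consider "c = 0" | "c = 1" | "c \<ge> 2" by linarith
    thus ?case using v by cases (auto simp: max_def)
  next
    case (Suc K)
    show ?case
    proof (cases "c \<le> Suc K")
      case True
      have "2 * v ^ Suc (Suc K) \<le> v ^ Suc K" using mult_right_mono[of "2 * v" 1 "v ^ Suc K"] v by simp
      thus ?thesis using Suc True by (simp add: max_def)
    next
      case False
      thus ?thesis using Suc by (cases "c = Suc (Suc K)") (auto simp: max_def)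
    qed
  qed
  moreover have "0 \<le> v ^ max c (Suc K)" using v by simp
  ultimately show ?thesis by linarith
qed

text \<open>Even powers of a sign are 1 and odd ones the sign itself: \<open>b\<close> collects the
  odd exponents of \<open>q\<close>, and \<open>r\<close> the positive even ones, which start at 2
  and so gain a further factor 1 / N q. The last clause makes both predictable: they are functions
  of the earlier signs.\<close>

lemma smooth_sum_step:
  assumes P: "finite P" "q \<notin> P" "\<And>p. p \<in> P \<Longrightarrow> N p > 0" and q: "N q \<ge> 2"
    and W: "euler_bound K N P \<le> W"
  shows "\<exists>b r.
    (\<forall>s. s q = 1 \<or> s q = - 1 \<longrightarrow> smooth_sum K N (insert q P) t s = smooth_sum K N P t s + r s + s q * b s) \<and>
    (\<forall>s. (\<forall>p\<in>P. \<bar>s p\<bar> = 1) \<longrightarrow> \<bar>b s\<bar> \<le> W * (2 / N q) \<and> \<bar>r s\<bar> \<le> W * (2 / (N q)\<^sup>2)) \<and>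
    (\<forall>s s'. (\<forall>p\<in>P. s p = s' p) \<longrightarrow> b s = b s' \<and> r s = r s')"
proof -
  define v where "v = 1 / N q"
  have v: "0 \<le> v" "v \<le> 1 / 2" using q by (auto simp: v_def field_simps)
  define S where "S i s = smooth_sum K N P (t / N q ^ i) s" for i s
  define b where "b s = (\<Sum>i\<le>K. if odd i then v ^ i * S i s else 0)" for s
  define r where "r s = (\<Sum>i\<le>K. if even i \<and> i \<noteq> 0 then v ^ i * S i s else 0)" for s
  have S_le: "\<bar>S i s\<bar> \<le> W" if "\<And>p. p \<in> P \<Longrightarrow> \<bar>s p\<bar> = 1" for i s
    unfolding S_def by (rule order.trans[OF abs_smooth_sum_le W]) (fact P that)+
  have W0: "W \<ge> 0"
    by (rule order.trans[OF _ W]) (auto simp: euler_bound_def less_imp_le P(3) intro!: prod_nonneg sum_nonneg)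
  have bd: "\<bar>\<Sum>i\<le>K. if Q i then v ^ i * S i s else 0\<bar> \<le> W * (2 * v ^ c)"
    if s: "\<And>p. p \<in> P \<Longrightarrow> \<bar>s p\<bar> = 1" and Q: "\<And>i. Q i \<Longrightarrow> c \<le> i" for Q c s
  proof -
    have "\<bar>\<Sum>i\<le>K. if Q i then v ^ i * S i s else 0\<bar> \<le> (\<Sum>i\<le>K. W * (if c \<le> i then v ^ i else 0))"
    proof (rule order.trans[OF sum_abs sum_mono])
      fix i
      have "v ^ i * \<bar>S i s\<bar> \<le> v ^ i * W" using S_le[OF s] v by (intro mult_left_mono) auto
      thus "\<bar>if Q i then v ^ i * S i s else 0\<bar> \<le> W * (if c \<le> i then v ^ i else 0)"
        using Q[of i] v W0 by (auto simp: abs_mult power_abs mult.commute)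
    qed
    also have "\<dots> = W * (\<Sum>i\<le>K. if c \<le> i then v ^ i else 0)" by (simp add: sum_distrib_left)
    also have "\<dots> \<le> W * (2 * v ^ c)" using W0 by (intro mult_left_mono geometric_tail_le v)
    finally show ?thesis .
  qed
  show ?thesis
  proof (rule exI[of _ b], rule exI[of _ r], intro conjI allI impI)
    fix s :: "'a \<Rightarrow> real" assume sq: "s q = 1 \<or> s q = - 1"
    have pw: "(s q / N q) ^ i = (if even i then 1 else s q) * v ^ i" for i
    proof -
      have "s q ^ i = (if even i then 1 else s q)" using sq by auto
      thus ?thesis by (simp add: v_def power_divide)
    qed
    have "smooth_sum K N (insert q P) t s = (\<Sum>i\<le>K. (if even i then 1 else s q) * v ^ i * S i s)"
      using smooth_sum_insert[OF P(1,2), of N K t s] q by (simp add: pw S_def)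
    also have "\<dots> = (\<Sum>i\<le>K. (if i = 0 then S 0 s else 0) + (if even i \<and> i \<noteq> 0 then v ^ i * S i s else 0)
        + s q * (if odd i then v ^ i * S i s else 0))"
      by (intro sum.cong refl) (auto simp: mult.assoc)
    also have "\<dots> = S 0 s + r s + s q * b s"
      by (simp add: sum.distrib r_def b_def sum_distrib_left)
    finally show "smooth_sum K N (insert q P) t s = smooth_sum K N P t s + r s + s q * b s" by (simp add: S_def)
  next
    fix s :: "'a \<Rightarrow> real" assume s: "\<forall>p\<in>P. \<bar>s p\<bar> = 1"
    have "\<bar>b s\<bar> \<le> W * (2 * v ^ 1)" unfolding b_def by (intro bd s[rule_format]) (auto intro!: Suc_leI Nat.gr0I)
    thus "\<bar>b s\<bar> \<le> W * (2 / N q)" by (simp add: v_def)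
    have "\<bar>r s\<bar> \<le> W * (2 * v ^ 2)" unfolding r_def
    proof (intro bd s[rule_format])
      fix i :: nat assume "even i \<and> i \<noteq> 0"
      thus "2 \<le> i" by (auto elim!: evenE)
    qed
    thus "\<bar>r s\<bar> \<le> W * (2 / (N q)\<^sup>2)" by (simp add: v_def power_divide)
  next
    fix s s' :: "'a \<Rightarrow> real" assume s: "\<forall>p\<in>P. s p = s' p"
    have eq: "S i s = S i s'" for i unfolding S_def by (rule smooth_sum_cong) (use s in blast)
    show "b s = b s'" "r s = r s'" unfolding b_def r_def by (simp_all only: eq)
  qed
qed

text \<open>Adding one prime at a time, the sum changes by \<open>s q * b + r\<close> where \<open>b\<close> and \<open>r\<close> only depend on
  the signs chosen before: this is the martingale structure behind the Azuma-type bound.\<close>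

lemma exp_moment_bound:
  fixes N :: "'a \<Rightarrow> real"
  assumes P0: "finite P0" and Q: "finite Q" "P0 \<inter> Q = {}"
    and N: "\<And>p. p \<in> P0 \<union> Q \<Longrightarrow> N p \<ge> 2" and l: "l \<ge> 0"
    and W: "\<And>Q'. Q' \<subseteq> Q \<Longrightarrow> euler_bound K N (P0 \<union> Q') \<le> W"
    and m: "\<And>s. (\<And>p. p \<in> P0 \<Longrightarrow> \<bar>s p\<bar> = 1) \<Longrightarrow> m \<le> smooth_sum K N P0 t s"
  shows "(\<Sum>s\<in>(P0 \<union> Q) \<rightarrow>\<^sub>E {1, - 1}. exp (- (l * smooth_sum K N (P0 \<union> Q) t s))) \<le>
    2 ^ card (P0 \<union> Q) * exp (- (l * m) + (2 * l * W + 4 * l\<^sup>2 * W\<^sup>2) * (\<Sum>q\<in>Q. 1 / (N q)\<^sup>2))"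
  using Q N W
proof (induction Q rule: finite_induct)
  case empty
  have "(\<Sum>s\<in>P0 \<rightarrow>\<^sub>E {1, - 1}. exp (- (l * smooth_sum K N P0 t s))) \<le> (\<Sum>s\<in>P0 \<rightarrow>\<^sub>E {1, - 1 :: real}. exp (- (l * m)))"
  proof (rule sum_mono)
    fix s :: "'a \<Rightarrow> real" assume s: "s \<in> P0 \<rightarrow>\<^sub>E {1, - 1}"
    have "m \<le> smooth_sum K N P0 t s"
    proof (rule m)
      fix p assume "p \<in> P0"
      hence "s p \<in> {1, - 1}" using s by auto
      thus "\<bar>s p\<bar> = 1" by auto
    qed
    thus "exp (- (l * smooth_sum K N P0 t s)) \<le> exp (- (l * m))" using l by (simp add: mult_left_mono)
  qed
  thus ?case using P0 by (simp add: card_PiE)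
next
  case (insert q Q)
  define P where "P = P0 \<union> Q"
  have P: "finite P" "q \<notin> P" using insert P0 by (auto simp: P_def)
  have Np: "N p \<ge> 2" if "p \<in> insert q P" for p using insert.prems that by (auto simp: P_def)
  have WP: "euler_bound K N P \<le> W" unfolding P_def by (rule insert.prems) auto
  have Np0: "N p > 0" if "p \<in> P" for p using Np[of p] that by simp
  have Nq: "N q \<ge> 2" using Np by simp
  \<comment> \<open>The first summand pays for \<open>r\<close>, the second for the square of
    \<open>l * b\<close> in the cosh bound.\<close>
  define c where "c = 2 * l * W + 4 * l\<^sup>2 * W\<^sup>2"
  obtain b r where
    br1: "\<forall>s. s q = 1 \<or> s q = - 1 \<longrightarrow> smooth_sum K N (insert q P) t s = smooth_sum K N P t s + r s + s q * b s"
    and br2: "\<forall>s. (\<forall>p\<in>P. \<bar>s p\<bar> = 1) \<longrightarrow> \<bar>b s\<bar> \<le> W * (2 / N q) \<and> \<bar>r s\<bar> \<le> W * (2 / (N q)\<^sup>2)"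
    and br3: "\<forall>s s'. (\<forall>p\<in>P. s p = s' p) \<longrightarrow> b s = b s' \<and> r s = r s'"
    using smooth_sum_step[of P q N K W t, OF P Np0 Nq WP] by auto
  have inj: "inj_on (\<lambda>(y, g). g(q := y)) ({1, - 1 :: real} \<times> (P \<rightarrow>\<^sub>E {1, - 1}))"
    using P(2) by (rule inj_combinator)
  have step: "exp (- (l * smooth_sum K N (insert q P) t (g(q := 1)))) + exp (- (l * smooth_sum K N (insert q P) t (g(q := - 1))))
      \<le> 2 * exp (c / (N q)\<^sup>2) * exp (- (l * smooth_sum K N P t g))" if g: "g \<in> P \<rightarrow>\<^sub>E {1, - 1}" for g
  proof -
    have g1: "\<bar>g p\<bar> = 1" if "p \<in> P" for p
    proof -
      have "g p \<in> {1, - 1}" using g that by auto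
      thus ?thesis by auto
    qed
    have upd: "smooth_sum K N (insert q P) t (g(q := y)) = smooth_sum K N P t g + r g + y * b g" if "y = 1 \<or> y = - 1" for y
    proof -
      have "smooth_sum K N P t (g(q := y)) = smooth_sum K N P t g" using P(2) by (intro smooth_sum_cong) auto
      moreover have "b (g(q := y)) = b g \<and> r (g(q := y)) = r g" using P(2) br3 by auto
      ultimately show ?thesis using br1[rule_format, of "g(q := y)"] that by simp
    qed
    define a where "a = smooth_sum K N P t g"
    have e1: "- (l * (a + r g + 1 * b g)) = - (l * a) + - (l * r g) + - (l * b g)"
      and e2: "- (l * (a + r g + - 1 * b g)) = - (l * a) + - (l * r g) + l * b g"
      by (simp_all add: algebra_simps)
    have "exp (- (l * (a + r g + 1 * b g))) + exp (- (l * (a + r g + - 1 * b g))) =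
        exp (- (l * a)) * exp (- (l * r g)) * (exp (l * b g) + exp (- (l * b g)))"
      unfolding e1 e2 exp_add by (simp add: algebra_simps)
    also have "\<dots> \<le> exp (- (l * a)) * exp (2 * l * W / (N q)\<^sup>2) * (2 * exp (4 * l\<^sup>2 * W\<^sup>2 / (N q)\<^sup>2))"
    proof (intro mult_mono mult_nonneg_nonneg)
      have "- r g \<le> W * (2 / (N q)\<^sup>2)" using br2[rule_format, of g] g1 by (simp add: abs_le_iff)
      hence "l * (- r g) \<le> l * (W * (2 / (N q)\<^sup>2))" using l by (rule mult_left_mono)
      thus "exp (- (l * r g)) \<le> exp (2 * l * W / (N q)\<^sup>2)" by (simp add: mult_ac)
      have "\<bar>l * b g\<bar> \<le> l * (W * (2 / N q))" unfolding abs_mult using br2[rule_format, of g] g1 l by (intro mult_mono) auto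
      hence "\<bar>l * b g\<bar>\<^sup>2 \<le> (l * (W * (2 / N q)))\<^sup>2" by (intro power_mono) auto
      hence "(l * b g)\<^sup>2 \<le> 4 * l\<^sup>2 * W\<^sup>2 / (N q)\<^sup>2" by (simp add: power_mult_distrib power_divide mult_ac)
      hence "2 * exp ((l * b g)\<^sup>2) \<le> 2 * exp (4 * l\<^sup>2 * W\<^sup>2 / (N q)\<^sup>2)" by simp
      thus "exp (l * b g) + exp (- (l * b g)) \<le> 2 * exp (4 * l\<^sup>2 * W\<^sup>2 / (N q)\<^sup>2)"
        using exp_add_exp_minus_le[of "l * b g"] by linarith
    qed (auto intro: add_nonneg_nonneg)
    also have "\<dots> = 2 * exp (c / (N q)\<^sup>2) * exp (- (l * a))"
      by (simp add: c_def add_divide_distrib exp_add)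
    finally show ?thesis using upd[of 1] upd[of "- 1"] by (simp add: a_def)
  qed
  have "(\<Sum>s\<in>insert q P \<rightarrow>\<^sub>E {1, - 1}. exp (- (l * smooth_sum K N (insert q P) t s))) =
      (\<Sum>(y, g)\<in>{1, - 1} \<times> (P \<rightarrow>\<^sub>E {1, - 1}). exp (- (l * smooth_sum K N (insert q P) t (g(q := y)))))"
    unfolding PiE_insert_eq sum.reindex[OF inj] by (simp add: case_prod_unfold o_def)
  also have "\<dots> = (\<Sum>y\<in>{1, - 1}. \<Sum>g\<in>P \<rightarrow>\<^sub>E {1, - 1}. exp (- (l * smooth_sum K N (insert q P) t (g(q := y)))))"
    by (rule sum.cartesian_product[symmetric])
  also have "\<dots> = (\<Sum>g\<in>P \<rightarrow>\<^sub>E {1, - 1}. exp (- (l * smooth_sum K N (insert q P) t (g(q := 1))))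
      + exp (- (l * smooth_sum K N (insert q P) t (g(q := - 1)))))"
    by (simp add: sum.distrib)
  also have "\<dots> \<le> (\<Sum>g\<in>P \<rightarrow>\<^sub>E {1, - 1}. 2 * exp (c / (N q)\<^sup>2) * exp (- (l * smooth_sum K N P t g)))"
    by (intro sum_mono step)
  also have "\<dots> = 2 * exp (c / (N q)\<^sup>2) * (\<Sum>g\<in>P \<rightarrow>\<^sub>E {1, - 1}. exp (- (l * smooth_sum K N P t g)))"
    by (simp add: sum_distrib_left)
  also have "\<dots> \<le> 2 * exp (c / (N q)\<^sup>2) * (2 ^ card P * exp (- (l * m) + c * (\<Sum>q\<in>Q. 1 / (N q)\<^sup>2)))"
    unfolding P_def c_def using insert.prems by (intro mult_left_mono insert.IH) auto
  also have "\<dots> = 2 ^ card (insert q P) * (exp (c / (N q)\<^sup>2) * exp (- (l * m) + c * (\<Sum>q\<in>Q. 1 / (N q)\<^sup>2)))"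
    using P by simp
  also have "exp (c / (N q)\<^sup>2) * exp (- (l * m) + c * (\<Sum>q\<in>Q. 1 / (N q)\<^sup>2)) =
      exp (- (l * m) + c * (\<Sum>q\<in>insert q Q. 1 / (N q)\<^sup>2))"
    using insert.hyps by (simp add: distrib_left flip: exp_add)
  finally show ?case by (simp add: P_def c_def)
qed

section \<open>From probabilities to sums over sign vectors\<close>

lemma (in prob_space) random_signs_prob:
  fixes F :: "'a \<Rightarrow> 'b \<Rightarrow> real"
  assumes ind: "indep_vars (\<lambda>_. borel) (\<lambda>i \<omega>. F \<omega> i) I" and Q: "finite Q" "Q \<subseteq> I"
    and half: "\<And>i. i \<in> I \<Longrightarrow> prob {\<omega> \<in> space M. F \<omega> i = 1} = 1 / 2"
      "\<And>i. i \<in> I \<Longrightarrow> prob {\<omega> \<in> space M. F \<omega> i = - 1} = 1 / 2"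
    and s: "\<And>i. i \<in> Q \<Longrightarrow> s i = 1 \<or> s i = - 1"
  shows "{\<omega> \<in> space M. \<forall>i\<in>Q. F \<omega> i = s i} \<in> events \<and> prob {\<omega> \<in> space M. \<forall>i\<in>Q. F \<omega> i = s i} = (1 / 2) ^ card Q"
proof (cases "Q = {}")
  case True
  thus ?thesis by (simp add: prob_space)
next
  case False
  have eq: "{\<omega> \<in> space M. \<forall>i\<in>Q. F \<omega> i = s i} = (\<Inter>i\<in>Q. (\<lambda>\<omega>. F \<omega> i) -` {s i} \<inter> space M)"
    using False by auto
  have rv: "random_variable borel (\<lambda>\<omega>. F \<omega> i)" if "i \<in> I" for i
    using ind that by (auto simp: indep_vars_def)
  have "prob (\<Inter>i\<in>Q. (\<lambda>\<omega>. F \<omega> i) -` {s i} \<inter> space M) = (\<Prod>i\<in>Q. prob ((\<lambda>\<omega>. F \<omega> i) -` {s i} \<inter> space M))"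
    by (rule indep_varsD[OF ind False Q]) simp
  also have "\<dots> = (\<Prod>i\<in>Q. 1 / 2)"
  proof (rule prod.cong[OF refl])
    fix i assume i: "i \<in> Q"
    have "(\<lambda>\<omega>. F \<omega> i) -` {s i} \<inter> space M = {\<omega> \<in> space M. F \<omega> i = s i}" by auto
    thus "prob ((\<lambda>\<omega>. F \<omega> i) -` {s i} \<inter> space M) = 1 / 2" using s[OF i] half[of i] i Q by auto
  qed
  also have "\<dots> = (1 / 2) ^ card Q" by simp
  finally have "prob {\<omega> \<in> space M. \<forall>i\<in>Q. F \<omega> i = s i} = (1 / 2) ^ card Q" unfolding eq .
  moreover have "(\<Inter>i\<in>Q. (\<lambda>\<omega>. F \<omega> i) -` {s i} \<inter> space M) \<in> events"
    using Q False rv by (intro sets.finite_INT) (auto intro!: measurable_sets)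
  ultimately show ?thesis unfolding eq by simp
qed

text \<open>Only the signs on the finite set Q matter, and each sign vector has probability 2^(-card
  Q). The event is covered by the cells of the bad vectors, and the Chernoff bound replaces the
  indicator of a negative value by exp (-l h).\<close>

lemma (in prob_space) random_signs_negative:
  fixes F :: "'a \<Rightarrow> 'b \<Rightarrow> real" and h :: "('b \<Rightarrow> real) \<Rightarrow> real"
  assumes ind: "indep_vars (\<lambda>_. borel) (\<lambda>i \<omega>. F \<omega> i) I" and Q: "finite Q" "Q \<subseteq> I"
    and half: "\<And>i. i \<in> I \<Longrightarrow> prob {\<omega> \<in> space M. F \<omega> i = 1} = 1 / 2"
      "\<And>i. i \<in> I \<Longrightarrow> prob {\<omega> \<in> space M. F \<omega> i = - 1} = 1 / 2"
    and F: "\<And>i \<omega>. i \<in> I \<Longrightarrow> \<omega> \<in> space M \<Longrightarrow> F \<omega> i \<in> {1, - 1}"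
    and h: "\<And>s s'. (\<And>i. i \<in> Q \<Longrightarrow> s i = s' i) \<Longrightarrow> h s = h s'" and l: "l \<ge> 0"
  shows "prob {\<omega> \<in> space M. h (F \<omega>) < 0} \<le> (1 / 2) ^ card Q * (\<Sum>s\<in>Q \<rightarrow>\<^sub>E {1, - 1}. exp (- (l * h s)))"
proof -
  define Ev where "Ev s = {\<omega> \<in> space M. \<forall>i\<in>Q. F \<omega> i = s i}" for s
  define Bad where "Bad = {s \<in> Q \<rightarrow>\<^sub>E {1, - 1}. h s < 0}"
  have fin: "finite (Q \<rightarrow>\<^sub>E {1, - 1 :: real})" using Q by (intro finite_PiE) auto
  have finB: "finite Bad" unfolding Bad_def using fin by simp
  have Ev: "Ev s \<in> events" "prob (Ev s) = (1 / 2) ^ card Q" if "s \<in> Q \<rightarrow>\<^sub>E {1, - 1}" for s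
  proof -
    have "s i = 1 \<or> s i = - 1" if "i \<in> Q" for i using \<open>s \<in> Q \<rightarrow>\<^sub>E {1, - 1}\<close> that by (auto simp: PiE_iff)
    from random_signs_prob[OF ind Q half this] show "Ev s \<in> events" "prob (Ev s) = (1 / 2) ^ card Q"
      by (auto simp: Ev_def)
  qed
  have sub: "{\<omega> \<in> space M. h (F \<omega>) < 0} \<subseteq> (\<Union>s\<in>Bad. Ev s)"
  proof safe
    fix \<omega> assume \<omega>: "\<omega> \<in> space M" "h (F \<omega>) < 0"
    have "h (restrict (F \<omega>) Q) = h (F \<omega>)" by (rule h) simp
    hence "restrict (F \<omega>) Q \<in> Bad" using \<omega> F Q by (auto simp: Bad_def)
    moreover have "\<omega> \<in> Ev (restrict (F \<omega>) Q)" using \<omega> by (simp add: Ev_def)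
    ultimately show "\<omega> \<in> (\<Union>s\<in>Bad. Ev s)" by blast
  qed
  have "prob {\<omega> \<in> space M. h (F \<omega>) < 0} \<le> prob (\<Union>s\<in>Bad. Ev s)"
    using Ev finB by (intro finite_measure_mono sub sets.finite_UN) (auto simp: Bad_def)
  also have "\<dots> \<le> (\<Sum>s\<in>Bad. prob (Ev s))"
    using Ev finB by (intro finite_measure_subadditive_finite) (auto simp: Bad_def)
  also have "\<dots> \<le> (\<Sum>s\<in>Bad. (1 / 2) ^ card Q * exp (- (l * h s)))"
  proof (rule sum_mono)
    fix s assume s: "s \<in> Bad"
    have "l * h s \<le> 0" using s l by (auto simp: Bad_def intro: mult_nonneg_nonpos)
    hence "1 \<le> exp (- (l * h s))" by simp
    hence "(1 / 2) ^ card Q * 1 \<le> (1 / 2 :: real) ^ card Q * exp (- (l * h s))" by (intro mult_left_mono) auto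
    thus "prob (Ev s) \<le> (1 / 2) ^ card Q * exp (- (l * h s))" using Ev(2)[of s] s by (simp add: Bad_def)
  qed
  also have "\<dots> \<le> (\<Sum>s\<in>Q \<rightarrow>\<^sub>E {1, - 1}. (1 / 2) ^ card Q * exp (- (l * h s)))"
    using fin by (intro sum_mono2) (auto simp: Bad_def)
  finally show ?thesis by (simp add: sum_distrib_left)
qed

section \<open>The probability of a negative sum\<close>

text \<open>Applied with L = ln ln x; w is y^(1/3). For l proportional to w the main term of the
  exponent is linear in w, while the variance term is w^2 / y = 1 / w up to powers of ln x, and
  \<open>large\<close> makes it at most 1.\<close>

lemma smooth_sum_negative_prob:
  fixes F :: "'w \<Rightarrow> 'b \<Rightarrow> real" and N :: "'b \<Rightarrow> real"
  assumes M: "prob_space M" "prob_space.indep_vars M (\<lambda>_. borel) (\<lambda>i \<omega>. F \<omega> i) I"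
    and half: "\<And>i. i \<in> I \<Longrightarrow> measure M {\<omega> \<in> space M. F \<omega> i = 1} = 1 / 2"
      "\<And>i. i \<in> I \<Longrightarrow> measure M {\<omega> \<in> space M. F \<omega> i = - 1} = 1 / 2"
    and F: "\<And>i \<omega>. i \<in> I \<Longrightarrow> \<omega> \<in> space M \<Longrightarrow> F \<omega> i \<in> {1, - 1}"
    and Q: "finite Q" "Q \<subseteq> I" and N: "\<And>i. i \<in> Q \<Longrightarrow> N i \<ge> 2" and K: "K \<ge> 1"
    and E: "(\<Sum>i\<in>Q. 1 / N i) \<le> c * L" and c: "c > 0" and L: "L \<ge> 1"
    and x: "x > 0" "ln x > 0" and w: "w = exp (ln x / (3 * (24 * c + 2) * L))"
    and large: "72 * c * L * exp (8 * c * L) \<le> w"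
  shows "measure M {\<omega> \<in> space M. smooth_sum K N Q x (F \<omega>) < 0} \<le> exp (- w)"
proof -
  interpret prob_space M by (rule M)
  \<comment> \<open>This choice makes ln x / (2 ln y) = 12 c L + L, which absorbs the 10 c L of
    Rankin's bound and the 2 c L of the main term and leaves a factor exp (-L) <= 1/2.\<close>
  define D where "D = 24 * c + 2"
  define y where "y = exp (ln x / (D * L))"
  have DL: "D * L > 0" using c L by (simp add: D_def)
  have lny: "ln y = ln x / (D * L)" by (simp add: y_def)
  have y1: "y > 1" unfolding y_def using x DL by simp
  have w1: "w \<ge> 1" unfolding w using x c L by simp
  have yw: "y = w ^ 3"
  proof -
    have "w = exp (ln x / (D * L) / 3)" unfolding w D_def by (simp add: mult_ac)
    hence "w ^ 3 = exp (3 * (ln x / (D * L) / 3))" using exp_of_nat_mult[of 3 "ln x / (D * L) / 3"] by simp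
    thus ?thesis by (simp add: y_def)
  qed
  define P0 where "P0 = {i\<in>Q. N i \<le> y}"
  define P1 where "P1 = {i\<in>Q. N i > y}"
  have PQ1: "Q = P0 \<union> P1" unfolding P0_def P1_def by fastforce
  have PQ2: "P0 \<inter> P1 = {}" unfolding P0_def P1_def by fastforce
  have PQ3: "finite P0" "finite P1" using Q(1) by (simp_all add: P0_def P1_def)
  note PQ = PQ1 PQ2 PQ3
  have P0Q: "P0 \<subseteq> Q" and P1Q: "P1 \<subseteq> Q" and P0y: "\<And>i. i \<in> P0 \<Longrightarrow> N i \<le> y"
    by (auto simp: P0_def P1_def)
  have Npos: "N i > 0" if "i \<in> Q" for i using N[OF that] by simp
  have Esub: "(\<Sum>i\<in>Q'. 1 / N i) \<le> c * L" if "Q' \<subseteq> Q" for Q'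
  proof -
    have "(\<Sum>i\<in>Q'. 1 / N i) \<le> (\<Sum>i\<in>Q. 1 / N i)"
      using Q(1) that Npos by (intro sum_mono2) (auto simp: less_imp_le)
    thus ?thesis using E by linarith
  qed
  define m where "m = exp (- (2 * c * L)) / 2"
  define B where "B = exp (2 * c * L)"
  have m: "m \<le> smooth_sum K N P0 x s" if s: "\<And>i. i \<in> P0 \<Longrightarrow> \<bar>s i\<bar> = 1" for s
  proof -
    have E0: "(\<Sum>i\<in>P0. 1 / N i) \<le> c * L" by (rule Esub[OF P0Q])
    have lnq: "ln x / (2 * ln y) = 12 * c * L + L" unfolding lny D_def using x c L by (simp add: field_simps)
    have "exp (10 * (\<Sum>i\<in>P0. 1 / N i) - ln x / (2 * ln y)) \<le> exp (- (2 * c * L) - 1)"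
      unfolding lnq exp_le_cancel_iff using E0 L by linarith
    also have "\<dots> = exp (- (2 * c * L)) / exp 1" by (rule exp_diff)
    also have "\<dots> \<le> exp (- (2 * c * L)) / 2" using exp_ge_add_one_self[of 1] by (intro divide_left_mono) auto
    finally have 1: "exp (10 * (\<Sum>i\<in>P0. 1 / N i) - ln x / (2 * ln y)) \<le> m" by (simp add: m_def)
    have "exp (- (2 * c * L)) \<le> exp (- (2 * (\<Sum>i\<in>P0. 1 / N i)))" using E0 by simp
    hence 2: "2 * m \<le> exp (- (2 * (\<Sum>i\<in>P0. 1 / N i)))" by (simp add: m_def)
    have "exp (- (2 * (\<Sum>i\<in>P0. 1 / N i))) - exp (10 * (\<Sum>i\<in>P0. 1 / N i) - ln x / (2 * ln y)) \<le> smooth_sum K N P0 x s"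
      using P0Q by (intro smooth_sum_lower[OF PQ3(1) _ P0y s K y1 x(1)] N) auto
    thus ?thesis using 1 2 by linarith
  qed
  have X: "euler_bound K N (P0 \<union> Q') \<le> B" if "Q' \<subseteq> P1" for Q'
  proof -
    have sub: "P0 \<union> Q' \<subseteq> Q" using that P0Q P1Q by blast
    have "euler_bound K N (P0 \<union> Q') \<le> exp (2 * (\<Sum>i\<in>P0 \<union> Q'. 1 / N i))"
      using N sub by (intro euler_bound_le_exp) auto
    also have "\<dots> \<le> B" unfolding B_def using Esub[OF sub] by simp
    finally show ?thesis .
  qed
  \<comment> \<open>Since B m = 1/2, this gives l m = 2 w, of which at most 1 <= w is lost to the
    variance.\<close>
  define l where "l = 4 * B * w"
  have B1: "B \<ge> 1" unfolding B_def using c L by simp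
  have l0: "l \<ge> 0" unfolding l_def using B1 w1 by simp
  define \<sigma> where "\<sigma> = (\<Sum>q\<in>P1. 1 / (N q)\<^sup>2)"
  have mom: "(\<Sum>s\<in>Q \<rightarrow>\<^sub>E {1, - 1}. exp (- (l * smooth_sum K N Q x s))) \<le>
    2 ^ card Q * exp (- (l * m) + (2 * l * B + 4 * l\<^sup>2 * B\<^sup>2) * \<sigma>)"
    unfolding PQ(1) \<sigma>_def
    by (rule exp_moment_bound[OF PQ(3,4,2) _ l0 X m]) (use N P0Q P1Q in blast)+
  have s0: "0 \<le> \<sigma>" unfolding \<sigma>_def by (intro sum_nonneg) auto
  have s1: "\<sigma> \<le> c * L / w ^ 3"
  proof -
    have "\<sigma> \<le> (\<Sum>q\<in>P1. (1 / y) * (1 / N q))" unfolding \<sigma>_def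
    proof (rule sum_mono)
      fix q assume q: "q \<in> P1"
      have "y * N q \<le> N q * N q" using q Npos[of q] by (intro mult_right_mono) (auto simp: P1_def)
      thus "1 / (N q)\<^sup>2 \<le> (1 / y) * (1 / N q)"
        using q Npos[of q] y1 by (simp add: power2_eq_square frac_le P1_def)
    qed
    also have "\<dots> = (1 / y) * (\<Sum>q\<in>P1. 1 / N q)" by (simp add: sum_distrib_left)
    also have "\<dots> \<le> (1 / y) * (c * L)" using Esub[OF P1Q] y1 by (intro mult_left_mono) auto
    finally show ?thesis by (simp add: yw)
  qed
  have lm: "l * m = 2 * w"
  proof -
    have "B * exp (- (2 * c * L)) = 1" by (simp add: B_def flip: exp_add)
    thus ?thesis by (simp add: l_def m_def mult_ac)
  qed
  have B4: "B ^ 4 = exp (8 * c * L)" by (simp add: B_def flip: exp_of_nat_mult)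
  have rest: "(2 * l * B + 4 * l\<^sup>2 * B\<^sup>2) * \<sigma> \<le> 1"
  proof -
    have "B\<^sup>2 \<le> B ^ 4" using B1 by (intro power_increasing) auto
    moreover have "w \<le> w ^ 2" using w1 by (simp add: self_le_power)
    ultimately have "B\<^sup>2 * w \<le> B ^ 4 * w ^ 2" using w1 by (intro mult_mono) auto
    \<comment> \<open>Inserting \<open>l\<close> gives the coefficients 8 and 64 of the two
      summands, hence 72.\<close>
    hence "2 * l * B + 4 * l\<^sup>2 * B\<^sup>2 \<le> 72 * (B ^ 4 * w\<^sup>2)"
      by (simp add: l_def power_mult_distrib power2_eq_square power4_eq_xxxx algebra_simps)
    moreover have "0 \<le> B ^ 4 * w\<^sup>2" using B1 by simp
    ultimately have "(2 * l * B + 4 * l\<^sup>2 * B\<^sup>2) * \<sigma> \<le> 72 * (B ^ 4 * w\<^sup>2) * (c * L / w ^ 3)"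
      using s0 s1 by (intro mult_mono) auto
    also have "\<dots> = 72 * c * L * exp (8 * c * L) / w"
      using w1 by (simp add: B4 power2_eq_square power3_eq_cube)
    also have "\<dots> \<le> 1" using large w1 by (simp add: divide_le_eq)
    finally show ?thesis .
  qed
  have "prob {\<omega> \<in> space M. smooth_sum K N Q x (F \<omega>) < 0} \<le>
      (1 / 2) ^ card Q * (\<Sum>s\<in>Q \<rightarrow>\<^sub>E {1, - 1}. exp (- (l * smooth_sum K N Q x s)))"
    by (rule random_signs_negative[OF M(2) Q half F _ l0]) (auto intro: smooth_sum_cong)
  also have "\<dots> \<le> (1 / 2) ^ card Q * (2 ^ card Q * exp (- (l * m) + (2 * l * B + 4 * l\<^sup>2 * B\<^sup>2) * \<sigma>))"
    by (intro mult_left_mono mom) auto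
  also have "\<dots> = exp (- (l * m) + (2 * l * B + 4 * l\<^sup>2 * B\<^sup>2) * \<sigma>)" by (simp add: power_one_over)
  also have "\<dots> \<le> exp (- w)" using rest w1 unfolding lm by simp
  finally show ?thesis .
qed

context cyclotomic
begin

lemma nonzero_prime_ideals_eq: "nonzero_prime_ideals (cyclotomic_integers n) = Collect is_prime"
  using nonzero_primeideal_iff by (auto simp: nonzero_prime_ideals_def cyclotomic_integers_eq)

lemma ideal_partial_sum_eq_smooth_sum:
  assumes f: "random_completely_multiplicative (cyclotomic_integers n) M f"
    and \<omega>: "\<omega> \<in> space M" and Q: "Q = {P. is_prime P \<and> real (nrm P) \<le> x}" and k: "x < 2 ^ k"
  shows "ideal_partial_sum (cyclotomic_integers n) (f \<omega>) x = smooth_sum k (\<lambda>P. real (nrm P)) Q x (f \<omega>)"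
proof -
  have finQ: "finite Q" unfolding Q by (rule finite_primes_le)
  note PI = nonzero_prime_ideals_eq[unfolded cyclotomic_integers_eq]
  have "f \<omega> (fac e S) = (\<Prod>P\<in>S. f \<omega> P ^ e P)" if "finite S" "S \<subseteq> Collect is_prime" for S e
    using f \<omega> that unfolding random_completely_multiplicative_def cyclotomic_integers_eq PI fac_def by blast
  from ideal_partial_sum_eq[OF Q finQ k this]
  have "ideal_partial_sum RK (f \<omega>) x =
    (\<Sum>e | e \<in> Q \<rightarrow>\<^sub>E {..k} \<and> (\<Prod>P\<in>Q. real (nrm P) ^ e P) \<le> x. \<Prod>P\<in>Q. (f \<omega> P / real (nrm P)) ^ e P)" by simp
  also have "\<dots> = smooth_sum k (\<lambda>P. real (nrm P)) Q x (f \<omega>)"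
    unfolding smooth_sum_def
    using finQ by (subst sum.inter_filter[symmetric]) (auto intro: finite_PiE)
  finally show ?thesis by (simp add: cyclotomic_integers_eq)
qed

lemma negative_prob_large:
  assumes f: "random_completely_multiplicative (cyclotomic_integers n) M f"
    and A: "A > 0" and x: "x \<ge> 3" "ln (ln x) \<ge> 1" and nA: "real n < ln x powr A"
    and c: "c = 5 * A + 1203"
    and large: "72 * c * ln (ln x) * exp (8 * c * ln (ln x)) \<le> exp (ln x / (3 * (24 * c + 2) * ln (ln x)))"
  shows "measure M {\<omega> \<in> space M. ideal_partial_sum (cyclotomic_integers n) (f \<omega>) x < 0}
    \<le> exp (- exp (ln x / (3 * (24 * c + 2) * ln (ln x))))"
proof -
  define Q where "Q = {P. is_prime P \<and> real (nrm P) \<le> x}"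
  have finQ: "finite Q" unfolding Q_def by (rule finite_primes_le)
  obtain k0 where "x < 2 ^ k0" using real_arch_pow[of 2 x] by auto
  moreover have "(2::real) ^ k0 \<le> 2 ^ max k0 1" by (intro power_increasing) auto
  ultimately obtain k :: nat where k: "x < 2 ^ k" "k \<ge> 1" using that[of "max k0 1"] by fastforce
  have lnx: "ln x > 0" using x by simp
  have "ln (real n) \<le> ln (ln x powr A)" using nA n1 by (intro ln_mono) auto
  also have "\<dots> = A * ln (ln x)" using lnx by (simp add: ln_powr)
  finally have ln_n: "ln (real n) \<le> A * ln (ln x)" .
  note f' = f[unfolded random_completely_multiplicative_def nonzero_prime_ideals_eq]
  have E: "(\<Sum>P\<in>Q. 1 / real (nrm P)) \<le> c * ln (ln x)"
  proof -
    have "(\<Sum>P\<in>Q. 1 / real (nrm P)) \<le> 5 * ln (real n) + 3 + 400 * (2 + ln (ln x))"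
      by (rule sum_inverse_nrm[OF x(1) Q_def])
    \<comment> \<open>Here 1203 = 3 + 800 + 400, the constants being absorbed by ln ln x >= 1, and 5
      A comes from ln n <= A ln ln x.\<close>
    also have "\<dots> \<le> c * ln (ln x)" unfolding c using ln_n x(2) by (simp add: algebra_simps)
    finally show ?thesis .
  qed
  have "{\<omega> \<in> space M. ideal_partial_sum (cyclotomic_integers n) (f \<omega>) x < 0} =
      {\<omega> \<in> space M. smooth_sum k (\<lambda>P. real (nrm P)) Q x (f \<omega>) < 0}"
    using ideal_partial_sum_eq_smooth_sum[OF f _ Q_def k(1)] by auto
  also have "measure M \<dots> \<le> exp (- exp (ln x / (3 * (24 * c + 2) * ln (ln x))))"
  proof (rule smooth_sum_negative_prob[where I = "Collect is_prime" and c = c and L = "ln (ln x)"])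
    show "prob_space M" using f' by blast
    show "prob_space.indep_vars M (\<lambda>_. borel) (\<lambda>i \<omega>. f \<omega> i) (Collect is_prime)" using f' by blast
    show "real (nrm P) \<ge> 2" if "P \<in> Q" for P using nrm_prime_ge_2[of P] that by (simp add: Q_def)
    show "0 < c" using A by (simp add: c)
  qed (use f' finQ k E x lnx large in \<open>auto simp: Q_def\<close>)
  finally show ?thesis .
qed

text \<open>At most one prime ideal has norm below 3, and its norm is 2, so the sum is 1, 1/2 or
  3/2.\<close>

lemma partial_sum_rationals_pos:
  assumes n: "n = 1" and f: "random_completely_multiplicative (cyclotomic_integers n) M f"
    and \<omega>: "\<omega> \<in> space M" and x: "1 < x" "x < 3"
  shows "ideal_partial_sum (cyclotomic_integers n) (f \<omega>) x > 0"
proof -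
  define Q where "Q = {P. is_prime P \<and> real (nrm P) \<le> x}"
  have finQ: "finite Q" unfolding Q_def by (rule finite_primes_le)
  have nrm2: "nrm P = 2" if "P \<in> Q" for P
    using nrm_prime_ge_2[of P] that x(2) by (simp add: Q_def)
  have "Q \<subseteq> {P. is_prime P \<and> of_nat 2 \<in> P}"
  proof
    fix P assume P: "P \<in> Q"
    hence pP: "is_prime P" by (simp add: Q_def)
    obtain p :: nat where p: "prime p" "of_nat p \<in> P" using prime_in_prime[OF pP] by blast
    obtain j where j: "j > 0" "nrm P = p ^ j" using nrm_char[OF pP p] by blast
    have "p dvd 2" using j nrm2[OF P] by (metis dvd_power)
    hence "p = 2" using p(1) by (simp add: primes_dvd_imp_eq)
    thus "P \<in> {P. is_prime P \<and> of_nat 2 \<in> P}" using pP p by auto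
  qed
  hence "card Q \<le> card {P. is_prime P \<and> of_nat 2 \<in> P}"
    using primes_above(1)[of 2] by (intro card_mono) auto
  also have "\<dots> \<le> totient (n div 2 ^ multiplicity 2 n)" using primes_above(1)[of 2] by auto
  also have "\<dots> = 1" by (simp add: n)
  finally have "card Q \<le> 1" .
  have empty: "smooth_sum 2 N {} t s = (if 1 \<le> t then 1 else 0)" for N :: "complex set \<Rightarrow> real" and t s
    by (simp add: smooth_sum_def)
  have "smooth_sum 2 (\<lambda>P. real (nrm P)) Q x (f \<omega>) > 0"
  proof (cases "Q = {}")
    case True
    thus ?thesis using x by (simp add: empty)
  next
    case False
    then obtain P where P: "Q = {P}" using \<open>card Q \<le> 1\<close> finQ by (metis card_le_Suc0_iff_eq One_nat_def is_singletonI' is_singletonE)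
    have nP: "nrm P = 2" using nrm2 P by simp
    have "is_prime P" using P by (auto simp: Q_def)
    hence "P \<in> nonzero_prime_ideals (cyclotomic_integers n)"
      unfolding nonzero_prime_ideals_eq by blast
    hence "f \<omega> P \<in> {1, - 1}"
      using f[unfolded random_completely_multiplicative_def, THEN conjunct2, THEN conjunct2, THEN conjunct1] \<omega>
      by blast
    hence fP: "f \<omega> P = 1 \<or> f \<omega> P = - 1" by simp
    have sum2: "(\<Sum>i\<le>2. g i) = g 0 + g 1 + g 2" for g :: "nat \<Rightarrow> real" by (simp add: numeral_2_eq_2)
    have "smooth_sum 2 (\<lambda>P. real (nrm P)) Q x (f \<omega>) =
        (\<Sum>i\<le>2. (f \<omega> P / 2) ^ i * (if 1 \<le> x / 2 ^ i then 1 else 0))"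
      unfolding P using smooth_sum_insert[of "{}" P "\<lambda>P. real (nrm P)" 2 x "f \<omega>"] nP by (simp add: empty)
    \<comment> \<open>The exponent 2 drops out because x < 4.\<close>
    also have "\<dots> = 1 + f \<omega> P / 2 * (if 1 \<le> x / 2 then 1 else 0)"
      unfolding sum2 using x by simp
    finally show ?thesis using fP by (elim disjE) simp_all
  qed
  thus ?thesis using ideal_partial_sum_eq_smooth_sum[OF f \<omega> Q_def, of 2] x by simp
qed

end

text \<open>For \<open>x\<close> slightly larger than \<open>e\<close> the right-hand side is tiny, but then \<open>n = 1\<close> and the sum is
  positive; on bounded ranges away from \<open>e\<close> a large \<open>C\<close> makes the bound trivial, and for
  \<open>x \<le> e\<close> the exponent is not positive (\<open>x = e\<close> gives a division by \<open>0\<close>).\<close>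

theorem theorem1p2:
  shows "\<exists>K>0. \<forall>A>0. \<exists>C>0.
    \<forall>(n :: nat) (x :: real) (M :: 'w measure) (f :: 'w \<Rightarrow> complex set \<Rightarrow> real).
      n \<ge> 1 \<longrightarrow> x > 1 \<longrightarrow> real n < ln x powr A \<longrightarrow>
      random_completely_multiplicative (cyclotomic_integers n) M f \<longrightarrow>
      measure M {\<omega> \<in> space M. ideal_partial_sum (cyclotomic_integers n) (f \<omega>) x < 0}
        \<le> K * exp (- exp (ln x / (C * ln (ln x))))"
proof (rule exI[of _ "exp (exp 1)"], intro conjI allI impI)
  fix A :: real assume A: "A > 0"
  define c where "c = 5 * A + 1203"
  define D where "D = 3 * (24 * c + 2)"
  have c: "c > 0" using A by (simp add: c_def)
  \<comment> \<open>The left side is ln ln x times a power of ln x; the right side outgrows every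
    power of ln x.\<close>
  have "eventually (\<lambda>x. 72 * c * ln (ln x) * exp (8 * c * ln (ln x)) \<le> exp (ln x / (3 * (24 * c + 2) * ln (ln x)))) at_top"
    using c by real_asymp
  moreover have "eventually (\<lambda>x::real. ln (ln x) \<ge> 1) at_top" by real_asymp
  ultimately have "eventually (\<lambda>x. 72 * c * ln (ln x) * exp (8 * c * ln (ln x)) \<le> exp (ln x / (D * ln (ln x)))
      \<and> ln (ln x) \<ge> 1 \<and> x \<ge> 3) at_top"
    unfolding D_def using eventually_ge_at_top[of 3] by eventually_elim simp
  then obtain x0 where x0: "\<And>x. x \<ge> x0 \<Longrightarrow> 72 * c * ln (ln x) * exp (8 * c * ln (ln x)) \<le> exp (ln x / (D * ln (ln x)))"
      "\<And>x. x \<ge> x0 \<Longrightarrow> ln (ln x) \<ge> 1" "\<And>x. x \<ge> x0 \<Longrightarrow> x \<ge> 3"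
    by (auto simp: eventually_at_top_linorder)
  \<comment> \<open>For 1 < x below the second bound ln x powr A < 2, which forces n = 1; the cap 3
    leaves only primes of norm 2 in the sum.\<close>
  define x1 where "x1 = min 3 (exp (2 powr (1 / A)))"
  have e3: "exp 1 < (3::real)" using e_less_272 by simp
  have "(2::real) powr 0 < 2 powr (1 / A)" using A by (intro powr_less_mono) auto
  hence x1e: "exp 1 < x1" unfolding x1_def using e3 by simp
  hence x1pos: "x1 > 0" by (rule less_trans[OF exp_gt_zero])
  have "ln (exp 1) < ln x1" using x1e by (intro ln_strict_mono) auto
  hence lx1: "ln x1 > 1" by simp
  have llx1: "ln (ln x1) > 0" using lx1 by simp
  have x03: "x0 \<ge> 3" using x0(3)[of x0] by simp
  have lx0: "ln x0 > 0" using x03 by simp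
  \<comment> \<open>\<open>D\<close> serves for x >= x0; the other value makes ln x / (C ln ln x) at
    most 1 between x1 and x0.\<close>
  define C where "C = max D (ln x0 / ln (ln x1))"
  have Dpos: "D > 0" using c by (simp add: D_def)
  have CD: "C \<ge> D" "C \<ge> ln x0 / ln (ln x1)" "C > 0" using Dpos by (auto simp: C_def)
  show "\<exists>C>0. \<forall>(n :: nat) (x :: real) (M :: 'w measure) (f :: 'w \<Rightarrow> complex set \<Rightarrow> real).
      n \<ge> 1 \<longrightarrow> x > 1 \<longrightarrow> real n < ln x powr A \<longrightarrow>
      random_completely_multiplicative (cyclotomic_integers n) M f \<longrightarrow>
      measure M {\<omega> \<in> space M. ideal_partial_sum (cyclotomic_integers n) (f \<omega>) x < 0}
        \<le> exp (exp 1) * exp (- exp (ln x / (C * ln (ln x))))"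
  proof (intro exI[of _ C] conjI allI impI CD)
    fix n :: nat and x :: real and M :: "'w measure" and f :: "'w \<Rightarrow> complex set \<Rightarrow> real"
    assume n: "n \<ge> 1" and x: "x > 1" and nA: "real n < ln x powr A"
      and f: "random_completely_multiplicative (cyclotomic_integers n) M f"
    interpret cyclotomic n by unfold_locales (rule n)
    have pM: "prob_space M" using f by (simp add: random_completely_multiplicative_def)
    let ?p = "measure M {\<omega> \<in> space M. ideal_partial_sum (cyclotomic_integers n) (f \<omega>) x < 0}"
    have p1: "?p \<le> 1" by (rule prob_space.prob_le_1[OF pM])
    have lnx: "ln x > 0" using x by simp
    \<comment> \<open>The factor exp (exp 1), independent of A, lifts the bound to at least 1 as
      soon as the inner exponent is at most 1.\<close>
    have trivial: "?p \<le> exp (exp 1) * exp (- exp (ln x / (C * ln (ln x))))" if "ln x / (C * ln (ln x)) \<le> 1"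
    proof -
      have "exp (- exp 1) \<le> exp (- exp (ln x / (C * ln (ln x))))" using that by simp
      hence "exp (exp 1) * exp (- exp 1) \<le> exp (exp 1) * exp (- exp (ln x / (C * ln (ln x))))"
        by (intro mult_left_mono) auto
      moreover have "exp (exp 1) * exp (- exp 1) = (1::real)" by (simp flip: exp_add)
      ultimately show ?thesis using p1 by linarith
    qed
    consider "x \<le> exp 1" | "exp 1 < x" "x < x1" | "x1 \<le> x" "x < x0" | "x0 \<le> x" by linarith
    thus "?p \<le> exp (exp 1) * exp (- exp (ln x / (C * ln (ln x))))"
    proof cases
      case 1
      have "ln x \<le> ln (exp 1)" using 1 x by (intro ln_mono) auto
      hence "ln x \<le> 1" by simp
      hence "ln (ln x) \<le> 0" using lnx by simp
      hence "C * ln (ln x) \<le> 0" using CD(3) by (simp add: mult_nonneg_nonpos)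
      hence "ln x / (C * ln (ln x)) \<le> 0" using lnx by (intro divide_nonneg_nonpos) auto
      thus ?thesis by (intro trivial) simp
    next
      case 2
      have "ln x < ln (exp (2 powr (1 / A)))" using 2 x by (intro ln_strict_mono) (auto simp: x1_def)
      hence "ln x powr A < (2 powr (1 / A)) powr A" using A lnx by (intro powr_less_mono2) auto
      also have "\<dots> = 2" using A by (simp add: powr_powr)
      finally have "n = 1" using nA n by simp
      hence "ideal_partial_sum (cyclotomic_integers n) (f \<omega>) x > 0" if "\<omega> \<in> space M" for \<omega>
        using partial_sum_rationals_pos[OF _ f that x] 2 by (simp add: x1_def)
      hence "{\<omega> \<in> space M. ideal_partial_sum (cyclotomic_integers n) (f \<omega>) x < 0} = {}"
        by (auto simp: not_less less_imp_le)
      thus ?thesis by (simp only: measure_empty) simp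
    next
      case 3
      have l: "ln x1 \<le> ln x" using 3 x1pos by (intro ln_mono) auto
      have ll: "ln (ln x1) \<le> ln (ln x)" by (rule ln_mono[OF l]) (use lx1 in simp)
      have "ln x \<le> ln x0" using 3 x by (intro ln_mono) auto
      also have "\<dots> = ln x0 / ln (ln x1) * ln (ln x1)" using llx1 by simp
      also have "\<dots> \<le> C * ln (ln x)" using CD ll llx1 by (intro mult_mono) auto
      finally have "ln x / (C * ln (ln x)) \<le> 1" using lnx CD(3) ll llx1 by (simp add: divide_le_eq)
      thus ?thesis by (rule trivial)
    next
      case 4
      have "?p \<le> exp (- exp (ln x / (D * ln (ln x))))"
        unfolding D_def
        by (rule negative_prob_large[OF f A x0(3,2)[OF 4] nA c_def x0(1)[OF 4, unfolded D_def]])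
      also have "\<dots> \<le> exp (- exp (ln x / (C * ln (ln x))))"
      proof -
        have "D * ln (ln x) \<le> C * ln (ln x)" using CD x0(2)[OF 4] by (intro mult_right_mono) auto
        moreover have "0 < D * ln (ln x)" using Dpos x0(2)[OF 4] by simp
        ultimately have "ln x / (C * ln (ln x)) \<le> ln x / (D * ln (ln x))"
          using lnx by (intro frac_le) auto
        thus ?thesis by simp
      qed
      also have "\<dots> \<le> exp (exp 1) * exp (- exp (ln x / (C * ln (ln x))))" by simp
      finally show ?thesis .
    qed
  qed
qed simp

end
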